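(* Let $\Omega\subset\mathbb{R}^d$ be a connected open set and $H$ an RKHS on $\Omega$ with kernel $k$, continuously included in the space of $C^\infty$ functions and consisting of real analytic functions. Let $f:\Omega\to\Omega$ be of class $C^\infty$ and $p\in\Omega$ with $f(p)=p$ and $V_p\subset D(C_f)$. Let $0\le m\le n$ be integers, let $X_N=(x_1,\dots,x_N)\in\Omega^N$, $Y_N=(y_1,\dots,y_N)\in\Omega^N$ with $y_i=f(x_i)$ for all $i$, and assume $r_n\le N$ and $\mathrm{span}\{\pi_nk_{x_1},\dots,\pi_nk_{x_N}\}=V_{p,n}$. Let $\mathbf{C}_{f,m}^\star$ be the matrix of $C_f^*|_{V_{p,m}}$ with respect to the basis $\{v_1,\dots,v_{r_m}\}$. Define the $r_m\times r_m$ matrices $\widehat{\mathbf{C}}_{m,n,N}$ and $\mathbf{E}_{m,n}^{X_N}$ by $$\mathbf{G}_m^{-1}\mathbf{V}_m^{Y_N}(\mathbf{V}_n^{X_N})^\dagger\mathbf{G}_n=\begin{pmatrix}\widehat{\mathbf{C}}_{m,n,N}&*\end{pmatrix},\qquad \mathbf{G}_n\Big(N^{-1}\mathbf{V}_n^{X_N}(\mathbf{V}_n^{X_N})^*\Big)^{-1}\mathbf{G}_n=\begin{pmatrix}\mathbf{E}_{m,n}^{X_N}&*\\ *&*\end{pmatrix}.$$ Then $$\big\|\mathbf{C}_{f,m}^\star-\widehat{\mathbf{C}}_{m,n,N}\big\|\le\big\|C_f|_{V_{p,m}}\big\|_{\rm op}\,\big\|\mathbf{G}_m^{-1/2}\big\|_{\rm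 op}\,\big\|\mathbf{E}_{m,n}^{X_N}\big\|_{\rm op}^{1/2}\sqrt{\frac1N\sum_{i=1}^N\mathcal{E}_{p,n}(x_i)^2}.$$
   Context: Conventions: $k_x:=k(x,\cdot)\in H$, $\langle h,k_x\rangle_H=h(x)$, inner product linear in the first variable. $C_fh:=h\circ f$ on $D(C_f)=\{h\in H:h\circ f\in H\}$; $C_f^*$ is its adjoint. $V_{p,n}:=\mathrm{span}\{\partial_x^\alpha k(x,\cdot)|_{x=p}:|\alpha|\le n\}\subset H$, $V_p:=\bigcup_nV_{p,n}$ (dense in $H$ under the hypotheses, so $C_f$ is densely defined), $r_n:=\dim V_{p,n}$; $C_f^*$ maps $V_{p,n}$ into itself because $f(p)=p$. $\pi_n:H\to V_{p,n}$ is the orthogonal projection, and $\mathcal{E}_{p,n}(x):=\min_{v\in V_{p,n}}\|k_x-v\|_H=\|k_x-\pi_nk_x\|_H$. Fix a basis $\{v_i\}_{i\ge1}$ of $V_p$ such that $\{v_1,\dots,v_{r_n}\}$ is a basis of $V_{p,n}$ for every $n$. Put $\mathbf{v}_n(x):=(\overline{v_i(x)})_{i=1}^{r_n}$, $\mathbf{G}_n:=(\langle v_j,v_i\rangle_H)_{i,j=1}^{r_n}$ (entry in row $i$, column $j$), and $\mathbf{V}_n^X:=(\mathbf{v}_n(x_1),\dots,\mathbf{v}_n(x_N))\in\mathbb{C}^{r_n\times N}$ for $X=(x_1,\dots,x_N)$. The matrix $\mathbf{C}$ of a linear map $T$ in a basis is given by $Tv_j=\sum_i\mathbf{C}_{ij}v_i$.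 $\dagger$ is the Moore–Penrose pseudo-inverse, $\|\cdot\|$ the Frobenius norm, $\|\cdot\|_{\rm op}$ the operator norm (for $C_f|_{V_{p,m}}$, as a map $V_{p,m}\to H$). *)

theory Defs
  imports
    "HOL-Analysis.Analysis"
    "HOL-Library.Function_Algebras"
    "Jordan_Normal_Form.Gauss_Jordan_Elimination"
    "Jordan_Normal_Form.Schur_Decomposition"
begin

definition partial_deriv :: "'d::finite \<Rightarrow> (real^'d \<Rightarrow> 'b::real_normed_vector) \<Rightarrow> real^'d \<Rightarrow> 'b"
  where "partial_deriv i g x = vector_derivative (\<lambda>t. g (x + t *\<^sub>R axis i 1)) (at 0)"

primrec Ck_on :: "nat \<Rightarrow> (real^'d::finite) set \<Rightarrow> (real^'d \<Rightarrow> 'b::real_normed_vector) \<Rightarrow> bool"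
  where
    "Ck_on 0 \<Omega> g \<longleftrightarrow> continuous_on \<Omega> g"
  | "Ck_on (Suc n) \<Omega> g \<longleftrightarrow> continuous_on \<Omega> g \<and>
       (\<forall>i. (\<forall>x\<in>\<Omega>. (\<lambda>t. g (x + t *\<^sub>R axis i 1)) differentiable (at 0)) \<and>
            Ck_on n \<Omega> (partial_deriv i g))"

definition C_infinity_on :: "(real^'d::finite) set \<Rightarrow> (real^'d \<Rightarrow> 'b::real_normed_vector) \<Rightarrow> bool"
  where "C_infinity_on \<Omega> g \<longleftrightarrow> (\<forall>n. Ck_on n \<Omega> g)"

text \<open>A multi-index is a function \<open>\<alpha> :: 'd \<Rightarrow> nat\<close> of length \<open>sum \<alpha> UNIV\<close>. The index type
  carries no order, so the coordinates are differentiated in an arbitrary fixed order; for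
  smooth functions the choice is immaterial.\<close>

definition coordinates :: "'d::finite list"
  where "coordinates = (SOME is. distinct is \<and> set is = UNIV)"

definition multi_deriv ::
    "('d::finite \<Rightarrow> nat) \<Rightarrow> (real^'d \<Rightarrow> 'b::real_normed_vector) \<Rightarrow> real^'d \<Rightarrow> 'b"
  where "multi_deriv \<alpha> g = foldr (\<lambda>i. partial_deriv i ^^ \<alpha> i) coordinates g"

definition real_analytic_on :: "(real^'d::finite) set \<Rightarrow> (real^'d \<Rightarrow> complex) \<Rightarrow> bool"
  where "real_analytic_on \<Omega> g \<longleftrightarrow>
    (\<forall>a\<in>\<Omega>. \<exists>\<rho>>0. \<exists>c :: ('d \<Rightarrow> nat) \<Rightarrow> complex. \<forall>x\<in>ball a \<rho>.
       ((\<lambda>\<alpha>. c \<alpha> * of_real (\<Prod>i\<in>UNIV. (vec_nth x i - vec_nth a i) ^ \<alpha> i)) has_sum g x) UNIV)"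

interpretation cfun: vector_space "\<lambda>(c::complex) (h :: 'a \<Rightarrow> complex) x. c * h x"
  by unfold_locales (auto simp: fun_eq_iff algebra_simps)

definition hnorm :: "('h \<Rightarrow> 'h \<Rightarrow> complex) \<Rightarrow> 'h \<Rightarrow> real"
  where "hnorm ip h = sqrt (Re (ip h h))"

text \<open>The inner product is only constrained on \<open>H\<close>; it is linear in its first argument.\<close>

locale hilbert_function_space =
  fixes H :: "('a \<Rightarrow> complex) set"
    and ip :: "('a \<Rightarrow> complex) \<Rightarrow> ('a \<Rightarrow> complex) \<Rightarrow> complex"
  assumes subspace: "cfun.subspace H"
    and ip_add_left: "\<lbrakk>g \<in> H; h \<in> H; u \<in> H\<rbrakk> \<Longrightarrow> ip (g + h) u = ip g u + ip h u"
    and ip_scale_left: "\<lbrakk>g \<in> H; h \<in> H\<rbrakk> \<Longrightarrow> ip (\<lambda>x. c * g x) h = c * ip g h"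
    and ip_cnj: "\<lbrakk>g \<in> H; h \<in> H\<rbrakk> \<Longrightarrow> ip g h = cnj (ip h g)"
    and ip_pos: "\<lbrakk>h \<in> H; h \<noteq> 0\<rbrakk> \<Longrightarrow> 0 < Re (ip h h)"
    and complete: "\<lbrakk>\<And>n::nat. s n \<in> H;
        \<And>e. 0 < e \<Longrightarrow> \<exists>M. \<forall>i\<ge>M. \<forall>j\<ge>M. hnorm ip (s i - s j) < e\<rbrakk>
      \<Longrightarrow> \<exists>h\<in>H. (\<lambda>n. hnorm ip (s n - h)) \<longlonglongrightarrow> 0"

text \<open>A function on \<open>\<Omega>\<close> is represented by its extension by zero to the whole type, so that
  equality of representatives is equality on \<open>\<Omega>\<close>.\<close>

locale rkhs = hilbert_function_space H ip
  for \<Omega> :: "'a set"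
    and H :: "('a \<Rightarrow> complex) set"
    and ip :: "('a \<Rightarrow> complex) \<Rightarrow> ('a \<Rightarrow> complex) \<Rightarrow> complex" +
  fixes k :: "'a \<Rightarrow> 'a \<Rightarrow> complex"
  assumes zero_outside: "\<lbrakk>h \<in> H; x \<notin> \<Omega>\<rbrakk> \<Longrightarrow> h x = 0"
    and kernel_mem: "x \<in> \<Omega> \<Longrightarrow> k x \<in> H"
    and reproducing: "\<lbrakk>h \<in> H; x \<in> \<Omega>\<rbrakk> \<Longrightarrow> ip h (k x) = h x"

text \<open>Continuity of the inclusion refers to the usual topology of the space of smooth functions,
  that is, uniform convergence of every partial derivative on every compact subset of \<open>\<Omega>\<close>.\<close>

definition continuously_included_smooth ::
    "(real^'d::finite) set \<Rightarrow> (real^'d \<Rightarrow> complex) set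
      \<Rightarrow> ((real^'d \<Rightarrow> complex) \<Rightarrow> (real^'d \<Rightarrow> complex) \<Rightarrow> complex) \<Rightarrow> bool"
  where "continuously_included_smooth \<Omega> H ip \<longleftrightarrow>
    (\<forall>h\<in>H. C_infinity_on \<Omega> h) \<and>
    (\<forall>h\<in>H. \<forall>\<alpha> K. compact K \<and> K \<subseteq> \<Omega> \<longrightarrow>
       (\<forall>\<epsilon>>0. \<exists>\<delta>>0. \<forall>g\<in>H. hnorm ip (g - h) < \<delta> \<longrightarrow>
          (\<forall>x\<in>K. cmod (multi_deriv \<alpha> g x - multi_deriv \<alpha> h x) < \<epsilon>)))"

definition V_space :: "(real^'d::finite \<Rightarrow> real^'d \<Rightarrow> complex) \<Rightarrow> real^'d \<Rightarrow> nat
    \<Rightarrow> (real^'d \<Rightarrow> complex) set"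
  where "V_space k p n =
    cfun.span {(\<lambda>y. multi_deriv \<alpha> (\<lambda>x. k x y) p) |\<alpha>. sum \<alpha> UNIV \<le> n}"

definition V_dim :: "(real^'d::finite \<Rightarrow> real^'d \<Rightarrow> complex) \<Rightarrow> real^'d \<Rightarrow> nat \<Rightarrow> nat"
  where "V_dim k p n = cfun.dim (V_space k p n)"

definition orth_proj :: "(('a \<Rightarrow> complex) \<Rightarrow> ('a \<Rightarrow> complex) \<Rightarrow> complex)
    \<Rightarrow> ('a \<Rightarrow> complex) set \<Rightarrow> ('a \<Rightarrow> complex) \<Rightarrow> ('a \<Rightarrow> complex)"
  where "orth_proj ip V h = (THE v. v \<in> V \<and> (\<forall>w\<in>V. ip (h - v) w = 0))"

text \<open>The infimum is a minimum whenever \<open>V\<close> is finite-dimensional.\<close>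

definition proj_error :: "(('a \<Rightarrow> complex) \<Rightarrow> ('a \<Rightarrow> complex) \<Rightarrow> complex)
    \<Rightarrow> ('a \<Rightarrow> complex) set \<Rightarrow> ('a \<Rightarrow> complex) \<Rightarrow> real"
  where "proj_error ip V h = (INF v\<in>V. hnorm ip (h - v))"

definition comp_op :: "'a set \<Rightarrow> ('a \<Rightarrow> 'a) \<Rightarrow> ('a \<Rightarrow> complex) \<Rightarrow> ('a \<Rightarrow> complex)"
  where "comp_op \<Omega> f h = (\<lambda>x. if x \<in> \<Omega> then h (f x) else 0)"

definition comp_dom :: "'a set \<Rightarrow> ('a \<Rightarrow> complex) set \<Rightarrow> ('a \<Rightarrow> 'a) \<Rightarrow> ('a \<Rightarrow> complex) set"
  where "comp_dom \<Omega> H f = {h \<in> H. comp_op \<Omega> f h \<in> H}"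

text \<open>Adjoint of a densely defined operator \<open>T\<close> with domain \<open>D\<close>, meaningful at those \<open>g\<close> for
  which a representing vector exists.\<close>

definition adjoint_op :: "('h \<Rightarrow> 'h \<Rightarrow> complex) \<Rightarrow> 'h set \<Rightarrow> 'h set \<Rightarrow> ('h \<Rightarrow> 'h) \<Rightarrow> 'h \<Rightarrow> 'h"
  where "adjoint_op ip H D T g = (THE u. u \<in> H \<and> (\<forall>h\<in>D. ip (T h) g = ip h u))"

definition comp_adj :: "'a set \<Rightarrow> ('a \<Rightarrow> complex) set
    \<Rightarrow> (('a \<Rightarrow> complex) \<Rightarrow> ('a \<Rightarrow> complex) \<Rightarrow> complex)
    \<Rightarrow> ('a \<Rightarrow> 'a) \<Rightarrow> ('a \<Rightarrow> complex) \<Rightarrow> ('a \<Rightarrow> complex)"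
  where "comp_adj \<Omega> H ip f = adjoint_op ip H (comp_dom \<Omega> H f) (comp_op \<Omega> f)"

definition op_norm_on :: "('h \<Rightarrow> 'h \<Rightarrow> complex) \<Rightarrow> 'h set \<Rightarrow> ('h \<Rightarrow> 'h) \<Rightarrow> real"
  where "op_norm_on ip V T = (SUP h\<in>{h \<in> V. hnorm ip h \<le> 1}. hnorm ip (T h))"

definition indexed_basis :: "(nat \<Rightarrow> 'a \<Rightarrow> complex) \<Rightarrow> nat set \<Rightarrow> ('a \<Rightarrow> complex) set \<Rightarrow> bool"
  where "indexed_basis v I S \<longleftrightarrow>
    inj_on v I \<and> cfun.independent (v ` I) \<and> cfun.span (v ` I) = S"

text \<open>Indices start at 0. The index set of the basis of the union of the \<open>V_space k p n\<close> is all
  of \<open>nat\<close> exactly when that union is infinite-dimensional.\<close>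

definition adapted_basis :: "(real^'d::finite \<Rightarrow> real^'d \<Rightarrow> complex) \<Rightarrow> real^'d
    \<Rightarrow> (nat \<Rightarrow> real^'d \<Rightarrow> complex) \<Rightarrow> bool"
  where "adapted_basis k p v \<longleftrightarrow>
    indexed_basis v (\<Union>n. {..<V_dim k p n}) (\<Union>n. V_space k p n) \<and>
    (\<forall>n. indexed_basis v {..<V_dim k p n} (V_space k p n))"

definition matrix_in_basis :: "(nat \<Rightarrow> 'a \<Rightarrow> complex) \<Rightarrow> nat
    \<Rightarrow> (('a \<Rightarrow> complex) \<Rightarrow> ('a \<Rightarrow> complex)) \<Rightarrow> complex Matrix.mat"
  where "matrix_in_basis v r T =
    Matrix.mat r r (\<lambda>(i, j). cfun.representation (v ` {..<r}) (T (v j)) (v i))"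

definition gram_mat :: "(('a \<Rightarrow> complex) \<Rightarrow> ('a \<Rightarrow> complex) \<Rightarrow> complex)
    \<Rightarrow> (nat \<Rightarrow> 'a \<Rightarrow> complex) \<Rightarrow> nat \<Rightarrow> complex Matrix.mat"
  where "gram_mat ip v r = Matrix.mat r r (\<lambda>(i, j). ip (v j) (v i))"

definition data_mat :: "(nat \<Rightarrow> 'a \<Rightarrow> complex) \<Rightarrow> nat \<Rightarrow> nat \<Rightarrow> (nat \<Rightarrow> 'a) \<Rightarrow> complex Matrix.mat"
  where "data_mat v r N X = Matrix.mat r N (\<lambda>(i, j). cnj (v i (X j)))"

definition pinv :: "complex Matrix.mat \<Rightarrow> complex Matrix.mat"
  where "pinv A = (THE B. B \<in> carrier_mat (dim_col A) (dim_row A) \<and>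
    A * B * A = A \<and> B * A * B = B \<and>
    mat_adjoint (A * B) = A * B \<and> mat_adjoint (B * A) = B * A)"

definition mat_inv :: "complex Matrix.mat \<Rightarrow> complex Matrix.mat"
  where "mat_inv A = the (mat_inverse A)"

definition psd_mat :: "complex Matrix.mat \<Rightarrow> bool"
  where "psd_mat B \<longleftrightarrow> square_mat B \<and> mat_adjoint B = B \<and>
    (\<forall>w\<in>carrier_vec (dim_row B). 0 \<le> Re ((B *\<^sub>v w) \<bullet>c w))"

definition mat_sqrt :: "complex Matrix.mat \<Rightarrow> complex Matrix.mat"
  where "mat_sqrt A = (THE B. B \<in> carrier_mat (dim_row A) (dim_row A) \<and> psd_mat B \<and> B * B = A)"

definition frobenius_norm :: "complex Matrix.mat \<Rightarrow> real"
  where "frobenius_norm A = sqrt (\<Sum>i<dim_row A. \<Sum>j<dim_col A. (cmod (A $$ (i, j)))\<^sup>2)"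

definition cvec_norm :: "complex Matrix.vec \<Rightarrow> real"
  where "cvec_norm w = sqrt (\<Sum>i<dim_vec w. (cmod (vec_index w i))\<^sup>2)"

definition mat_op_norm :: "complex Matrix.mat \<Rightarrow> real"
  where "mat_op_norm A =
    (SUP w\<in>{w \<in> carrier_vec (dim_col A). cvec_norm w \<le> 1}. cvec_norm (A *\<^sub>v w))"

definition leading_block :: "nat \<Rightarrow> complex Matrix.mat \<Rightarrow> complex Matrix.mat"
  where "leading_block r A = Matrix.mat r r (\<lambda>(i, j). A $$ (i, j))"

definition C_hat :: "(('a \<Rightarrow> complex) \<Rightarrow> ('a \<Rightarrow> complex) \<Rightarrow> complex) \<Rightarrow> (nat \<Rightarrow> 'a \<Rightarrow> complex)
    \<Rightarrow> nat \<Rightarrow> nat \<Rightarrow> nat \<Rightarrow> (nat \<Rightarrow> 'a) \<Rightarrow> (nat \<Rightarrow> 'a) \<Rightarrow> complex Matrix.mat"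
  where "C_hat ip v rm rn N X Y = leading_block rm
    (mat_inv (gram_mat ip v rm) * data_mat v rm N Y * pinv (data_mat v rn N X) * gram_mat ip v rn)"

definition E_mat :: "(('a \<Rightarrow> complex) \<Rightarrow> ('a \<Rightarrow> complex) \<Rightarrow> complex) \<Rightarrow> (nat \<Rightarrow> 'a \<Rightarrow> complex)
    \<Rightarrow> nat \<Rightarrow> nat \<Rightarrow> nat \<Rightarrow> (nat \<Rightarrow> 'a) \<Rightarrow> complex Matrix.mat"
  where "E_mat ip v rm rn N X = leading_block rm
    (gram_mat ip v rn *
     mat_inv ((1 / of_nat N) \<cdot>\<^sub>m (data_mat v rn N X * mat_adjoint (data_mat v rn N X))) *
     gram_mat ip v rn)"

end

(*
  Put Q for the matrix with entries <k_{x_j} - pi_n k_{x_j}, C_f v_l>. If every k_{x_j} is replaced by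
  its projection in the data matrix, then the regression recovers C_f^* exactly, because a full row rank
  matrix V has the right inverse V^H (V V^H)^{-1}; hence C^star - C_hat = - G_m^{-1} Q V^+ G_n, restricted
  to the first r_m columns. The Frobenius norm of this product is estimated factor by factor:
  G_m^{-1/2} Q costs the norm of C_f on V_{p,m} times the projection errors, and the Gram matrix of
  V^+ G_n restricted to r_m columns is E / N.

  That C_f^* maps V_{p,m} into itself is seen without the chain rule of higher order: h is orthogonal to
  V_{p,m} iff its derivatives up to order m vanish at p iff h(x) = O(|x - p|^(m+1)), and the last
  property passes to the composition with f because f fixes p and is Lipschitz near p. Uniqueness of the
  adjoint holds because a function orthogonal to all V_{p,n} is flat at p, hence zero by analyticity.
*)
theory Submission
  imports Defs "HOL-Complex_Analysis.Conformal_Mappings"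
    "Jordan_Normal_Form.Jordan_Normal_Form_Existence"
begin

section \<open>Norms, square roots and pseudo-inverses of complex matrices\<close>

text \<open>The inverse Gram matrix of the small space is split as \<open>S * S\<close>. One factor
  costs its operator norm. The other is absorbed by \<open>Q\<close>, because |S q|^2 is the squared
  norm of a function in V_{p,m}, namely the representative there of u |-> <C_f u, e>; Cauchy-Schwarz
  then spends only one power of the norm of C_f. Pseudo-inverse, square root, projection and adjoint
  are definite descriptions, so each becomes usable only through existence and uniqueness. For the
  square root this requires diagonalizing Hermitian matrices, which is extracted from the Jordan
  form. Likewise the suprema that define operator norms must first be shown to be bounded.
  Smoothness means iterated differentiability along coordinate lines in one fixed order, so Taylor
  expansion proceeds one variable at a time. Continuity of the inclusion enters when derivatives at
  p are represented by inner products: the Riesz theorem yields a vector, and evaluating it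
  identifies it as a derivative of the kernel.\<close>

lemma mat_adjoint_dim [simp]:
  "dim_row (mat_adjoint A) = dim_col A" "dim_col (mat_adjoint A) = dim_row A"
  by (simp_all add: mat_adjoint_def)

text \<open>Dimension equations in place of carriers let \<open>simp\<close> discharge the side
  conditions, so that long products can be rebracketed by rewriting.\<close>

lemma mat_mult_assoc:
  fixes A :: "'b::semiring_0 Matrix.mat"
  assumes "dim_col A = dim_row B" "dim_col B = dim_row C"
  shows "A * B * C = A * (B * C)"
  by (rule assoc_mult_mat[of A "dim_row A" "dim_row B" B "dim_row C" C "dim_col C"])
    (use assms in \<open>auto intro: carrier_matI\<close>)

lemma mat_adjoint_carrier [simp]: "A \<in> carrier_mat n m \<Longrightarrow> mat_adjoint A \<in> carrier_mat m n"
  by (metis carrier_matD carrier_matI mat_adjoint_dim)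

lemma mat_adjoint_index [simp]:
  "i < dim_col A \<Longrightarrow> j < dim_row A \<Longrightarrow> mat_adjoint A $$ (i, j) = conjugate (A $$ (j, i))"
  by (simp add: mat_adjoint_def mat_of_rows_index)

lemma mat_adjoint_adjoint [simp]: "mat_adjoint (mat_adjoint A) = A"
  by (rule eq_matI) auto

lemma mat_adjoint_mult:
  fixes A B :: "complex Matrix.mat"
  assumes "dim_col A = dim_row B"
  shows "mat_adjoint (A * B) = mat_adjoint B * mat_adjoint A"
  by (rule eq_matI) (use assms in \<open>auto simp: scalar_prod_def sum_conjugate conjugate_dist_mul mult.commute\<close>)

lemma mat_adjoint_one [simp]: "mat_adjoint (1\<^sub>m n :: complex Matrix.mat) = 1\<^sub>m n"
  by (rule eq_matI) auto

lemma mat_adjoint_diag: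
  "mat_adjoint (mat_diag n d :: complex Matrix.mat) = mat_diag n (\<lambda>i. cnj (d i))"
  by (rule eq_matI) (auto simp: mat_diag_def)

section \<open>Hermitian inner product of vectors and norms of matrices\<close>

lemma cscalar_prod_sum: "u \<bullet>c w = (\<Sum>i<dim_vec w. vec_index u i * cnj (vec_index w i))"
  by (simp add: scalar_prod_def atLeast0LessThan)

lemma cscalar_prod_adjoint:
  fixes A :: "complex Matrix.mat"
  assumes A: "A \<in> carrier_mat n m" and u: "u \<in> carrier_vec m" and w: "w \<in> carrier_vec n"
  shows "(A *\<^sub>v u) \<bullet>c w = u \<bullet>c (mat_adjoint A *\<^sub>v w)"
proof -
  have "(A *\<^sub>v u) \<bullet>c w = (\<Sum>i<n. \<Sum>j<m. A $$ (i,j) * vec_index u j * cnj (vec_index w i))"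
    using A u w by (simp add: cscalar_prod_sum scalar_prod_def sum_distrib_right atLeast0LessThan)
  also have "\<dots> = (\<Sum>j<m. \<Sum>i<n. A $$ (i,j) * vec_index u j * cnj (vec_index w i))"
    by (rule sum.swap)
  also have "\<dots> = u \<bullet>c (mat_adjoint A *\<^sub>v w)"
    using A u w by (simp add: cscalar_prod_sum scalar_prod_def sum_distrib_left atLeast0LessThan
        mult.assoc mult.left_commute)
  finally show ?thesis .
qed

lemma cvec_norm_sq: "w \<bullet>c w = of_real ((cvec_norm w)\<^sup>2)"
  by (simp add: cscalar_prod_sum cvec_norm_def sum_nonneg complex_norm_square del: of_real_power)

lemma cvec_norm_nonneg [simp]: "0 \<le> cvec_norm w"
  by (simp add: cvec_norm_def sum_nonneg)

lemma cvec_norm_zero [simp]: "cvec_norm (0\<^sub>v n) = 0"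
  by (simp add: cvec_norm_def)

lemma cvec_norm_L2: "cvec_norm w = L2_set (\<lambda>i. cmod (vec_index w i)) {..<dim_vec w}"
  by (simp add: cvec_norm_def L2_set_def)

lemma cscalar_prod_le:
  assumes "dim_vec u = dim_vec w"
  shows "cmod (u \<bullet>c w) \<le> cvec_norm u * cvec_norm w"
proof -
  have "cmod (u \<bullet>c w) \<le> (\<Sum>i<dim_vec w. \<bar>cmod (vec_index u i)\<bar> * \<bar>cmod (vec_index w i)\<bar>)"
    unfolding cscalar_prod_sum by (rule order_trans[OF norm_sum]) (simp add: norm_mult)
  also have "\<dots> \<le> cvec_norm u * cvec_norm w"
    unfolding cvec_norm_L2 assms by (rule L2_set_mult_ineq)
  finally show ?thesis .
qed

lemma cvec_norm_smult: "cvec_norm (c \<cdot>\<^sub>v w) = cmod c * cvec_norm w"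
  by (simp add: cvec_norm_def norm_mult power_mult_distrib real_sqrt_mult flip: sum_distrib_left)

lemma cvec_norm_eq_0: "w \<in> carrier_vec n \<Longrightarrow> cvec_norm w = 0 \<longleftrightarrow> w = 0\<^sub>v n"
  by (auto simp: cvec_norm_def sum_nonneg_eq_0_iff vec_eq_iff)

lemma frobenius_norm_nonneg [simp]: "0 \<le> frobenius_norm A"
  by (simp add: frobenius_norm_def sum_nonneg)

lemma frobenius_norm_cols:
  assumes "A \<in> carrier_mat n m"
  shows "(frobenius_norm A)\<^sup>2 = (\<Sum>j<m. (cvec_norm (Matrix.col A j))\<^sup>2)"
  using assms sum.swap[of "\<lambda>i j. (cmod (A $$ (i, j)))\<^sup>2" "{..<m}" "{..<n}"]
  by (simp add: frobenius_norm_def cvec_norm_def sum_nonneg)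

lemma frobenius_norm_adjoint: "frobenius_norm (mat_adjoint A) = frobenius_norm A"
  using sum.swap[of "\<lambda>i j. (cmod (A $$ (i, j)))\<^sup>2" "{..<dim_col A}" "{..<dim_row A}"]
  by (simp add: frobenius_norm_def)

text \<open>Cauchy-Schwarz in every row. The crude constant shows that the supremum in
  \<open>mat_op_norm\<close> is taken over a bounded set, without which a supremum of reals carries
  no information.\<close>

lemma cvec_norm_mult_frobenius:
  assumes A: "A \<in> carrier_mat n m" and w: "w \<in> carrier_vec m"
  shows "cvec_norm (A *\<^sub>v w) \<le> frobenius_norm A * cvec_norm w"
proof -
  have "(cmod (vec_index (A *\<^sub>v w) i))\<^sup>2 \<le> (\<Sum>j<m. (cmod (A $$ (i, j)))\<^sup>2) * (cvec_norm w)\<^sup>2"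
    if i: "i < n" for i
  proof -
    have "cmod (vec_index (A *\<^sub>v w) i) \<le> (\<Sum>j<m. \<bar>cmod (A $$ (i,j))\<bar> * \<bar>cmod (vec_index w j)\<bar>)"
      using A w i by (simp add: scalar_prod_def atLeast0LessThan)
        (rule order_trans[OF norm_sum], simp add: norm_mult)
    also have "\<dots> \<le> L2_set (\<lambda>j. cmod (A $$ (i,j))) {..<m} * cvec_norm w"
      using L2_set_mult_ineq[of "\<lambda>j. cmod (A $$ (i,j))" "\<lambda>j. cmod (vec_index w j)" "{..<m}"] w
      by (simp add: cvec_norm_L2)
    finally have "(cmod (vec_index (A *\<^sub>v w) i))\<^sup>2 \<le> (L2_set (\<lambda>j. cmod (A $$ (i,j))) {..<m} * cvec_norm w)\<^sup>2"
      by (rule power_mono) simp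
    then show ?thesis by (simp add: power_mult_distrib L2_set_def sum_nonneg)
  qed
  then have "(\<Sum>i<n. (cmod (vec_index (A *\<^sub>v w) i))\<^sup>2) \<le> (\<Sum>i<n. (\<Sum>j<m. (cmod (A $$ (i, j)))\<^sup>2) * (cvec_norm w)\<^sup>2)"
    by (intro sum_mono) auto
  then have "(cvec_norm (A *\<^sub>v w))\<^sup>2 \<le> (frobenius_norm A * cvec_norm w)\<^sup>2"
    using A by (simp add: cvec_norm_def[of "A *\<^sub>v w"] frobenius_norm_def sum_nonneg power_mult_distrib sum_distrib_right)
  then show ?thesis by (rule power2_le_imp_le) simp
qed

lemma mat_op_norm_bdd:
  "bdd_above ((\<lambda>w. cvec_norm (A *\<^sub>v w)) ` {w \<in> carrier_vec (dim_col A). cvec_norm w \<le> 1})"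
proof (rule bdd_aboveI2)
  fix w assume "w \<in> {w \<in> carrier_vec (dim_col A). cvec_norm w \<le> 1}"
  then show "cvec_norm (A *\<^sub>v w) \<le> frobenius_norm A"
    using cvec_norm_mult_frobenius[of A "dim_row A" "dim_col A" w]
      mult_left_mono[of "cvec_norm w" 1 "frobenius_norm A"] by auto
qed

lemma mat_op_norm_nonneg [simp]: "0 \<le> mat_op_norm A"
  unfolding mat_op_norm_def
  by (rule cSUP_upper2[OF mat_op_norm_bdd, of "0\<^sub>v (dim_col A)"]) auto

lemma cvec_norm_mult_le:
  assumes A: "A \<in> carrier_mat n m" and w: "w \<in> carrier_vec m"
  shows "cvec_norm (A *\<^sub>v w) \<le> mat_op_norm A * cvec_norm w"
proof (cases "cvec_norm w = 0")
  case True
  then show ?thesis using cvec_norm_mult_frobenius[OF A w] by simp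
next
  case False
  then have pos: "cvec_norm w > 0" using cvec_norm_nonneg[of w] by linarith
  define u where "u = of_real (1 / cvec_norm w) \<cdot>\<^sub>v w"
  have "cvec_norm u = 1" "u \<in> carrier_vec m"
    using pos w by (simp_all add: u_def cvec_norm_smult norm_divide)
  then have "cvec_norm (A *\<^sub>v u) \<le> mat_op_norm A"
    unfolding mat_op_norm_def using A by (intro cSUP_upper[OF _ mat_op_norm_bdd]) auto
  moreover have "A *\<^sub>v u = of_real (1 / cvec_norm w) \<cdot>\<^sub>v (A *\<^sub>v w)"
    unfolding u_def by (rule mult_mat_vec[OF A w])
  ultimately have "cvec_norm (A *\<^sub>v w) / cvec_norm w \<le> mat_op_norm A"
    using pos by (simp add: cvec_norm_smult norm_divide)
  then show ?thesis using pos by (simp add: field_simps)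
qed

text \<open>The squared Frobenius norm is the sum of the squared column norms, and \<open>A\<close>
  acts on the columns of \<open>B\<close> one by one. The free constant \<open>c\<close> admits the
  operator norm as well as bounds obtained in another way.\<close>

lemma frobenius_norm_mult_left:
  assumes A: "A \<in> carrier_mat n m" and B: "B \<in> carrier_mat m l" and c: "0 \<le> c"
    and le: "\<And>w. w \<in> carrier_vec m \<Longrightarrow> cvec_norm (A *\<^sub>v w) \<le> c * cvec_norm w"
  shows "frobenius_norm (A * B) \<le> c * frobenius_norm B"
proof (rule power2_le_imp_le)
  have "(frobenius_norm (A * B))\<^sup>2 = (\<Sum>j<l. (cvec_norm (A *\<^sub>v Matrix.col B j))\<^sup>2)"
    using A B by (subst frobenius_norm_cols[of _ n l]) (auto intro!: sum.cong simp add: col_mult2[OF A B] simp del: col_mult)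
  also have "\<dots> \<le> (\<Sum>j<l. (c * cvec_norm (Matrix.col B j))\<^sup>2)"
    using B by (intro sum_mono power_mono le) auto
  also have "\<dots> = (c * frobenius_norm B)\<^sup>2"
    using frobenius_norm_cols[OF B] by (simp add: power_mult_distrib sum_distrib_left)
  finally show "(frobenius_norm (A * B))\<^sup>2 \<le> (c * frobenius_norm B)\<^sup>2" .
qed (use c in simp)

text \<open>Passing to adjoints reduces this to the left factor. A bound \<open>c\<close> for
  \<open>B\<close> is also one for its adjoint: |B^H y|^2 = <B (B^H y), y> \<le> c |B^H y| |y|, and
  one factor |B^H y| cancels.\<close>

lemma frobenius_norm_mult_right:
  assumes A: "A \<in> carrier_mat n m" and B: "B \<in> carrier_mat m l" and c: "0 \<le> c"
    and le: "\<And>w. w \<in> carrier_vec l \<Longrightarrow> cvec_norm (B *\<^sub>v w) \<le> c * cvec_norm w"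
  shows "frobenius_norm (A * B) \<le> frobenius_norm A * c"
proof -
  have le': "cvec_norm (mat_adjoint B *\<^sub>v y) \<le> c * cvec_norm y" if y: "y \<in> carrier_vec m" for y
  proof -
    let ?z = "mat_adjoint B *\<^sub>v y"
    have z: "?z \<in> carrier_vec l" using mult_mat_vec_carrier[OF mat_adjoint_carrier[OF B] y] .
    have "of_real ((cvec_norm ?z)\<^sup>2) = (B *\<^sub>v ?z) \<bullet>c y"
      using cscalar_prod_adjoint[OF B z y] by (simp add: cvec_norm_sq)
    then have "(cvec_norm ?z)\<^sup>2 = cmod ((B *\<^sub>v ?z) \<bullet>c y)" by (metis norm_of_real abs_power2 real_norm_def)
    also have "\<dots> \<le> cvec_norm (B *\<^sub>v ?z) * cvec_norm y"
      using B y by (intro cscalar_prod_le) auto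
    also have "\<dots> \<le> c * cvec_norm ?z * cvec_norm y"
      by (intro mult_right_mono le z) simp
    finally have "cvec_norm ?z * cvec_norm ?z \<le> cvec_norm ?z * (c * cvec_norm y)"
      by (simp add: power2_eq_square ac_simps)
    then show ?thesis
      using c cvec_norm_nonneg[of ?z] cvec_norm_nonneg[of y]
      by (cases "cvec_norm ?z = 0") auto
  qed
  have "frobenius_norm (A * B) = frobenius_norm (mat_adjoint B * mat_adjoint A)"
    using A B by (simp add: frobenius_norm_adjoint flip: mat_adjoint_mult)
  also have "\<dots> \<le> c * frobenius_norm (mat_adjoint A)"
    by (rule frobenius_norm_mult_left[OF mat_adjoint_carrier[OF B] mat_adjoint_carrier[OF A] c le'])
  finally show ?thesis by (simp add: frobenius_norm_adjoint mult.commute)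
qed

section \<open>Inverses and their adjoints\<close>

lemma mat_inv:
  assumes A: "A \<in> carrier_mat n n"
    and inj: "\<forall>w\<in>carrier_vec n. A *\<^sub>v w = 0\<^sub>v n \<longrightarrow> w = 0\<^sub>v n"
  shows "mat_inv A \<in> carrier_mat n n" "A * mat_inv A = 1\<^sub>m n" "mat_inv A * A = 1\<^sub>m n"
proof -
  have "Determinant.det A \<noteq> 0"
  proof
    assume "Determinant.det A = 0"
    then obtain w where "w \<in> carrier_vec n" "w \<noteq> 0\<^sub>v n" "A *\<^sub>v w = 0\<^sub>v n"
      unfolding det_0_iff_vec_prod_zero_field[OF A] by (elim bexE exE conjE) 
    with inj show False by blast
  qed
  then have unit: "A \<in> Units (ring_mat TYPE(complex) n ())"
    by (rule det_non_zero_imp_unit[OF A])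
  obtain B where B: "mat_inverse A = Some B"
  proof (cases "mat_inverse A")
    case None
    from mat_inverse(1)[OF A this] unit show ?thesis by (rule notE)
  qed
  have eq: "mat_inv A = B"
    by (simp only: mat_inv_def B option.sel)
  show "mat_inv A \<in> carrier_mat n n" "A * mat_inv A = 1\<^sub>m n" "mat_inv A * A = 1\<^sub>m n"
    unfolding eq using mat_inverse(2)[OF A B] by blast+
qed

lemma inverse_mat_unique:
  fixes A :: "'b::semiring_1 Matrix.mat"
  assumes "A \<in> carrier_mat n n" "B \<in> carrier_mat n n" "C \<in> carrier_mat n n"
    and "B * A = 1\<^sub>m n" "A * C = 1\<^sub>m n"
  shows "B = C"
proof -
  have "B = B * (A * C)" using assms(2,5) by simp
  also have "\<dots> = B * A * C" using assoc_mult_mat[OF assms(2,1,3)] by simp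
  also have "\<dots> = C" using assms(3,4) by simp
  finally show ?thesis .
qed

lemma adjoint_inverse:
  fixes A B :: "complex Matrix.mat"
  assumes A: "A \<in> carrier_mat n n" "mat_adjoint A = A" and B: "B \<in> carrier_mat n n"
    and inv: "A * B = 1\<^sub>m n" "B * A = 1\<^sub>m n"
  shows "mat_adjoint B = B"
proof (rule inverse_mat_unique[of A n])
  show "mat_adjoint B * A = 1\<^sub>m n"
    using mat_adjoint_mult[of A B] A B inv by simp
qed (rule A(1) mat_adjoint_carrier[OF B] B inv(1))+

section \<open>Diagonalization of Hermitian matrices\<close>

lemma jordan_matrix_column:
  fixes n_as :: "(nat \<times> 'b::zero_neq_one) list"
  assumes "j < sum_list (map fst n_as)"
  defines "J \<equiv> jordan_matrix n_as"
  shows "(\<forall>i < sum_list (map fst n_as). i \<noteq> j \<longrightarrow> J $$ (i, j) = 0) \<or>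
    (\<exists>l. j = Suc l \<and> J $$ (l, j) = 1 \<and> J $$ (l, l) = J $$ (j, j) \<and>
      (\<forall>i < sum_list (map fst n_as). i \<noteq> j \<longrightarrow> i \<noteq> l \<longrightarrow> J $$ (i, j) = 0))"
  using assms(1) unfolding J_def
proof (induction n_as arbitrary: j)
  case Nil
  then show ?case by simp
next
  case (Cons na n_as)
  obtain n a where na: "na = (n, a)" by (cases na)
  let ?s = "sum_list (map fst n_as)"
  let ?J = "jordan_matrix n_as"
  have idx: "jordan_matrix (na # n_as) $$ (i, l) =
      (if i < n then if l < n then jordan_block n a $$ (i, l) else 0
       else if l < n then 0 else ?J $$ (i - n, l - n))"
    if "i < n + ?s" "l < n + ?s" for i l
    using that by (simp add: na jordan_matrix_Cons)
  show ?case
  \<comment> \<open>Inside the first block, column 0 is diagonal and every later column has its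
    extra 1 one row above the diagonal; a column beyond the block is one of the remaining blocks,
    shifted by \<open>n\<close>.\<close>
  proof (cases "j < n")
    case True
    then show ?thesis
      by (cases j) (auto simp: na idx[simplified na])
  next
    case False
    define j' where "j' = j - n"
    have j: "j = n + j'" "j' < ?s" using False Cons.prems by (auto simp: na j'_def)
    from Cons.IH[OF j(2)] show ?thesis
    proof (elim disjE exE conjE)
      assume z: "\<forall>i<?s. i \<noteq> j' \<longrightarrow> ?J $$ (i, j') = 0"
      then have "jordan_matrix (na # n_as) $$ (i, j) = 0" if "i < n + ?s" "i \<noteq> j" for i
        using that j by (auto simp: idx)
      then show ?thesis by (simp add: na)
    next
      fix l assume l: "j' = Suc l" "?J $$ (l, j') = 1" "?J $$ (l, l) = ?J $$ (j', j')"
        and z: "\<forall>i<?s. i \<noteq> j' \<longrightarrow> i \<noteq> l \<longrightarrow> ?J $$ (i, j') = 0"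
      have "jordan_matrix (na # n_as) $$ (i, j) = 0" if "i < n + ?s" "i \<noteq> j" "i \<noteq> n + l" for i
        using that j z by (auto simp: idx)
      moreover have "j = Suc (n + l)" using j l by simp
      moreover have "jordan_matrix (na # n_as) $$ (n + l, j) = 1"
        "jordan_matrix (na # n_as) $$ (n + l, n + l) = jordan_matrix (na # n_as) $$ (j, j)"
        using j l by (simp_all add: idx)
      ultimately show ?thesis by (auto simp: na)
    qed
  qed
qed

lemma hermitian_form_real:
  fixes A :: "complex Matrix.mat"
  assumes A: "A \<in> carrier_mat n n" "mat_adjoint A = A" and w: "w \<in> carrier_vec n" "w \<noteq> 0\<^sub>v n"
    and eig: "A *\<^sub>v w = c \<cdot>\<^sub>v w"
  shows "cnj c = c"
proof -
  have "c * (w \<bullet>c w) = (A *\<^sub>v w) \<bullet>c w"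
    unfolding eig using w by simp
  also have "\<dots> = w \<bullet>c (A *\<^sub>v w)"
    using cscalar_prod_adjoint[OF A(1) w(1) w(1)] A(2) by simp
  also have "\<dots> = cnj c * (w \<bullet>c w)"
    unfolding eig using w by (simp add: conjugate_smult_vec)
  finally show ?thesis
    using w cvec_norm_eq_0[OF w(1)] by (auto simp: cvec_norm_sq)
qed

text \<open>By the shape of Jordan columns, each column p_j of \<open>P\<close> is an eigenvector or
  satisfies A p_j = c p_j + p_{j-1}, with the same c as at p_{j-1}. Symmetry of \<open>A\<close>
  excludes the second case, so the Jordan matrix is diagonal. \<open>P\<close> comes out invertible
  with inverse \<open>Q\<close>; its columns are not claimed to be orthonormal.\<close>

lemma hermitian_diagonalization:
  fixes A :: "complex Matrix.mat"
  assumes A: "A \<in> carrier_mat n n" "mat_adjoint A = A"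
  obtains P Q and d :: "nat \<Rightarrow> real" where
    "P \<in> carrier_mat n n" "Q \<in> carrier_mat n n" "P * Q = 1\<^sub>m n" "Q * P = 1\<^sub>m n"
    "A = P * mat_diag n (\<lambda>i. of_real (d i)) * Q"
    "\<And>j. j < n \<Longrightarrow> P *\<^sub>v unit_vec n j \<noteq> 0\<^sub>v n"
    "\<And>j. j < n \<Longrightarrow> A *\<^sub>v (P *\<^sub>v unit_vec n j) = of_real (d j) \<cdot>\<^sub>v (P *\<^sub>v unit_vec n j)"
proof -
  obtain as where "char_poly A = (\<Prod>a\<leftarrow>as. [:- a, 1:])"
    using char_poly_factorized[OF A(1)] by blast
  then obtain n_as where "jordan_nf A n_as"
    using jordan_nf_exists[OF A(1)] by blast
  then obtain P Q where wit: "similar_mat_wit A (jordan_matrix n_as) P Q"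
    unfolding jordan_nf_def similar_mat_def by blast
  define J where "J = jordan_matrix n_as"
  have P: "P \<in> carrier_mat n n" and Q: "Q \<in> carrier_mat n n" and J: "J \<in> carrier_mat n n"
    and PQ: "P * Q = 1\<^sub>m n" and QP: "Q * P = 1\<^sub>m n" and AJ: "A = P * J * Q"
    using similar_mat_witD2[OF A(1) wit] by (simp_all add: J_def)
  have n: "sum_list (map fst n_as) = n" using carrier_matD(1)[OF J] by (simp add: J_def)
  define p where "p j = P *\<^sub>v unit_vec n j" for j
  have p: "p j \<in> carrier_vec n" for j using P by (simp add: p_def)
  have p_nz: "p j \<noteq> 0\<^sub>v n" if "j < n" for j
  proof
    assume "p j = 0\<^sub>v n"
    then have "Q *\<^sub>v (P *\<^sub>v unit_vec n j) = 0\<^sub>v n"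
      using Q by (simp add: p_def mult_mat_vec_def scalar_prod_def zero_vec_def)
    moreover have "(Q * P) *\<^sub>v unit_vec n j = Q *\<^sub>v (P *\<^sub>v unit_vec n j)"
      by (rule assoc_mult_mat_vec[OF Q P]) simp
    ultimately have "(1\<^sub>m n :: complex Matrix.mat) *\<^sub>v unit_vec n j = 0\<^sub>v n" unfolding QP by (rule trans[rotated])
    then have "unit_vec n j = (0\<^sub>v n :: complex Matrix.vec)" by simp
    then show False using that by simp
  qed
  have AP: "A *\<^sub>v p j = P *\<^sub>v (J *\<^sub>v unit_vec n j)" if "j < n" for j
  proof -
    have "A * P = P * J * (Q * P)"
      unfolding AJ using P Q J by (subst assoc_mult_mat[of _ n n _ n _ n]) auto
    also have "\<dots> = P * J" using QP P J by simp
    finally have "A * P = P * J" .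
    moreover have "A *\<^sub>v p j = (A * P) *\<^sub>v unit_vec n j"
      using A(1) P by (simp add: p_def)
    moreover have "(P * J) *\<^sub>v unit_vec n j = P *\<^sub>v (J *\<^sub>v unit_vec n j)"
      using J P by (intro assoc_mult_mat_vec) auto
    ultimately show ?thesis by simp
  qed
  have Jcol: "J *\<^sub>v unit_vec n j = Matrix.vec n (\<lambda>i. J $$ (i, j))" if "j < n" for j
    using that J by (intro eq_vecI) (auto simp: scalar_prod_right_unit)
  define diag where "diag j \<longleftrightarrow> (\<forall>i<n. i \<noteq> j \<longrightarrow> J $$ (i, j) = 0)" for j
  have eig: "A *\<^sub>v p j = J $$ (j, j) \<cdot>\<^sub>v p j" if "j < n" "diag j" for j
  proof -
    have "J *\<^sub>v unit_vec n j = J $$ (j, j) \<cdot>\<^sub>v unit_vec n j"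
      unfolding Jcol[OF that(1)] using that by (intro eq_vecI) (auto simp: diag_def)
    then show ?thesis using AP[OF that(1)] mult_mat_vec[OF P, of "unit_vec n j"] by (simp add: p_def)
  qed
  \<comment> \<open>Strong induction: the preceding column must already be known to be diagonal, so
    that \<open>p l\<close> is an eigenvector and its eigenvalue is real.\<close>
  have diag: "diag j" if "j < n" for j
    using that
  proof (induction j rule: less_induct)
    case (less j)
    show ?case
    proof (rule ccontr)
      assume "\<not> diag j"
      then obtain l where l: "j = Suc l" "J $$ (l, j) = 1" "J $$ (l, l) = J $$ (j, j)"
          "\<forall>i < n. i \<noteq> j \<longrightarrow> i \<noteq> l \<longrightarrow> J $$ (i, j) = 0"
        using jordan_matrix_column[of j n_as] less.prems
        unfolding diag_def n J_def[symmetric] by blast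
      define c where "c = J $$ (l, l)"
      have ln: "l < n" "l < j" using l less.prems by auto
      have eig_l: "A *\<^sub>v p l = c \<cdot>\<^sub>v p l"
        unfolding c_def using less.IH[OF ln(2) ln(1)] ln by (intro eig)
      have real: "cnj c = c"
        by (rule hermitian_form_real[OF A p p_nz eig_l]) (rule ln)
      have "J *\<^sub>v unit_vec n j = c \<cdot>\<^sub>v unit_vec n j + unit_vec n l"
        unfolding Jcol[OF less.prems] using l ln less.prems by (intro eq_vecI) (auto simp: c_def)
      then have eig_j: "A *\<^sub>v p j = c \<cdot>\<^sub>v p j + p l"
        using AP[OF less.prems] mult_mat_vec[OF P, of "unit_vec n j"]
          mult_add_distrib_mat_vec[OF P, of "c \<cdot>\<^sub>v unit_vec n j" "unit_vec n l"]
        by (simp add: p_def)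
      \<comment> \<open>Pair with the eigenvector \<open>p l\<close> and move \<open>A\<close>
        across. Since \<open>c\<close> is real, both sides contain the same multiple of <p_j, p_l>,
        and |p_l|^2 = 0 remains.\<close>
      have "c * (p j \<bullet>c p l) + p l \<bullet>c p l = (A *\<^sub>v p j) \<bullet>c p l"
        unfolding eig_j using p[of j] p[of l] by (simp add: add_scalar_prod_distrib[of _ n])
      also have "\<dots> = p j \<bullet>c (A *\<^sub>v p l)"
        using cscalar_prod_adjoint[OF A(1) p p] A(2) by simp
      also have "\<dots> = c * (p j \<bullet>c p l)"
        unfolding eig_l using p[of j] p[of l] real by (simp add: conjugate_smult_vec)
      finally have "p l \<bullet>c p l = 0" by simp
      then have "cvec_norm (p l) = 0" unfolding cvec_norm_sq by simp
      with cvec_norm_eq_0[OF p] p_nz[OF ln(1)] show False by simp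
    qed
  qed
  define d where "d j = Re (J $$ (j, j))" for j
  have d: "J $$ (j, j) = of_real (d j)" if "j < n" for j
  proof -
    have "cnj (J $$ (j, j)) = J $$ (j, j)"
      by (rule hermitian_form_real[OF A p p_nz eig]) (use that diag in auto)
    then show ?thesis unfolding d_def by (simp add: complex_eq_iff)
  qed
  have "J = mat_diag n (\<lambda>i. of_real (d i))"
    using J diag d by (intro eq_matI) (auto simp: mat_diag_def diag_def)
  then have "A = P * mat_diag n (\<lambda>i. of_real (d i)) * Q" using AJ by simp
  then show ?thesis
    using that[OF P Q PQ QP] p_nz eig diag d unfolding p_def by auto
qed

text \<open>The candidate \<open>P * D sqrt * Q\<close> squares to \<open>A\<close> at once. As
  \<open>P\<close> need not be unitary, symmetry and positivity are read off after a congruence: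
  \<open>mat_adjoint P * B * P\<close> equals \<open>M * D sqrt\<close>, where \<open>M\<close> is
  the Gram matrix of the eigenvectors.\<close>

lemma psd_mat_sqrt_exists:
  fixes A :: "complex Matrix.mat"
  assumes A: "A \<in> carrier_mat n n" and psd: "psd_mat A"
  shows "\<exists>B. B \<in> carrier_mat n n \<and> psd_mat B \<and> B * B = A"
proof -
  have herm: "mat_adjoint A = A"
    and pos: "\<And>w. w \<in> carrier_vec n \<Longrightarrow> 0 \<le> Re ((A *\<^sub>v w) \<bullet>c w)"
    using psd A by (auto simp: psd_mat_def)
  obtain P Q and d :: "nat \<Rightarrow> real" where
    P: "P \<in> carrier_mat n n" and Q: "Q \<in> carrier_mat n n"
    and PQ: "P * Q = 1\<^sub>m n" and QP: "Q * P = 1\<^sub>m n"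
    and AD: "A = P * mat_diag n (\<lambda>i. of_real (d i)) * Q"
    and nz: "\<And>j. j < n \<Longrightarrow> P *\<^sub>v unit_vec n j \<noteq> 0\<^sub>v n"
    and eig: "\<And>j. j < n \<Longrightarrow> A *\<^sub>v (P *\<^sub>v unit_vec n j) = of_real (d j) \<cdot>\<^sub>v (P *\<^sub>v unit_vec n j)"
    by (rule hermitian_diagonalization[OF A herm]) blast
  have d: "0 \<le> d j" if j: "j < n" for j
  proof -
    let ?p = "P *\<^sub>v unit_vec n j"
    have p: "?p \<in> carrier_vec n" using P by simp
    have "0 \<le> d j * (cvec_norm ?p)\<^sup>2"
      using pos[OF p] unfolding eig[OF j] using p by (simp add: cvec_norm_sq)
    moreover have "0 < (cvec_norm ?p)\<^sup>2"
      using cvec_norm_eq_0[OF p] nz[OF j] by simp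
    ultimately show ?thesis by (simp add: zero_le_mult_iff)
  qed
  define D where "D g = mat_diag n (\<lambda>i. of_real (g (d i)) :: complex)" for g :: "real \<Rightarrow> real"
  define M where "M = mat_adjoint P * P"
  have D [simp]: "D g \<in> carrier_mat n n" for g by (simp add: D_def)
  have D_adj: "mat_adjoint (D g) = D g" for g by (simp add: D_def mat_adjoint_diag)
  have P' [simp]: "mat_adjoint P \<in> carrier_mat n n" and M [simp]: "M \<in> carrier_mat n n"
    using mult_carrier_mat[OF mat_adjoint_carrier[OF P] P] P by (simp_all add: M_def)
  have M_adj: "mat_adjoint M = M" using P by (simp add: M_def mat_adjoint_mult)
  note [simp] = P Q carrier_matD[OF P] carrier_matD[OF Q] carrier_matD[OF D] carrier_matD[OF M]
  have PAP: "mat_adjoint P * (P * D g * Q) * P = M * D g" for g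
  proof -
    have "mat_adjoint P * (P * D g * Q) * P = mat_adjoint P * (P * D g * Q * P)"
      by (rule mat_mult_assoc) simp_all
    also have "P * D g * Q * P = P * D g * (Q * P)"
      by (rule mat_mult_assoc) simp_all
    also have "\<dots> = P * D g" unfolding QP by simp
    also have "mat_adjoint P * (P * D g) = M * D g"
      unfolding M_def by (rule mat_mult_assoc[symmetric]) simp_all
    finally show ?thesis .
  qed
  \<comment> \<open>\<open>M\<close> commutes with \<open>D id\<close>, hence is zero at the entries that link different eigenvalues, and
    so commutes with every \<open>D g\<close>.\<close>
  have "mat_adjoint (M * D id) = M * D id"
  proof -
    have A': "A = P * D id * Q" using AD by (simp add: D_def)
    have "mat_adjoint (mat_adjoint P * A * P) = mat_adjoint P * (A * P)"
      using A herm P by (simp add: mat_adjoint_mult)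
    also have "\<dots> = mat_adjoint P * A * P"
      using carrier_matD[OF A] by (intro mat_mult_assoc[symmetric]) simp_all
    finally show ?thesis using PAP[of id] A' by simp
  qed
  then have comm_id: "D id * M = M * D id"
    using mat_adjoint_mult[of M "D id"] M_adj D_adj by simp
  have comm: "D g * M = M * D g" for g
  proof (rule eq_matI)
    fix i j assume "i < dim_row (M * D g)" "j < dim_col (M * D g)"
    then have ij: "i < n" "j < n" by simp_all
    have "of_real (d i) * M $$ (i, j) = M $$ (i, j) * of_real (d j)"
      using arg_cong[OF comm_id, of "\<lambda>X. X $$ (i, j)"] ij
      by (simp add: D_def mat_diag_mult_left[of _ n n] mat_diag_mult_right[of _ n n])
    then have "M $$ (i, j) = 0 \<or> d i = d j" by (auto simp: mult.commute)
    then show "(D g * M) $$ (i, j) = (M * D g) $$ (i, j)"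
      using ij by (auto simp: D_def mat_diag_mult_left[of _ n n] mat_diag_mult_right[of _ n n])
  qed auto
  define B where "B = P * D sqrt * Q"
  have B [simp]: "B \<in> carrier_mat n n" by (rule carrier_matI) (simp_all add: B_def)
  note [simp] = carrier_matD[OF B]
  have PBP: "mat_adjoint P * B * P = M * D sqrt" unfolding B_def by (rule PAP)
  have "B * B = P * D sqrt * (Q * (P * D sqrt * Q))"
    unfolding B_def by (rule mat_mult_assoc) simp_all
  also have "Q * (P * D sqrt * Q) = Q * (P * (D sqrt * Q))"
    by (subst mat_mult_assoc) simp_all
  also have "\<dots> = Q * P * (D sqrt * Q)"
    by (rule mat_mult_assoc[symmetric]) simp_all
  also have "\<dots> = D sqrt * Q" unfolding QP by simp
  also have "P * D sqrt * (D sqrt * Q) = P * D sqrt * D sqrt * Q"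
    by (rule mat_mult_assoc[symmetric]) simp_all
  also have "P * D sqrt * D sqrt = P * (D sqrt * D sqrt)"
    by (rule mat_mult_assoc) simp_all
  also have "D sqrt * D sqrt = mat_diag n (\<lambda>i. of_real (d i))"
    unfolding D_def mat_diag_diag
    by (rule eq_matI) (use d in \<open>auto simp: mat_diag_def simp flip: of_real_mult\<close>)
  finally have BB: "B * B = A" using AD by simp
  have "mat_adjoint B = B"
  proof -
    have "mat_adjoint P * mat_adjoint B * P = mat_adjoint P * B * P"
    proof -
      have "mat_adjoint P * mat_adjoint B * P = mat_adjoint (mat_adjoint P * (B * P))"
        using B P by (simp add: mat_adjoint_mult)
      also have "mat_adjoint P * (B * P) = mat_adjoint P * B * P"
        by (intro mat_mult_assoc[symmetric]) simp_all
      also have "mat_adjoint \<dots> = M * D sqrt"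
        unfolding PBP using comm[of sqrt] by (simp add: mat_adjoint_mult M_adj D_adj)
      finally show ?thesis using PBP by simp
    qed
    then have "mat_adjoint Q * (mat_adjoint P * mat_adjoint B * P) * Q = mat_adjoint Q * (mat_adjoint P * B * P) * Q"
      by simp
    \<comment> \<open>The congruence with \<open>P\<close> is undone by its inverse
      \<open>Q\<close>, so equality after congruence is equality of the matrices.\<close>
    moreover have "mat_adjoint Q * (mat_adjoint P * X * P) * Q = X" if [simp]: "dim_row X = n" "dim_col X = n" for X
    proof -
      have QP': "mat_adjoint Q * mat_adjoint P = 1\<^sub>m n"
        using PQ by (simp flip: mat_adjoint_mult)
      have "mat_adjoint Q * (mat_adjoint P * X * P) * Q = mat_adjoint Q * (mat_adjoint P * X * P * Q)"
        by (rule mat_mult_assoc) simp_all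
      also have "mat_adjoint P * X * P * Q = mat_adjoint P * X * (P * Q)"
        by (rule mat_mult_assoc) simp_all
      also have "\<dots> = mat_adjoint P * X" unfolding PQ by simp
      also have "mat_adjoint Q * (mat_adjoint P * X) = mat_adjoint Q * mat_adjoint P * X"
        by (rule mat_mult_assoc[symmetric]) simp_all
      also have "\<dots> = X" unfolding QP' by simp
      finally show ?thesis .
    qed
    ultimately show ?thesis by simp
  qed
  moreover have "0 \<le> Re ((B *\<^sub>v w) \<bullet>c w)" if w: "w \<in> carrier_vec n" for w
  proof -
    define y where "y = Q *\<^sub>v w"
    have y [simp]: "y \<in> carrier_vec n" using mult_mat_vec_carrier[OF Q w] by (simp add: y_def)
    \<comment> \<open>Fourth roots of the eigenvalues: since \<open>D ?r\<close> commutes with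
      \<open>M\<close>, the matrix \<open>M * D sqrt\<close> is the adjoint of
      \<open>P * D ?r\<close> times \<open>P * D ?r\<close>, and the quadratic form becomes a
      squared norm.\<close>
    let ?r = "\<lambda>t. sqrt (sqrt t)"
    have w_eq: "w = P *\<^sub>v y"
      unfolding y_def assoc_mult_mat_vec[OF P Q w, symmetric] PQ using w by simp
    have "(B *\<^sub>v w) \<bullet>c w = (B *\<^sub>v (P *\<^sub>v y)) \<bullet>c (P *\<^sub>v y)" by (simp add: w_eq)
    also have "\<dots> = (mat_adjoint P *\<^sub>v (B *\<^sub>v (P *\<^sub>v y))) \<bullet>c y"
      using cscalar_prod_adjoint[OF P' mult_mat_vec_carrier[OF B mult_mat_vec_carrier[OF P y]] y] by simp
    also have "mat_adjoint P *\<^sub>v (B *\<^sub>v (P *\<^sub>v y)) = (mat_adjoint P * B) *\<^sub>v (P *\<^sub>v y)"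
      by (rule assoc_mult_mat_vec[OF P' B mult_mat_vec_carrier[OF P y], symmetric])
    also have "\<dots> = (mat_adjoint P * B * P) *\<^sub>v y"
      by (rule assoc_mult_mat_vec[OF mult_carrier_mat[OF P' B] P y, symmetric])
    also have "mat_adjoint P * B * P = D ?r * M * D ?r"
    proof -
      have "D ?r * D ?r = D sqrt"
        unfolding D_def mat_diag_diag
    by (rule eq_matI) (use d in \<open>auto simp: mat_diag_def simp flip: of_real_mult\<close>)
      then have "M * D sqrt = M * D ?r * D ?r"
        by (simp add: mat_mult_assoc)
      then show ?thesis unfolding PBP comm[of ?r] .
    qed
    also have "D ?r * M * D ?r = mat_adjoint (P * D ?r) * (P * D ?r)"
    proof -
      have "D ?r * M = D ?r * mat_adjoint P * P"
        unfolding M_def by (rule mat_mult_assoc[symmetric]) simp_all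
      then have "D ?r * M * D ?r = D ?r * mat_adjoint P * (P * D ?r)"
        by (simp add: mat_mult_assoc)
      then show ?thesis by (simp add: mat_adjoint_mult D_adj)
    qed
    also have "(\<dots> *\<^sub>v y) \<bullet>c y = ((P * D ?r) *\<^sub>v y) \<bullet>c ((P * D ?r) *\<^sub>v y)"
    proof -
      have PD: "P * D ?r \<in> carrier_mat n n" by (rule carrier_matI) simp_all
      have "(mat_adjoint (P * D ?r) * (P * D ?r)) *\<^sub>v y = mat_adjoint (P * D ?r) *\<^sub>v ((P * D ?r) *\<^sub>v y)"
        by (rule assoc_mult_mat_vec[OF mat_adjoint_carrier[OF PD] PD y])
      then show ?thesis
        using cscalar_prod_adjoint[OF mat_adjoint_carrier[OF PD], of "(P * D ?r) *\<^sub>v y" y]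
          mult_mat_vec_carrier[OF PD y] by simp
    qed
    finally show ?thesis by (simp add: cvec_norm_sq)
  qed
  ultimately have "psd_mat B" by (auto simp: psd_mat_def)
  with BB show ?thesis using B by blast
qed

text \<open>Suppose the Hermitian matrix B - C had an eigenvector p with eigenvalue d \<noteq> 0,
  and put b = B p, c = C p, so b = c + d p. Equality of the squares gives |b| = |c|, and expanding
  |b|^2 leaves d (<b, p> + <p, c>) = 0. Both terms have nonnegative real part, so both real parts
  are 0, and then d |p|^2 = Re <b, p> - Re <c, p> = 0. All eigenvalues being 0, the diagonalizable
  matrix B - C is 0.\<close>

lemma psd_mat_sqrt_unique:
  fixes B C :: "complex Matrix.mat"
  assumes B: "B \<in> carrier_mat n n" "psd_mat B" and C: "C \<in> carrier_mat n n" "psd_mat C"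
    and eq: "B * B = C * C"
  shows "B = C"
proof -
  have hB: "mat_adjoint B = B" and hC: "mat_adjoint C = C"
    and pB: "\<And>w. w \<in> carrier_vec n \<Longrightarrow> 0 \<le> Re ((B *\<^sub>v w) \<bullet>c w)"
    and pC: "\<And>w. w \<in> carrier_vec n \<Longrightarrow> 0 \<le> Re ((C *\<^sub>v w) \<bullet>c w)"
    using B C by (auto simp: psd_mat_def)
  define D where "D = B - C"
  have D: "D \<in> carrier_mat n n" using B C by (simp add: D_def minus_carrier_mat)
  have hD: "mat_adjoint D = D"
  proof (rule eq_matI)
    fix i j assume "i < dim_row D" "j < dim_col D"
    then show "mat_adjoint D $$ (i, j) = D $$ (i, j)"
      using B C mat_adjoint_index[of i B j] mat_adjoint_index[of i C j] hB hC by (simp add: D_def)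
  qed (use D in auto)
  obtain P Q and d :: "nat \<Rightarrow> real" where
    P: "P \<in> carrier_mat n n" and Q: "Q \<in> carrier_mat n n"
    and "P * Q = 1\<^sub>m n" "Q * P = 1\<^sub>m n"
    and DD: "D = P * mat_diag n (\<lambda>i. of_real (d i)) * Q"
    and nz: "\<And>j. j < n \<Longrightarrow> P *\<^sub>v unit_vec n j \<noteq> 0\<^sub>v n"
    and eig: "\<And>j. j < n \<Longrightarrow> D *\<^sub>v (P *\<^sub>v unit_vec n j) = of_real (d j) \<cdot>\<^sub>v (P *\<^sub>v unit_vec n j)"
    by (rule hermitian_diagonalization[OF D hD]) blast
  have "d j = 0" if j: "j < n" for j
  proof (rule ccontr)
    assume "d j \<noteq> 0"
    define p where "p = P *\<^sub>v unit_vec n j"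
    define b where "b = B *\<^sub>v p"
    define c where "c = C *\<^sub>v p"
    have p: "p \<in> carrier_vec n" using P by (simp add: p_def)
    have bc: "b \<in> carrier_vec n" "c \<in> carrier_vec n" using B C p by (auto simp: b_def c_def)
    have "D *\<^sub>v p = b - c"
      unfolding D_def b_def c_def by (rule minus_mult_distrib_mat_vec[OF B(1) C(1) p])
    then have b_eq: "b = c + of_real (d j) \<cdot>\<^sub>v p"
      using eig[OF j] bc p by (auto simp: p_def[symmetric] vec_eq_iff algebra_simps)
    have "b \<bullet>c b = (B *\<^sub>v b) \<bullet>c p"
      using cscalar_prod_adjoint[OF B(1) bc(1) p] hB by (simp add: b_def)
    also have "B *\<^sub>v b = C *\<^sub>v c"
      using eq p B C assoc_mult_mat_vec[OF B(1) B(1) p] assoc_mult_mat_vec[OF C(1) C(1) p]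
      by (simp add: b_def c_def)
    also have "(C *\<^sub>v c) \<bullet>c p = c \<bullet>c c"
      using cscalar_prod_adjoint[OF C(1) bc(2) p] hC by (simp add: c_def)
    finally have "b \<bullet>c b = c \<bullet>c c" .
    moreover have "b \<bullet>c b = b \<bullet>c c + of_real (d j) * (b \<bullet>c p)"
      using bc p by (subst (2) b_eq)
        (simp add: conjugate_add_vec[of _ n] scalar_prod_add_distrib[of _ n] conjugate_smult_vec)
    moreover have "b \<bullet>c c = c \<bullet>c c + of_real (d j) * (p \<bullet>c c)"
      using bc p by (subst b_eq) (simp add: add_scalar_prod_distrib[of _ n])
    ultimately have "of_real (d j) * (b \<bullet>c p + p \<bullet>c c) = 0"
      by (simp add: algebra_simps)
    then have "b \<bullet>c p + p \<bullet>c c = 0" using \<open>d j \<noteq> 0\<close> by simp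
    moreover have "p \<bullet>c c = c \<bullet>c p"
      using cscalar_prod_adjoint[OF C(1) p p] hC by (simp add: c_def)
    ultimately have "Re (b \<bullet>c p) + Re (c \<bullet>c p) = 0"
      by (metis plus_complex.sel(1) zero_complex.sel(1))
    then have zero: "Re (b \<bullet>c p) = 0" "Re (c \<bullet>c p) = 0"
      using pB[OF p] pC[OF p] by (simp_all add: b_def c_def)
    have "b \<bullet>c p = c \<bullet>c p + of_real (d j) * (p \<bullet>c p)"
      using bc p by (subst b_eq) (simp add: add_scalar_prod_distrib[of _ n])
    then have "d j * (cvec_norm p)\<^sup>2 = 0"
      using zero by (simp add: cvec_norm_sq del: of_real_power flip: of_real_mult)
    then show False using \<open>d j \<noteq> 0\<close> cvec_norm_eq_0[OF p] nz[OF j] by (simp add: p_def)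
  qed
  then have "mat_diag n (\<lambda>i. of_real (d i)) = (0\<^sub>m n n :: complex Matrix.mat)"
    by (intro eq_matI) (auto simp: mat_diag_def)
  then have D0: "D = 0\<^sub>m n n" using DD P Q by simp
  show ?thesis
  proof (rule eq_matI)
    fix i j assume ij: "i < dim_row C" "j < dim_col C"
    then have "D $$ (i, j) = 0" using D0 C by simp
    then show "B $$ (i, j) = C $$ (i, j)" using ij B C by (simp add: D_def)
  qed (use B C in auto)
qed

lemma mat_sqrt:
  assumes "A \<in> carrier_mat n n" and "psd_mat A"
  shows "mat_sqrt A \<in> carrier_mat n n" "psd_mat (mat_sqrt A)" "mat_sqrt A * mat_sqrt A = A"
proof -
  have "\<exists>!B. B \<in> carrier_mat (dim_row A) (dim_row A) \<and> psd_mat B \<and> B * B = A"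
    using psd_mat_sqrt_exists[OF assms] psd_mat_sqrt_unique assms(1) by (metis carrier_matD(1))
  from theI'[OF this] show "mat_sqrt A \<in> carrier_mat n n" "psd_mat (mat_sqrt A)"
      "mat_sqrt A * mat_sqrt A = A"
    using assms(1) by (simp_all add: mat_sqrt_def)
qed

text \<open>Here \<open>K\<close> is the inverse of V V^H, so V^H K is a right inverse of
  \<open>V\<close>; symmetry of \<open>K\<close> supplies the last Penrose equation.\<close>

lemma pinv_full_row_rank:
  fixes V :: "complex Matrix.mat"
  assumes V: "V \<in> carrier_mat r N" and K: "K \<in> carrier_mat r r"
    and inv: "V * mat_adjoint V * K = 1\<^sub>m r" "K * (V * mat_adjoint V) = 1\<^sub>m r"
  shows "pinv V = mat_adjoint V * K"
  unfolding pinv_def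
proof (rule the_equality)
  have V' [simp]: "mat_adjoint V \<in> carrier_mat N r" using V by simp
  note [simp] = V K
  have dims [simp]: "dim_row V = r" "dim_col V = N" "dim_row K = r" "dim_col K = r"
    using carrier_matD[OF V] carrier_matD[OF K] by blast+
  let ?B = "mat_adjoint V * K"
  have B [simp]: "?B \<in> carrier_mat N r" by (rule carrier_matI) simp_all
  have VB: "V * ?B = 1\<^sub>m r"
    using inv(1) assoc_mult_mat[OF V V' K] by simp
  have K': "mat_adjoint K = K"
    by (rule adjoint_inverse[of "V * mat_adjoint V" r]) (use inv in \<open>auto simp: mat_adjoint_mult\<close>)
  show "?B \<in> carrier_mat (dim_col V) (dim_row V) \<and> V * ?B * V = V \<and> ?B * V * ?B = ?B \<and>
      mat_adjoint (V * ?B) = V * ?B \<and> mat_adjoint (?B * V) = ?B * V"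
  proof (intro conjI)
    show "?B * V * ?B = ?B"
      using assoc_mult_mat[OF B V B] VB by (simp add: right_mult_one_mat[OF B])
    have "mat_adjoint (?B * V) = mat_adjoint V * (K * V)"
      by (simp add: mat_adjoint_mult K')
    also have "\<dots> = ?B * V" by (rule mat_mult_assoc[symmetric]) simp_all
    finally show "mat_adjoint (?B * V) = ?B * V" .
  qed (auto simp: VB)
  fix B' assume "B' \<in> carrier_mat (dim_col V) (dim_row V) \<and> V * B' * V = V \<and> B' * V * B' = B' \<and>
      mat_adjoint (V * B') = V * B' \<and> mat_adjoint (B' * V) = B' * V"
  then have B': "B' \<in> carrier_mat N r" and e1: "V * B' * V = V" and e2: "B' * V * B' = B'"
    and h: "mat_adjoint (B' * V) = B' * V" by auto
  have VB': "V * B' = 1\<^sub>m r"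
  proof -
    have c: "V * B' \<in> carrier_mat r r" by (rule mult_carrier_mat[OF V B'])
    have "V * B' = V * B' * (V * ?B)" unfolding VB using carrier_matD[OF B'] by simp
    also have "\<dots> = V * B' * V * ?B" by (rule assoc_mult_mat[symmetric, OF c V B])
    finally show ?thesis using e1 VB by simp
  qed
  \<comment> \<open>The Penrose equations put every pseudo-inverse into the form V^H Z, because B' =
    (B' V)^H B'. Then V B' = 1 makes \<open>Z\<close> a right inverse of V V^H, hence equal to
    \<open>K\<close>.\<close>
  define Z where "Z = mat_adjoint B' * B'"
  have Z: "Z \<in> carrier_mat r r" unfolding Z_def
    by (rule mult_carrier_mat[OF mat_adjoint_carrier[OF B'] B'])
  have "B' = mat_adjoint (B' * V) * B'" using e2 h by simp
  also have "\<dots> = mat_adjoint V * mat_adjoint B' * B'"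
    using carrier_matD[OF B'] by (simp add: mat_adjoint_mult)
  also have "\<dots> = mat_adjoint V * Z"
    unfolding Z_def by (rule assoc_mult_mat[OF V' mat_adjoint_carrier[OF B'] B'])
  finally have B'Z: "B' = mat_adjoint V * Z" .
  have "V * mat_adjoint V * Z = 1\<^sub>m r"
    using VB' assoc_mult_mat[OF V V' Z] B'Z by simp
  then have "K = Z"
    by (intro inverse_mat_unique[OF mult_carrier_mat[OF V V'] K Z inv(2)])
  with B'Z show "B' = ?B" by simp
qed

section \<open>Leading blocks as products, and the regression operator\<close>

definition truncation :: "nat \<Rightarrow> nat \<Rightarrow> complex Matrix.mat"
  where "truncation n r = Matrix.mat n r (\<lambda>(i, j). if i = j then 1 else 0)"

lemma truncation_carrier [simp]: "truncation n r \<in> carrier_mat n r"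
  and truncation_dim [simp]: "dim_row (truncation n r) = n" "dim_col (truncation n r) = r"
  by (simp_all add: truncation_def)

lemma mult_truncation_index:
  assumes "dim_col A = n" "r \<le> n" "i < dim_row A" "j < r"
  shows "(A * truncation n r) $$ (i, j) = A $$ (i, j)"
proof -
  have "(A * truncation n r) $$ (i, j) = (\<Sum>l<n. A $$ (i, l) * (if l = j then 1 else 0))"
    using assms by (simp add: truncation_def scalar_prod_def atLeast0LessThan)
  also have "\<dots> = (\<Sum>l<n. if l = j then A $$ (i, l) else 0)"
    by (intro sum.cong) auto
  also have "\<dots> = A $$ (i, j)" using assms by simp
  finally show ?thesis .
qed

lemma truncation_adjoint_mult_index:
  assumes "dim_row A = n" "r \<le> n" "i < r" "j < dim_col A"
  shows "(mat_adjoint (truncation n r) * A) $$ (i, j) = A $$ (i, j)"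
proof -
  have "(mat_adjoint (truncation n r) * A) $$ (i, j) = (\<Sum>l<n. (if l = i then 1 else 0) * A $$ (l, j))"
    using assms
    by (simp add: scalar_prod_def atLeast0LessThan, intro sum.cong) (auto simp: truncation_def)
  also have "\<dots> = (\<Sum>l<n. if l = i then A $$ (l, j) else 0)"
    by (intro sum.cong) auto
  also have "\<dots> = A $$ (i, j)" using assms by simp
  finally show ?thesis .
qed

lemma leading_block_truncation_right:
  assumes "A \<in> carrier_mat r n" "r \<le> n"
  shows "leading_block r A = A * truncation n r"
  by (rule eq_matI) (use assms in \<open>auto simp: leading_block_def mult_truncation_index simp del: index_mult_mat(1)\<close>)

lemma leading_block_truncation:
  assumes "A \<in> carrier_mat n n" "r \<le> n"
  shows "leading_block r A = mat_adjoint (truncation n r) * A * truncation n r"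
  by (rule eq_matI)
    (use assms carrier_matD[OF assms(1)] in \<open>auto simp: leading_block_def mult_truncation_index truncation_adjoint_mult_index
      simp del: index_mult_mat(1)\<close>)

text \<open>Applied with c = 1/N: the normalization inside the inverse of \<open>E_mat\<close> comes
  out as a factor N.\<close>

lemma mat_inv_smult:
  fixes A :: "complex Matrix.mat"
  assumes A: "A \<in> carrier_mat n n" and c: "c \<noteq> 0"
    and inj: "\<forall>w\<in>carrier_vec n. A *\<^sub>v w = 0\<^sub>v n \<longrightarrow> w = 0\<^sub>v n"
  shows "mat_inv (c \<cdot>\<^sub>m A) = inverse c \<cdot>\<^sub>m mat_inv A"
proof -
  note Ai = mat_inv[OF A inj]
  have cA: "c \<cdot>\<^sub>m A \<in> carrier_mat n n" using A by simp
  have B: "inverse c \<cdot>\<^sub>m mat_inv A \<in> carrier_mat n n" using Ai(1) by simp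
  have left: "(inverse c \<cdot>\<^sub>m mat_inv A) * (c \<cdot>\<^sub>m A) = 1\<^sub>m n"
  proof -
    have "(inverse c \<cdot>\<^sub>m mat_inv A) * (c \<cdot>\<^sub>m A) = inverse c \<cdot>\<^sub>m (mat_inv A * (c \<cdot>\<^sub>m A))"
      by (rule mult_smult_assoc_mat[OF Ai(1) cA])
    also have "mat_inv A * (c \<cdot>\<^sub>m A) = c \<cdot>\<^sub>m (mat_inv A * A)"
      by (rule mult_smult_distrib[OF Ai(1) A])
    also have "inverse c \<cdot>\<^sub>m (c \<cdot>\<^sub>m (mat_inv A * A)) = 1\<^sub>m n"
      unfolding Ai(3) by (rule eq_matI) (use c in simp_all)
    finally show ?thesis .
  qed
  have inj': "\<forall>w\<in>carrier_vec n. (c \<cdot>\<^sub>m A) *\<^sub>v w = 0\<^sub>v n \<longrightarrow> w = 0\<^sub>v n"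
  proof (intro ballI impI)
    fix w :: "complex Matrix.vec"
    assume w: "w \<in> carrier_vec n" and z: "(c \<cdot>\<^sub>m A) *\<^sub>v w = 0\<^sub>v n"
    have "w = (inverse c \<cdot>\<^sub>m mat_inv A) *\<^sub>v ((c \<cdot>\<^sub>m A) *\<^sub>v w)"
      unfolding assoc_mult_mat_vec[OF B cA w, symmetric] left using w by simp
    also have "\<dots> = 0\<^sub>v n" unfolding z using B carrier_matD[OF B] by (intro eq_vecI) (auto simp: scalar_prod_def)
    finally show "w = 0\<^sub>v n" .
  qed
  note cAi = mat_inv[OF cA inj']
  show ?thesis
    by (rule inverse_mat_unique[OF cA B cAi(1) left cAi(2), symmetric])
qed

lemma smult_mat_mult_vec:
  fixes A :: "complex Matrix.mat"
  assumes "A \<in> carrier_mat n m" "w \<in> carrier_vec m"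
  shows "(c \<cdot>\<^sub>m A) *\<^sub>v w = c \<cdot>\<^sub>v (A *\<^sub>v w)"
  using assms by (intro eq_vecI) (auto simp: scalar_prod_def sum_distrib_left mult.assoc)

text \<open>In Z^H Z, for the matrix Z of the conclusion, the middle collapses by K (V V^H) K = K,
  so N Z^H Z is exactly the block \<open>E\<close>. Hence N |Z w|^2 = <E w, w>, which Cauchy-Schwarz
  bounds by the operator norm of \<open>E\<close> times |w|^2.\<close>

lemma regression_operator_bound:
  fixes V G :: "complex Matrix.mat"
  assumes V: "V \<in> carrier_mat R N" and G: "G \<in> carrier_mat R R" "mat_adjoint G = G"
    and inj: "\<forall>w\<in>carrier_vec R. (V * mat_adjoint V) *\<^sub>v w = 0\<^sub>v R \<longrightarrow> w = 0\<^sub>v R"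
    and N: "0 < N" and r: "r \<le> R" and w: "w \<in> carrier_vec r"
  defines "K \<equiv> mat_inv (V * mat_adjoint V)"
    and "E \<equiv> leading_block r (G * mat_inv ((1 / of_nat N) \<cdot>\<^sub>m (V * mat_adjoint V)) * G)"
  shows "cvec_norm ((mat_adjoint V * K * G * truncation R r) *\<^sub>v w) \<le> sqrt (mat_op_norm E / real N) * cvec_norm w"
proof -
  let ?W = "truncation R r"
  define Z where "Z = mat_adjoint V * K * G * ?W"
  have V': "mat_adjoint V \<in> carrier_mat N R" using V by simp
  have VV: "V * mat_adjoint V \<in> carrier_mat R R" by (rule mult_carrier_mat[OF V V'])
  note Kinv = mat_inv[OF VV inj, folded K_def]
  have K': "mat_adjoint K = K"
  proof (rule adjoint_inverse[OF VV _ Kinv])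
    show "mat_adjoint (V * mat_adjoint V) = V * mat_adjoint V" using V V' by (simp add: mat_adjoint_mult)
  qed
  note dims [simp] = carrier_matD[OF V] carrier_matD[OF G(1)] carrier_matD[OF Kinv(1)]
  have Z: "Z \<in> carrier_mat N r" by (rule carrier_matI) (simp_all add: Z_def)
  have inv: "mat_inv ((1 / of_nat N) \<cdot>\<^sub>m (V * mat_adjoint V)) = of_nat N \<cdot>\<^sub>m K"
    using mat_inv_smult[OF VV _ inj, of "1 / of_nat N"] N by (simp add: K_def)
  have "mat_adjoint Z * Z = mat_adjoint ?W * (G * (K * (V * mat_adjoint V) * (K * (G * ?W))))"
    by (simp add: Z_def mat_adjoint_mult G(2) K' mat_mult_assoc)
  also have "K * (V * mat_adjoint V) * (K * (G * ?W)) = K * (G * ?W)"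
    unfolding Kinv(3) by simp
  finally have ZZ: "mat_adjoint Z * Z = mat_adjoint ?W * (G * (K * (G * ?W)))" .
  have GKG: "G * mat_inv ((1 / of_nat N) \<cdot>\<^sub>m (V * mat_adjoint V)) * G = of_nat N \<cdot>\<^sub>m (G * K * G)"
    unfolding inv mult_smult_distrib[OF G(1) Kinv(1)]
    by (rule mult_smult_assoc_mat[OF mult_carrier_mat[OF G(1) Kinv(1)] G(1)])
  have "E = mat_adjoint ?W * (of_nat N \<cdot>\<^sub>m (G * K * G)) * ?W"
    unfolding E_def GKG
    by (rule leading_block_truncation[OF _ r]) (rule carrier_matI; simp)
  also have "\<dots> = of_nat N \<cdot>\<^sub>m (mat_adjoint Z * Z)"
  proof -
    have A: "G * K * G \<in> carrier_mat R R" by (rule carrier_matI) simp_all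
    have W': "mat_adjoint ?W \<in> carrier_mat r R" by simp
    have "mat_adjoint ?W * (of_nat N \<cdot>\<^sub>m (G * K * G)) * ?W = of_nat N \<cdot>\<^sub>m (mat_adjoint ?W * (G * K * G) * ?W)"
      unfolding mult_smult_distrib[OF W' A]
      by (rule mult_smult_assoc_mat[OF mult_carrier_mat[OF W' A] truncation_carrier])
    then show ?thesis unfolding ZZ by (simp add: mat_mult_assoc)
  qed
  finally have E: "E = of_nat N \<cdot>\<^sub>m (mat_adjoint Z * Z)" .
  have ZZc: "mat_adjoint Z * Z \<in> carrier_mat r r"
    by (rule mult_carrier_mat[OF mat_adjoint_carrier[OF Z] Z])
  have Ec: "E \<in> carrier_mat r r" unfolding E using ZZc by simp
  have Zw: "Z *\<^sub>v w \<in> carrier_vec N" by (rule mult_mat_vec_carrier[OF Z w])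
  have Ew: "E *\<^sub>v w \<in> carrier_vec r" by (rule mult_mat_vec_carrier[OF Ec w])
  have "(Z *\<^sub>v w) \<bullet>c (Z *\<^sub>v w) = ((mat_adjoint Z * Z) *\<^sub>v w) \<bullet>c w"
    unfolding assoc_mult_mat_vec[OF mat_adjoint_carrier[OF Z] Z w]
    using cscalar_prod_adjoint[OF mat_adjoint_carrier[OF Z] Zw w] by simp
  moreover have "(E *\<^sub>v w) \<bullet>c w = of_nat N * (((mat_adjoint Z * Z) *\<^sub>v w) \<bullet>c w)"
  proof -
    have "E *\<^sub>v w = of_nat N \<cdot>\<^sub>v ((mat_adjoint Z * Z) *\<^sub>v w)"
      unfolding E by (rule smult_mat_mult_vec[OF ZZc w])
    then show ?thesis using mult_mat_vec_carrier[OF ZZc w] w by simp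
  qed
  ultimately have "of_real (real N * (cvec_norm (Z *\<^sub>v w))\<^sup>2) = (E *\<^sub>v w) \<bullet>c w"
    by (simp add: cvec_norm_sq)
  then have "real N * (cvec_norm (Z *\<^sub>v w))\<^sup>2 = cmod ((E *\<^sub>v w) \<bullet>c w)"
    by (metis abs_of_nonneg mult_nonneg_nonneg norm_of_real of_nat_0_le_iff zero_le_power2)
  also have "\<dots> \<le> cvec_norm (E *\<^sub>v w) * cvec_norm w"
    by (rule cscalar_prod_le) (simp add: carrier_matD[OF Ec] carrier_vecD[OF w])
  also have "\<dots> \<le> mat_op_norm E * cvec_norm w * cvec_norm w"
    by (intro mult_right_mono cvec_norm_mult_le[OF Ec w]) simp
  finally have "(cvec_norm (Z *\<^sub>v w))\<^sup>2 \<le> (sqrt (mat_op_norm E / real N) * cvec_norm w)\<^sup>2"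
    using N by (simp add: power_mult_distrib field_simps power2_eq_square)
  then show ?thesis unfolding Z_def[symmetric] by (rule power2_le_imp_le) simp
qed

section \<open>Order of vanishing of smooth functions\<close>

lemma C_infinity_onD:
  assumes "C_infinity_on \<Omega> g"
  shows "continuous_on \<Omega> g"
    and "x \<in> \<Omega> \<Longrightarrow> (\<lambda>t. g (x + t *\<^sub>R axis i 1)) differentiable (at 0)"
    and "C_infinity_on \<Omega> (partial_deriv i g)"
  using assms Ck_on.simps(1)[of \<Omega> g] Ck_on.simps(2)[of _ \<Omega> g]
  unfolding C_infinity_on_def by blast+

lemma C_infinity_on_partial_deriv_power:
  "C_infinity_on \<Omega> g \<Longrightarrow> C_infinity_on \<Omega> ((partial_deriv i ^^ a) g)"
  by (induction a) (auto intro: C_infinity_onD)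

text \<open>\<open>partial_deriv\<close> looks at the parameter 0 only; moving the base point along
  the line gives the derivative at every parameter \<open>s\<close>, as one-variable calculus needs
  it.\<close>

lemma line_has_vector_derivative:
  assumes g: "C_infinity_on \<Omega> g" and x: "x + s *\<^sub>R axis i 1 \<in> \<Omega>"
  shows "((\<lambda>s. g (x + s *\<^sub>R axis i 1)) has_vector_derivative
      partial_deriv i g (x + s *\<^sub>R axis i 1)) (at s)"
proof -
  let ?y = "x + s *\<^sub>R axis i 1"
  have "((\<lambda>t. g (?y + t *\<^sub>R axis i 1)) has_vector_derivative partial_deriv i g ?y) (at 0)"
    using C_infinity_onD(2)[OF g x, of i] by (simp add: partial_deriv_def vector_derivative_works)
  then have "((\<lambda>t. g (?y + t *\<^sub>R axis i 1)) \<circ> (\<lambda>u. u - s) has_vector_derivative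
      1 *\<^sub>R partial_deriv i g ?y) (at s)"
    by (intro vector_diff_chain_at) (auto intro!: derivative_eq_intros)
  moreover have "(\<lambda>t. g (?y + t *\<^sub>R axis i 1)) \<circ> (\<lambda>u. u - s) = (\<lambda>s. g (x + s *\<^sub>R axis i 1))"
    by (auto simp: fun_eq_iff algebra_simps)
  ultimately show ?thesis by simp
qed

lemma partial_deriv_cong:
  assumes "open \<Omega>" and "x \<in> \<Omega>" and "\<And>y. y \<in> \<Omega> \<Longrightarrow> g y = h y"
  shows "partial_deriv i g x = partial_deriv i h x"
  unfolding partial_deriv_def
proof (rule vector_derivative_cong_eq)
  have "((\<lambda>t. x + t *\<^sub>R axis i 1) \<longlongrightarrow> x + 0 *\<^sub>R axis i 1) (nhds 0)"
    by (intro tendsto_intros filterlim_ident)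
  then have "eventually (\<lambda>t. x + t *\<^sub>R axis i 1 \<in> \<Omega>) (nhds 0)"
    using assms(1,2) by (intro topological_tendstoD) auto
  then show "eventually (\<lambda>t. t \<in> UNIV \<longrightarrow> g (x + t *\<^sub>R axis i 1) = h (x + t *\<^sub>R axis i 1)) (nhds 0)"
    by eventually_elim (simp add: assms(3))
qed simp_all

lemma partial_deriv_linear_comb:
  assumes "open \<Omega>" and L: "bounded_linear L" and L': "bounded_linear L'"
    and g: "C_infinity_on \<Omega> g" and h: "C_infinity_on \<Omega> h"
    and u: "\<And>x. x \<in> \<Omega> \<Longrightarrow> u x = L (g x) + L' (h x)" and x: "x \<in> \<Omega>"
  shows "partial_deriv i u x = L (partial_deriv i g x) + L' (partial_deriv i h x)"
proof -
  have "partial_deriv i u x = partial_deriv i (\<lambda>x. L (g x) + L' (h x)) x"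
    by (rule partial_deriv_cong) (use assms in auto)
  also have "\<dots> = L (partial_deriv i g x) + L' (partial_deriv i h x)"
    unfolding partial_deriv_def[of i "\<lambda>x. L (g x) + L' (h x)"]
    using line_has_vector_derivative[OF g, of x 0 i] line_has_vector_derivative[OF h, of x 0 i] x
    by (intro vector_derivative_at has_vector_derivative_add
        bounded_linear.has_vector_derivative[OF L] bounded_linear.has_vector_derivative[OF L']) simp_all
  finally show ?thesis .
qed

text \<open>Two bounded real-linear maps cover sums (both the identity) as well as scalar multiples
  and complex conjugation (second map zero). Agreement of \<open>u\<close> is asked for on
  \<open>\<Omega>\<close> only, because the conjugate symmetry of the kernel, to which this is
  applied, is available only there.\<close>

lemma multi_deriv_linear_comb:
  assumes "open \<Omega>" and "bounded_linear L" and "bounded_linear L'"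
    and "C_infinity_on \<Omega> g" and "C_infinity_on \<Omega> h"
    and "\<And>x. x \<in> \<Omega> \<Longrightarrow> u x = L (g x) + L' (h x)" and "x \<in> \<Omega>"
  shows "multi_deriv \<alpha> u x = L (multi_deriv \<alpha> g x) + L' (multi_deriv \<alpha> h x)"
proof -
  have pow: "C_infinity_on \<Omega> ((partial_deriv i ^^ a) g) \<and> C_infinity_on \<Omega> ((partial_deriv i ^^ a) h) \<and>
      (\<forall>x\<in>\<Omega>. (partial_deriv i ^^ a) u x = L ((partial_deriv i ^^ a) g x) + L' ((partial_deriv i ^^ a) h x))"
    if "C_infinity_on \<Omega> g" "C_infinity_on \<Omega> h" "\<forall>x\<in>\<Omega>. u x = L (g x) + L' (h x)" for i a g h u
    using that
    by (induction a)
      (simp_all add: C_infinity_onD(3) partial_deriv_linear_comb[OF assms(1-3)])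
  have "C_infinity_on \<Omega> (foldr (\<lambda>i. partial_deriv i ^^ \<alpha> i) is g) \<and>
      C_infinity_on \<Omega> (foldr (\<lambda>i. partial_deriv i ^^ \<alpha> i) is h) \<and>
      (\<forall>x\<in>\<Omega>. foldr (\<lambda>i. partial_deriv i ^^ \<alpha> i) is u x =
        L (foldr (\<lambda>i. partial_deriv i ^^ \<alpha> i) is g x) +
        L' (foldr (\<lambda>i. partial_deriv i ^^ \<alpha> i) is h x))" for "is"
  proof (induction "is")
    case Nil
    then show ?case using assms by simp
  next
    case (Cons i "is")
    then show ?case unfolding foldr.simps o_apply by (intro pow) blast+
  qed
  then show ?thesis using assms(7) by (simp add: multi_deriv_def)
qed

text \<open>Induction on \<open>M\<close>: the derivative of the remainder is the remainder of the
  shifted family, and the mean value inequality turns its bound B |u|^M into B |s|^(M+1). The usual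
  factorial in the constant is given away, since only the order in \<open>s\<close> matters.\<close>

lemma taylor_remainder_bound:
  fixes \<phi> :: "nat \<Rightarrow> real \<Rightarrow> 'b::real_normed_vector"
  assumes "\<And>a s. a < M \<Longrightarrow> \<bar>s\<bar> \<le> \<delta> \<Longrightarrow> (\<phi> a has_vector_derivative \<phi> (Suc a) s) (at s)"
    and "\<And>s. \<bar>s\<bar> \<le> \<delta> \<Longrightarrow> norm (\<phi> M s) \<le> B"
    and "\<bar>s\<bar> \<le> \<delta>"
  shows "norm (\<phi> 0 s - (\<Sum>a<M. (s ^ a / fact a) *\<^sub>R \<phi> a 0)) \<le> B * \<bar>s\<bar> ^ M"
  using assms
proof (induction M arbitrary: \<phi> s)
  case 0
  then show ?case by simp
next
  case (Suc M)
  define \<psi> where "\<psi> s = \<phi> 0 s - (\<Sum>a<Suc M. (s ^ a / fact a) *\<^sub>R \<phi> a 0)" for s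
  define \<psi>' where "\<psi>' s = \<phi> 1 s - (\<Sum>a<M. (s ^ a / fact a) *\<^sub>R \<phi> (Suc a) 0)" for s
  have IH: "norm (\<psi>' u) \<le> B * \<bar>u\<bar> ^ M" if "\<bar>u\<bar> \<le> \<delta>" for u
    unfolding \<psi>'_def using Suc.IH[of "\<lambda>a. \<phi> (Suc a)" u] Suc.prems that by simp
  have der: "(\<psi> has_vector_derivative \<psi>' u) (at u)" if u: "\<bar>u\<bar> \<le> \<delta>" for u
  proof -
    have "((\<lambda>s. \<Sum>a<M. (s ^ Suc a / fact (Suc a)) *\<^sub>R \<phi> (Suc a) 0) has_vector_derivative
        (\<Sum>a<M. (u ^ a / fact a) *\<^sub>R \<phi> (Suc a) 0)) (at u)"
    proof (rule has_vector_derivative_sum)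
      fix a
      have "((\<lambda>s. s ^ Suc a / fact (Suc a)) has_real_derivative u ^ a / fact a) (at u)"
        using DERIV_cdivide[OF DERIV_pow[of "Suc a" u], of "fact (Suc a)"]
        by (simp del: power_Suc of_nat_Suc)
      then have "((\<lambda>s. (s ^ Suc a / fact (Suc a)) *\<^sub>R \<phi> (Suc a) 0) has_vector_derivative
          (u ^ a / fact a) *\<^sub>R \<phi> (Suc a) 0) (at u)"
        unfolding has_real_derivative_iff_has_vector_derivative
        by (rule bounded_linear.has_vector_derivative[OF bounded_linear_scaleR_left])
      then show "((\<lambda>s. (s ^ Suc a / fact (Suc a)) *\<^sub>R \<phi> (Suc a) 0) has_vector_derivative
          (u ^ a / fact a) *\<^sub>R \<phi> (Suc a) 0) (at u)" .
    qed
    then have "((\<lambda>s. \<phi> 0 s - (\<phi> 0 0 + (\<Sum>a<M. (s ^ Suc a / fact (Suc a)) *\<^sub>R \<phi> (Suc a) 0)))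
        has_vector_derivative \<phi> (Suc 0) u - (0 + (\<Sum>a<M. (u ^ a / fact a) *\<^sub>R \<phi> (Suc a) 0))) (at u)"
      by (intro has_vector_derivative_diff has_vector_derivative_add has_vector_derivative_const
          Suc.prems(1) u) simp_all
    then show ?thesis
      unfolding \<psi>_def[abs_def] \<psi>'_def sum.lessThan_Suc_shift by simp
  qed
  let ?S = "closed_segment 0 s"
  have S: "\<bar>u\<bar> \<le> \<bar>s\<bar>" if "u \<in> ?S" for u
    using segment_bound1[OF that] by simp
  have "norm (\<psi> s - \<psi> 0) \<le> (B * \<bar>s\<bar> ^ M) * norm (s - 0)"
  proof (rule differentiable_bound)
    fix u assume u: "u \<in> ?S"
    have us: "\<bar>u\<bar> \<le> \<bar>s\<bar>" by (rule S[OF u])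
    with Suc.prems(3) have ud: "\<bar>u\<bar> \<le> \<delta>" by linarith
    show "(\<psi> has_derivative (\<lambda>h. h *\<^sub>R \<psi>' u)) (at u within ?S)"
      using der[OF ud] unfolding has_vector_derivative_def by (rule has_derivative_at_withinI)
    \<comment> \<open>Nonnegativity of \<open>B\<close>, needed for monotonicity, comes from the
      bound at \<open>s\<close>.\<close>
    have "0 \<le> norm (\<phi> (Suc M) s)" by simp
    also have "\<dots> \<le> B" by (rule Suc.prems(2)[OF Suc.prems(3)])
    finally have "B * \<bar>u\<bar> ^ M \<le> B * \<bar>s\<bar> ^ M"
      using us by (intro mult_left_mono power_mono) simp_all
    with IH[OF ud] have "norm (\<psi>' u) \<le> B * \<bar>s\<bar> ^ M" by linarith
    moreover have "onorm (\<lambda>h::real. h *\<^sub>R \<psi>' u) \<le> norm (\<psi>' u)"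
      by (rule onorm_bound) (simp_all add: mult.commute)
    ultimately show "onorm (\<lambda>h. h *\<^sub>R \<psi>' u) \<le> B * \<bar>s\<bar> ^ M" by simp
  qed auto
  moreover have "\<psi> 0 = 0" unfolding \<psi>_def sum.lessThan_Suc_shift by simp
  ultimately show ?case by (simp add: \<psi>_def ac_simps)
qed

text \<open>Equivalence of norms on polynomials of degree below \<open>M\<close>, in scaled form on
  [0, r]. What counts is that \<open>K\<close> depends on \<open>M\<close> alone: it is applied with
  arbitrarily small \<open>r\<close> and with coefficients that vary with a base point.\<close>

lemma poly_coeff_bound:
  "\<exists>K\<ge>0. \<forall>(b :: nat \<Rightarrow> 'b::real_normed_vector) r S.
    0 \<le> r \<longrightarrow> (\<forall>s\<in>{0..r}. norm (\<Sum>a<M. s ^ a *\<^sub>R b a) \<le> S) \<longrightarrow> (\<forall>a<M. r ^ a * norm (b a) \<le> K * S)"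
proof (induction M)
  case 0
  then show ?case by auto
next
  case (Suc M)
  then obtain K where K: "0 \<le> K" and IH: "\<And>(b :: nat \<Rightarrow> 'b) r S a.
      0 \<le> r \<Longrightarrow> \<forall>s\<in>{0..r}. norm (\<Sum>a<M. s ^ a *\<^sub>R b a) \<le> S \<Longrightarrow> a < M \<Longrightarrow> r ^ a * norm (b a) \<le> K * S"
    by blast
  \<comment> \<open>The interval shrinks to [0, r/2] so that 2 s stays in [0, r]; undoing this costs
    2^a \<le> 2^M. The factor 1 + 2^M bounds q (2 s) - 2^M q s.\<close>
  define K1 where "K1 = 2 ^ M * (K * (1 + 2 ^ M))"
  have K1: "0 \<le> K1" using K by (simp add: K1_def)
  define K2 where "K2 = 1 + (real M + 1) * K1"
  show ?case
  proof (intro exI[of _ K2] conjI allI impI)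
    show "0 \<le> K2" using K1 by (simp add: K2_def)
    fix b :: "nat \<Rightarrow> 'b" and r S :: real and a
    assume r: "0 \<le> r" and S: "\<forall>s\<in>{0..r}. norm (\<Sum>a<Suc M. s ^ a *\<^sub>R b a) \<le> S" and a: "a < Suc M"
    define q where "q s = (\<Sum>a<Suc M. s ^ a *\<^sub>R b a)" for s
    have q: "norm (q s) \<le> S" if "0 \<le> s" "s \<le> r" for s using S that by (simp add: q_def)
    have S0: "0 \<le> S" using q[of 0] r norm_ge_zero order_trans by blast
    \<comment> \<open>\<open>q (2 * s) - 2 ^ M *\<^sub>R q s\<close> has no term of degree \<open>M\<close>.\<close>
    have q2: "q (2 * s) - 2 ^ M *\<^sub>R q s = (\<Sum>a<M. s ^ a *\<^sub>R ((2 ^ a - 2 ^ M) *\<^sub>R b a))" for s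
      by (simp add: q_def scaleR_sum_right sum_subtractf[symmetric] algebra_simps power_mult_distrib)
    have low: "r ^ a * norm (b a) \<le> K1 * S" if "a < M" for a
    proof -
      have "norm (\<Sum>a<M. s ^ a *\<^sub>R ((2 ^ a - 2 ^ M) *\<^sub>R b a)) \<le> (1 + 2 ^ M) * S" if "s \<in> {0..r/2}" for s
      proof -
        have "norm (q (2 * s) - 2 ^ M *\<^sub>R q s) \<le> norm (q (2 * s)) + 2 ^ M * norm (q s)"
          by (rule order_trans[OF norm_triangle_ineq4]) simp
        also have "\<dots> \<le> S + 2 ^ M * S"
          using that by (intro add_mono mult_left_mono q) auto
        also have "\<dots> = (1 + 2 ^ M) * S" by (simp add: distrib_right)
        finally show ?thesis unfolding q2 .
      qed
      then have "(r/2) ^ a * norm ((2 ^ a - 2 ^ M :: real) *\<^sub>R b a) \<le> K * ((1 + 2 ^ M) * S)"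
        using r \<open>a < M\<close> by (intro IH) auto
      \<comment> \<open>Elimination of the top term multiplies the lower coefficients by 2^a - 2^M,
        which does not shrink them.\<close>
      moreover have "1 \<le> \<bar>2 ^ a - 2 ^ M :: real\<bar>"
      proof -
        have "(2::real) ^ Suc a \<le> 2 ^ M" using \<open>a < M\<close> by (intro power_increasing) auto
        moreover have "(1::real) \<le> 2 ^ a" by simp
        ultimately show ?thesis unfolding power_Suc by linarith
      qed
      then have "(r/2) ^ a * norm (b a) \<le> (r/2) ^ a * norm ((2 ^ a - 2 ^ M :: real) *\<^sub>R b a)"
        using r by (intro mult_left_mono) (auto simp: mult_le_cancel_right1)
      ultimately have "(r/2) ^ a * norm (b a) \<le> K * ((1 + 2 ^ M) * S)" by linarith
      then have "2 ^ a * ((r/2) ^ a * norm (b a)) \<le> 2 ^ M * (K * ((1 + 2 ^ M) * S))"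
        using r \<open>a < M\<close>
        by - (rule mult_mono; assumption?; simp add: power_increasing)
      then show ?thesis by (simp add: K1_def power_divide mult.assoc)
    qed
    have "r ^ M * norm (b M) = norm (q r - (\<Sum>a<M. r ^ a *\<^sub>R b a))"
      using r by (simp add: q_def)
    also have "\<dots> \<le> norm (q r) + norm (\<Sum>a<M. r ^ a *\<^sub>R b a)" by (rule norm_triangle_ineq4)
    also have "\<dots> \<le> S + (\<Sum>a<M. K1 * S)"
      using r low by (intro add_mono q sum_norm_le) auto
    also have "\<dots> = (1 + real M * K1) * S" by (simp add: algebra_simps)
    also have "\<dots> \<le> K2 * S"
      unfolding K2_def using K1 S0 by (intro mult_right_mono) (auto simp: algebra_simps)
    finally have top: "r ^ M * norm (b M) \<le> K2 * S" .
    have "K1 * S \<le> K2 * S"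
      unfolding K2_def using K1 S0 by (intro mult_right_mono) (auto simp: algebra_simps)
    then show "r ^ a * norm (b a) \<le> K2 * S"
      using a top low[of a] by (cases "a = M") simp_all
  qed
qed

text \<open>Big-O of order \<open>M\<close> at \<open>p\<close>, for displacements in the coordinate
  subspace of \<open>S\<close>; the subspace permits an induction that adds one coordinate at a
  time. For M > 0 the admissible displacement 0 forces g p = 0, while M = 0 means boundedness near
  \<open>p\<close>.\<close>

definition vanishes_to_order ::
    "'d::finite set \<Rightarrow> real^'d \<Rightarrow> nat \<Rightarrow> (real^'d \<Rightarrow> 'b::real_normed_vector) \<Rightarrow> bool"
  where "vanishes_to_order S p M g \<longleftrightarrow> (\<exists>C \<delta>. 0 \<le> C \<and> 0 < \<delta> \<and>
    (\<forall>t. (\<forall>i. i \<notin> S \<longrightarrow> vec_nth t i = 0) \<and> norm t \<le> \<delta> \<longrightarrow> norm (g (p + t)) \<le> C * norm t ^ M))"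

lemma norm_axis_component_le:
  fixes t :: "real^'d::finite"
  shows "norm (t - vec_nth t i *\<^sub>R axis i 1) \<le> norm t"
  by (rule norm_le_componentwise_cart) (simp add: axis_def)

lemma add_mem_cball_iff: "p + z \<in> cball p r \<longleftrightarrow> norm z \<le> r"
  for p z :: "'b::real_normed_vector"
  by (simp add: dist_norm)

text \<open>Supplies the constant for the highest derivative in the Taylor remainder.\<close>

lemma locally_bounded_near:
  fixes g :: "real^'d::finite \<Rightarrow> 'b::real_normed_vector"
  assumes "open \<Omega>" "p \<in> \<Omega>" "continuous_on \<Omega> g"
  shows "\<exists>B \<delta>. 0 \<le> B \<and> 0 < \<delta> \<and> cball p \<delta> \<subseteq> \<Omega> \<and> (\<forall>x\<in>cball p \<delta>. norm (g x) \<le> B)"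
proof -
  obtain \<delta> where \<delta>: "0 < \<delta>" "cball p \<delta> \<subseteq> \<Omega>"
    using assms(1,2) open_contains_cball by blast
  have "compact (g ` cball p \<delta>)"
    by (rule compact_continuous_image) (use assms(3) \<delta> continuous_on_subset in auto)
  then obtain B where "\<forall>y\<in>g ` cball p \<delta>. norm y \<le> B"
    using compact_imp_bounded bounded_iff by blast
  moreover have "p \<in> cball p \<delta>" using \<delta> by simp
  ultimately have "0 \<le> B" using norm_ge_zero order_trans by blast
  then show ?thesis using \<delta> \<open>\<forall>y\<in>g ` cball p \<delta>. norm y \<le> B\<close> by blast
qed

text \<open>Split t = t' + s e_i with t' in the subspace of \<open>S\<close> and expand in s. The
  a-th Taylor coefficient, taken at p + t', is O(|t'|^(M-a)), so together with s^a it is O(|t|^M),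
  as is the remainder.\<close>

lemma vanishes_to_order_insertI:
  fixes g :: "real^'d::finite \<Rightarrow> 'b::real_normed_vector"
  assumes \<Omega>: "open \<Omega>" "p \<in> \<Omega>" and g: "C_infinity_on \<Omega> g" and i: "i \<notin> S"
    and van: "\<And>a. a < M \<Longrightarrow> vanishes_to_order S p (M - a) ((partial_deriv i ^^ a) g)"
  shows "vanishes_to_order (insert i S) p M g"
proof -
  note smooth = C_infinity_on_partial_deriv_power[OF g]
  obtain C \<delta> where C: "\<And>a. a < M \<Longrightarrow> 0 \<le> C a" and \<delta>: "\<And>a. a < M \<Longrightarrow> 0 < \<delta> a"
    and bound: "\<And>a t. a < M \<Longrightarrow> (\<forall>i. i \<notin> S \<longrightarrow> vec_nth t i = 0) \<Longrightarrow> norm t \<le> \<delta> a \<Longrightarrow>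
      norm ((partial_deriv i ^^ a) g (p + t)) \<le> C a * norm t ^ (M - a)"
    using van unfolding vanishes_to_order_def by metis
  obtain B \<eta> where B: "0 \<le> B" and \<eta>: "0 < \<eta>" "cball p \<eta> \<subseteq> \<Omega>"
    and gB: "\<forall>x\<in>cball p \<eta>. norm ((partial_deriv i ^^ M) g x) \<le> B"
    using locally_bounded_near[OF \<Omega> C_infinity_onD(1)[OF smooth[of M i]]] by (elim exE conjE) (rule that)
  \<comment> \<open>The radii of all coefficient bounds, together with half the radius of the
    remainder bound: on the segment of expansion |t'| + |u| \<le> 2 |t|.\<close>
  define E where "E = insert (\<eta> / 2) (\<delta> ` {..<M})"
  have E1: "finite E" by (simp add: E_def)
  have E2: "\<And>a. a < M \<Longrightarrow> \<delta> a \<in> E" unfolding E_def by blast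
  have E3: "\<eta> / 2 \<in> E" unfolding E_def by blast
  have E4: "\<forall>e\<in>E. 0 < e" using \<delta> \<eta>(1) by (auto simp add: E_def)
  define \<epsilon> where "\<epsilon> = Min E"
  have \<epsilon>\<delta>: "\<epsilon> \<le> \<delta> a" if "a < M" for a
    unfolding \<epsilon>_def by (rule Min_le[OF E1 E2[OF that]])
  have \<epsilon>: "\<epsilon> \<le> \<eta> / 2"
    unfolding \<epsilon>_def by (rule Min_le[OF E1 E3])
  have "\<epsilon> \<in> E" unfolding \<epsilon>_def using E1 E3 by (intro Min_in) auto
  with E4 have \<epsilon>0: "0 < \<epsilon>" by blast
  define C' where "C' = B + (\<Sum>a<M. C a)"
  have main: "norm (g (p + t)) \<le> C' * norm t ^ M"
    if t: "\<forall>l. l \<notin> insert i S \<longrightarrow> vec_nth t l = 0" and tle: "norm t \<le> \<epsilon>" for t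
  proof -
    define s where "s = vec_nth t i"
    define t' where "t' = t - s *\<^sub>R axis i 1"
    have t'S: "\<forall>l. l \<notin> S \<longrightarrow> vec_nth t' l = 0"
    proof (intro allI impI)
      fix l assume "l \<notin> S"
      then show "vec_nth t' l = 0"
        using t[rule_format, of l] by (cases "l = i") (simp_all add: t'_def s_def axis_def)
    qed
    have t'le: "norm t' \<le> norm t" unfolding t'_def s_def by (rule norm_axis_component_le)
    have sle: "\<bar>s\<bar> \<le> norm t" unfolding s_def by (rule component_le_norm_cart)
    define \<phi> where "\<phi> a u = (partial_deriv i ^^ a) g (p + t' + u *\<^sub>R axis i 1)" for a u
    have ball: "p + t' + u *\<^sub>R axis i 1 \<in> cball p \<eta>" if "\<bar>u\<bar> \<le> \<bar>s\<bar>" for u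
    proof -
      have "norm (t' + u *\<^sub>R axis i 1) \<le> norm t' + \<bar>u\<bar>"
        by (rule order_trans[OF norm_triangle_ineq]) simp
      also have "\<dots> \<le> \<eta>" using t'le sle that tle \<epsilon> by linarith
      finally show ?thesis unfolding add.assoc add_mem_cball_iff .
    qed
    have "norm (\<phi> 0 s - (\<Sum>a<M. (s ^ a / fact a) *\<^sub>R \<phi> a 0)) \<le> B * \<bar>s\<bar> ^ M"
    proof (rule taylor_remainder_bound[where \<phi> = \<phi> and \<delta> = "\<bar>s\<bar>"])
      fix a u assume "\<bar>u\<bar> \<le> \<bar>s\<bar>"
      then show "(\<phi> a has_vector_derivative \<phi> (Suc a) u) (at u)"
        unfolding \<phi>_def[abs_def] funpow.simps o_apply
        by (intro line_has_vector_derivative[OF smooth] subsetD[OF \<eta>(2)] ball)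
    next
      fix u assume "\<bar>u\<bar> \<le> \<bar>s\<bar>"
      then show "norm (\<phi> M u) \<le> B" unfolding \<phi>_def by (intro gB[rule_format] ball)
    qed simp
    also have "\<dots> \<le> B * norm t ^ M" using B sle by (intro mult_left_mono power_mono) auto
    finally have rem: "norm (\<phi> 0 s - (\<Sum>a<M. (s ^ a / fact a) *\<^sub>R \<phi> a 0)) \<le> B * norm t ^ M" .
    have "norm (\<Sum>a<M. (s ^ a / fact a) *\<^sub>R \<phi> a 0) \<le> (\<Sum>a<M. C a * norm t ^ M)"
    proof (rule sum_norm_le)
      fix a assume "a \<in> {..<M}"
      then have a: "a < M" by simp
      have "norm (\<phi> a 0) \<le> C a * norm t' ^ (M - a)"
        using bound[OF a t'S] t'le tle \<epsilon>\<delta>[OF a] by (simp add: \<phi>_def)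
      also have "\<dots> \<le> C a * norm t ^ (M - a)"
        using C[OF a] t'le by (intro mult_left_mono power_mono) auto
      finally have 1: "norm (\<phi> a 0) \<le> C a * norm t ^ (M - a)" .
      have "\<bar>s\<bar> ^ a / fact a \<le> \<bar>s\<bar> ^ a" by (simp add: divide_le_eq mult_le_cancel_left1)
      also have "\<dots> \<le> norm t ^ a" using sle by (intro power_mono) auto
      finally have 2: "\<bar>s\<bar> ^ a / fact a \<le> norm t ^ a" .
      have "norm ((s ^ a / fact a) *\<^sub>R \<phi> a 0) = \<bar>s\<bar> ^ a / fact a * norm (\<phi> a 0)"
        by (simp add: power_abs)
      also have "\<dots> \<le> norm t ^ a * (C a * norm t ^ (M - a))"
        by (intro mult_mono 1 2) auto
      also have "\<dots> = C a * norm t ^ M"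
        using a by (simp add: mult.left_commute flip: power_add)
      finally show "norm ((s ^ a / fact a) *\<^sub>R \<phi> a 0) \<le> C a * norm t ^ M" .
    qed
    then have "norm (\<phi> 0 s) \<le> B * norm t ^ M + (\<Sum>a<M. C a * norm t ^ M)"
      using rem norm_triangle_sub[of "\<phi> 0 s" "\<Sum>a<M. (s ^ a / fact a) *\<^sub>R \<phi> a 0"] by linarith
    moreover have "\<phi> 0 s = g (p + t)" by (simp add: \<phi>_def t'_def)
    ultimately show ?thesis by (simp add: C'_def distrib_right sum_distrib_right)
  qed
  have C': "0 \<le> C'"
    unfolding C'_def using B C by (intro add_nonneg_nonneg sum_nonneg) auto
  show ?thesis
    unfolding vanishes_to_order_def
    by (rule exI[of _ C'], rule exI[of _ \<epsilon>], intro conjI C' \<epsilon>0, intro allI impI, elim conjE, rule main)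
qed

text \<open>For t in the subspace of \<open>S\<close> with |t| \<le> r, the Taylor polynomial of s
  |-> g(p + t + s e_i) is O(r^M) uniformly for s in [0, r], being g minus the remainder.
  \<open>poly_coeff_bound\<close> then makes its a-th coefficient O(r^(M-a)).\<close>

lemma vanishes_to_order_insertD:
  fixes g :: "real^'d::finite \<Rightarrow> 'b::real_normed_vector"
  assumes \<Omega>: "open \<Omega>" "p \<in> \<Omega>" and g: "C_infinity_on \<Omega> g" and i: "i \<notin> S"
    and van: "vanishes_to_order (insert i S) p M g" and a: "a < M"
  shows "vanishes_to_order S p (M - a) ((partial_deriv i ^^ a) g)"
proof -
  note smooth = C_infinity_on_partial_deriv_power[OF g]
  obtain C \<delta> where C: "0 \<le> C" and \<delta>: "0 < \<delta>"
    and bound: "\<And>t. (\<forall>l. l \<notin> insert i S \<longrightarrow> vec_nth t l = 0) \<Longrightarrow> norm t \<le> \<delta> \<Longrightarrow>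
      norm (g (p + t)) \<le> C * norm t ^ M"
    using van unfolding vanishes_to_order_def by metis
  obtain B \<eta> where B: "0 \<le> B" and \<eta>: "0 < \<eta>" "cball p \<eta> \<subseteq> \<Omega>"
    and gB: "\<forall>x\<in>cball p \<eta>. norm ((partial_deriv i ^^ M) g x) \<le> B"
    using locally_bounded_near[OF \<Omega> C_infinity_onD(1)[OF smooth[of M i]]] by (elim exE conjE) (rule that)
  have "\<exists>K\<ge>0. \<forall>(b :: nat \<Rightarrow> 'b) r S. 0 \<le> r \<longrightarrow>
      (\<forall>s\<in>{0..r}. norm (\<Sum>a<M. s ^ a *\<^sub>R b a) \<le> S) \<longrightarrow> (\<forall>a<M. r ^ a * norm (b a) \<le> K * S)"
    by (rule poly_coeff_bound)
  then obtain K where K: "0 \<le> K" and coeff: "\<forall>(b :: nat \<Rightarrow> 'b) r S. 0 \<le> r \<longrightarrow>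
      (\<forall>s\<in>{0..r}. norm (\<Sum>a<M. s ^ a *\<^sub>R b a) \<le> S) \<longrightarrow> (\<forall>a<M. r ^ a * norm (b a) \<le> K * S)"
    by (elim exE conjE) (rule that)
  \<comment> \<open>The halves account for |t + u e_i| \<le> 2 r; the cap 1 serves at t = 0, where
    r^(M-a) \<le> r is wanted.\<close>
  define \<epsilon> where "\<epsilon> = min 1 (min (\<delta> / 2) (\<eta> / 2))"
  have \<epsilon>: "0 < \<epsilon>" "\<epsilon> \<le> 1" "\<epsilon> \<le> \<delta> / 2" "\<epsilon> \<le> \<eta> / 2" using \<delta> \<eta> by (auto simp: \<epsilon>_def)
  \<comment> \<open>\<open>fact a\<close> turns a Taylor coefficient back into a derivative,
    \<open>K\<close> is the loss in reading off coefficients, 2^M stems from |t + s e_i| \<le> 2 r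
    in the bound on \<open>g\<close>, and \<open>B\<close> from the remainder.\<close>
  define C' where "C' = fact a * (K * (C * 2 ^ M + B))"
  have C': "0 \<le> C'" using K C B by (simp add: C'_def)
  let ?h = "(partial_deriv i ^^ a) g"
  \<comment> \<open>The scale \<open>r\<close> is kept apart from \<open>norm t\<close> since it
    must be positive even at t = 0.\<close>
  have main: "norm (?h (p + t)) \<le> C' * r ^ (M - a)"
    if t: "\<forall>l. l \<notin> S \<longrightarrow> vec_nth t l = 0" and r: "norm t \<le> r" "0 < r" "r \<le> \<epsilon>" for t r
  proof -
    define \<phi> where "\<phi> b u = (partial_deriv i ^^ b) g (p + t + u *\<^sub>R axis i 1)" for b u
    have near: "norm (t + u *\<^sub>R axis i 1) \<le> 2 * r" if "\<bar>u\<bar> \<le> r" for u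
      using norm_triangle_ineq[of t "u *\<^sub>R axis i 1"] that r(1) by simp
    have ball: "p + t + u *\<^sub>R axis i 1 \<in> cball p \<eta>" if "\<bar>u\<bar> \<le> r" for u
      unfolding add.assoc add_mem_cball_iff using near[OF that] r \<epsilon> by linarith
    have "norm (\<Sum>b<M. s ^ b *\<^sub>R ((1 / fact b) *\<^sub>R \<phi> b 0)) \<le> (C * 2 ^ M + B) * r ^ M" if s: "s \<in> {0..r}" for s
    proof -
      have "norm (\<phi> 0 s - (\<Sum>b<M. (s ^ b / fact b) *\<^sub>R \<phi> b 0)) \<le> B * \<bar>s\<bar> ^ M"
      proof (rule taylor_remainder_bound[where \<phi> = \<phi> and \<delta> = r])
        fix b u assume "\<bar>u\<bar> \<le> r"
        then show "(\<phi> b has_vector_derivative \<phi> (Suc b) u) (at u)"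
          unfolding \<phi>_def[abs_def] funpow.simps o_apply
          by (intro line_has_vector_derivative[OF smooth] subsetD[OF \<eta>(2)] ball)
      next
        fix u assume "\<bar>u\<bar> \<le> r"
        then show "norm (\<phi> M u) \<le> B" unfolding \<phi>_def by (intro gB[rule_format] ball)
      qed (use s in simp)
      also have "\<dots> \<le> B * r ^ M" using B s by (intro mult_left_mono power_mono) auto
      finally have rem: "norm (\<phi> 0 s - (\<Sum>b<M. (s ^ b / fact b) *\<^sub>R \<phi> b 0)) \<le> B * r ^ M" .
      have "norm (g (p + (t + s *\<^sub>R axis i 1))) \<le> C * norm (t + s *\<^sub>R axis i 1) ^ M"
        by (rule bound) (use t near[of s] s r \<epsilon> in \<open>auto simp: axis_def\<close>)
      also have "\<dots> \<le> C * (2 * r) ^ M"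
        using C near[of s] s by (intro mult_left_mono power_mono) auto
      finally have "norm (\<phi> 0 s) \<le> C * 2 ^ M * r ^ M"
        by (simp add: \<phi>_def power_mult_distrib add.assoc)
      then have "norm (\<Sum>b<M. (s ^ b / fact b) *\<^sub>R \<phi> b 0) \<le> (C * 2 ^ M + B) * r ^ M"
        using rem norm_triangle_sub[of "\<Sum>b<M. (s ^ b / fact b) *\<^sub>R \<phi> b 0" "\<phi> 0 s"]
        by (simp add: distrib_right norm_minus_commute)
      then show ?thesis by simp
    qed
    then have "r ^ a * norm ((1 / fact a) *\<^sub>R \<phi> a 0) \<le> K * ((C * 2 ^ M + B) * r ^ M)"
      using r(2) a by (intro coeff[rule_format]) simp_all
    also have "r ^ M = r ^ a * r ^ (M - a)" using a by (simp flip: power_add)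
    finally have "r ^ a * norm ((1 / fact a) *\<^sub>R \<phi> a 0) \<le> r ^ a * (K * (C * 2 ^ M + B) * r ^ (M - a))"
      by (simp add: ac_simps)
    then have "norm ((1 / fact a) *\<^sub>R \<phi> a 0) \<le> K * (C * 2 ^ M + B) * r ^ (M - a)"
      by (rule mult_left_le_imp_le) (use r(2) in simp)
    then show ?thesis by (simp add: \<phi>_def C'_def field_simps)
  qed
  have final: "norm (?h (p + t)) \<le> C' * norm t ^ (M - a)"
    if t: "\<forall>l. l \<notin> S \<longrightarrow> vec_nth t l = 0" "norm t \<le> \<epsilon>" for t
  proof (cases "t = 0")
    case False
    then show ?thesis using main[of t "norm t"] t by simp
  next
    \<comment> \<open>As a < M, the exponent is positive, so letting the scale tend to 0 forces the
      derivative at \<open>p\<close> to vanish.\<close>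
    case True
    have "norm (?h p) \<le> 0 + e" if "0 < e" for e
    proof -
      define r where "r = min \<epsilon> (e / (C' + 1))"
      have r: "0 < r" "r \<le> \<epsilon>" "r \<le> e / (C' + 1)" using \<epsilon> that C' by (auto simp: r_def)
      have "norm (?h p) \<le> C' * r ^ (M - a)" using main[of 0 r] r by simp
      also have "\<dots> \<le> C' * r ^ 1"
        using r \<epsilon> C' a by (intro mult_left_mono power_decreasing) auto
      also have "\<dots> \<le> (C' + 1) * r" using r by (simp add: distrib_right)
      also have "\<dots> \<le> e" using r(3) C' by (simp add: field_simps)
      finally show ?thesis by simp
    qed
    then have "norm (?h p) \<le> 0" by (rule field_le_epsilon)
    then show ?thesis using True a C' by simp
  qed
  show ?thesis
    unfolding vanishes_to_order_def
    by (rule exI[of _ C'], rule exI[of _ \<epsilon>], intro conjI C' \<epsilon>(1), intro allI impI, elim conjE, rule final)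
qed

lemma coordinates: "distinct (coordinates :: 'd::finite list)" "set (coordinates :: 'd list) = UNIV"
  using someI_ex[OF finite_distinct_list[OF finite[of "UNIV :: 'd set"]]]
  unfolding coordinates_def by (simp_all add: conj_commute)

text \<open>Differentiating in the innermost coordinate first, each step turns smallness on a coordinate
  subspace into smallness of the derivatives on the subspace with one coordinate less; this avoids
  both the symmetry of mixed derivatives and the chain rule of higher order.\<close>

lemma vanishes_to_order_iff_multi_deriv:
  fixes g :: "real^'d::finite \<Rightarrow> 'b::real_normed_vector"
  assumes \<Omega>: "open \<Omega>" "p \<in> \<Omega>" and g: "C_infinity_on \<Omega> g"
  shows "vanishes_to_order UNIV p M g \<longleftrightarrow> (\<forall>\<alpha>. sum \<alpha> UNIV < M \<longrightarrow> multi_deriv \<alpha> g p = 0)"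
proof -
  have "vanishes_to_order (set is) p M g \<longleftrightarrow>
      (\<forall>\<alpha>. sum \<alpha> (set is) < M \<longrightarrow> foldr (\<lambda>i. partial_deriv i ^^ \<alpha> i) is g p = 0)"
    if "distinct is" for "is"
    using that g
  \<comment> \<open>In \<open>foldr\<close> the last list element is differentiated first, hence the
    induction appends at the end. \<open>M\<close> and \<open>g\<close> vary because the order drops
    to M - a when \<open>g\<close> is replaced by an a-th derivative.\<close>
  proof (induction "is" arbitrary: M g rule: rev_induct)
    \<comment> \<open>Without coordinates the only displacement is 0, and |g p| \<le> C * 0^M is a
      condition exactly when M > 0.\<close>
    case Nil
    show ?case
    proof
      assume "vanishes_to_order (set []) p M g"
      then obtain C \<delta> where "0 < \<delta>" and le: "\<And>t. \<forall>i. vec_nth t i = 0 \<Longrightarrow> norm t \<le> \<delta> \<Longrightarrow>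
          norm (g (p + t)) \<le> C * norm t ^ M"
        unfolding vanishes_to_order_def by auto
      then show "\<forall>\<alpha>. sum \<alpha> (set []) < M \<longrightarrow> foldr (\<lambda>i. partial_deriv i ^^ \<alpha> i) [] g p = 0"
        using le[of 0] by (auto simp: power_0_left)
    next
      assume "\<forall>\<alpha>. sum \<alpha> (set []) < M \<longrightarrow> foldr (\<lambda>i. partial_deriv i ^^ \<alpha> i) [] g p = 0"
      then have "norm (g (p + t)) \<le> norm (g p) * norm t ^ M" if "\<forall>i. vec_nth t i = 0" for t
      proof -
        have "t = 0" using that by (simp add: Finite_Cartesian_Product.vec_eq_iff)
        then show ?thesis
          using \<open>\<forall>\<alpha>. _ \<longrightarrow> _\<close> by (simp add: power_0_left)
      qed
      then show "vanishes_to_order (set []) p M g"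
        unfolding vanishes_to_order_def by (intro exI[of _ "norm (g p)"] exI[of _ 1]) auto
    qed
  next
    case (snoc i "is")
    then have i: "i \<notin> set is" "distinct is" and g: "C_infinity_on \<Omega> g" by auto
    let ?D = "\<lambda>\<alpha> h. foldr (\<lambda>i. partial_deriv i ^^ \<alpha> i) is h p"
    have "vanishes_to_order (set (is @ [i])) p M g \<longleftrightarrow>
        (\<forall>a<M. vanishes_to_order (set is) p (M - a) ((partial_deriv i ^^ a) g))"
      using vanishes_to_order_insertI[OF \<Omega> g i(1)] vanishes_to_order_insertD[OF \<Omega> g i(1)] by auto
    also have "\<dots> \<longleftrightarrow> (\<forall>a<M. \<forall>\<alpha>. sum \<alpha> (set is) < M - a \<longrightarrow> ?D \<alpha> ((partial_deriv i ^^ a) g) = 0)"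
      using snoc.IH[OF i(2) C_infinity_on_partial_deriv_power[OF g]] by simp
    also have "\<dots> \<longleftrightarrow> (\<forall>\<alpha>. sum \<alpha> (set (is @ [i])) < M \<longrightarrow>
        foldr (\<lambda>i. partial_deriv i ^^ \<alpha> i) (is @ [i]) g p = 0)"
    proof (intro iffI allI impI)
      fix \<alpha> assume "\<forall>a<M. \<forall>\<alpha>. sum \<alpha> (set is) < M - a \<longrightarrow> ?D \<alpha> ((partial_deriv i ^^ a) g) = 0"
        and "sum \<alpha> (set (is @ [i])) < M"
      then show "foldr (\<lambda>i. partial_deriv i ^^ \<alpha> i) (is @ [i]) g p = 0"
        using i by simp
    next
      fix a \<alpha> assume *: "\<forall>\<alpha>. sum \<alpha> (set (is @ [i])) < M \<longrightarrow>
          foldr (\<lambda>i. partial_deriv i ^^ \<alpha> i) (is @ [i]) g p = 0"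
        and a: "a < M" "sum \<alpha> (set is) < M - a"
      \<comment> \<open>The multi-index for the shorter list is glued to the exponent
        \<open>a\<close>; since \<open>i\<close> is not in that list, the derivatives along it are
        unaffected.\<close>
      define \<beta> where "\<beta> = \<alpha>(i := a)"
      have "sum \<beta> (set is) = sum \<alpha> (set is)" using i by (intro sum.cong) (auto simp: \<beta>_def)
      moreover have "\<beta> i = a" by (simp add: \<beta>_def)
      ultimately have "sum \<beta> (set (is @ [i])) < M" using a i by simp
      then have "foldr (\<lambda>i. partial_deriv i ^^ \<beta> i) (is @ [i]) g p = 0" by (rule *[rule_format])
      moreover have "foldr (\<lambda>i. partial_deriv i ^^ \<beta> i) is h = foldr (\<lambda>i. partial_deriv i ^^ \<alpha> i) is h" for h :: "real^'d \<Rightarrow> 'b"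
        using i by (intro foldr_cong) (auto simp: \<beta>_def)
      ultimately show "?D \<alpha> ((partial_deriv i ^^ a) g) = 0" by (simp add: \<beta>_def)
    qed
    finally show ?case .
  qed
  from this[OF coordinates(1)] show ?thesis by (simp add: coordinates(2) multi_deriv_def)
qed

section \<open>Flat real analytic functions\<close>

text \<open>The power series converges absolutely at a corner of a cube, hence defines a holomorphic
  function on the complexification of every line through the cube.\<close>

lemma real_analytic_line_extension:
  fixes g :: "real^'d::finite \<Rightarrow> complex"
  assumes "real_analytic_on \<Omega> g" and "a \<in> \<Omega>"
  shows "\<exists>R>0. \<forall>u w. \<exists>F. F holomorphic_on {\<zeta>. \<forall>i. cmod (of_real (vec_nth u i) + \<zeta> * of_real (vec_nth w i)) < R} \<and>
    (\<forall>s::real. (\<forall>i. \<bar>vec_nth u i + s * vec_nth w i\<bar> < R) \<longrightarrow> F (of_real s) = g (a + u + s *\<^sub>R w))"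
proof -
  obtain \<rho> and c :: "('d \<Rightarrow> nat) \<Rightarrow> complex" where \<rho>: "0 < \<rho>" and c: "\<forall>x\<in>ball a \<rho>.
      ((\<lambda>\<alpha>. c \<alpha> * of_real (\<Prod>i\<in>UNIV. (vec_nth x i - vec_nth a i) ^ \<alpha> i)) has_sum g x) UNIV"
    using assms(1)[unfolded real_analytic_on_def, rule_format, OF assms(2)] by (elim exE conjE) (rule that)
  \<comment> \<open>With every coordinate at most \<open>R\<close> in modulus, the norm is at most
    \<rho>/2, so the whole closed cube lies in the ball of convergence.\<close>
  define R where "R = \<rho> / (2 * real CARD('d))"
  have card: "0 < real CARD('d)" by simp
  have R: "0 < R" "real CARD('d) * R < \<rho>" using \<rho> card by (simp_all add: R_def)
  have mem: "a + v \<in> ball a \<rho>" if "\<And>i. \<bar>vec_nth v i\<bar> \<le> R" for v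
  proof -
    have "norm v \<le> (\<Sum>i\<in>UNIV. \<bar>vec_nth v i\<bar>)" by (rule norm_le_l1_cart)
    also have "\<dots> \<le> (\<Sum>i\<in>(UNIV :: 'd set). R)" by (intro sum_mono that)
    also have "\<dots> < \<rho>" using R by simp
    finally show ?thesis by (simp add: dist_norm)
  qed
  \<comment> \<open>The moduli of the terms at the corner a + (R, ..., R). Unconditional summability
    of complex numbers is absolute, so \<open>m\<close> is a summable majorant.\<close>
  define m where "m \<alpha> = cmod (c \<alpha> * of_real (\<Prod>i\<in>UNIV. R ^ \<alpha> i))" for \<alpha> :: "'d \<Rightarrow> nat"
  have "a + (\<chi> i. R) \<in> ball a \<rho>" using R by (intro mem) simp
  from c[rule_format, OF this] have "(\<lambda>\<alpha>. c \<alpha> * of_real (\<Prod>i\<in>UNIV. R ^ \<alpha> i)) summable_on UNIV"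
    by (simp add: summable_on_def) blast
  then have m: "m summable_on UNIV"
    unfolding m_def[abs_def] by (simp only: summable_on_iff_abs_summable_on_complex)
  show ?thesis
  proof (intro exI[of _ R] conjI R(1) allI)
    fix u w :: "real^'d"
    define D where "D = {\<zeta>. \<forall>i. cmod (of_real (vec_nth u i) + \<zeta> * of_real (vec_nth w i)) < R}"
    define T where "T \<alpha> \<zeta> = c \<alpha> * (\<Prod>i\<in>UNIV. (of_real (vec_nth u i) + \<zeta> * of_real (vec_nth w i)) ^ \<alpha> i)"
      for \<alpha> :: "'d \<Rightarrow> nat" and \<zeta>
    define F where "F \<zeta> = (\<Sum>\<^sub>\<infinity>\<alpha>. T \<alpha> \<zeta>)" for \<zeta>
    have "open D"
    proof -
      have "D = (\<Inter>i. {\<zeta>. cmod (of_real (vec_nth u i) + \<zeta> * of_real (vec_nth w i)) < R})"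
        by (auto simp: D_def)
      also have "open \<dots>" by (intro open_INT ballI open_Collect_less continuous_intros) auto
      finally show ?thesis .
    qed
    have bound: "cmod (T \<alpha> \<zeta>) \<le> m \<alpha>" if "\<zeta> \<in> D" for \<alpha> \<zeta>
    proof -
      have "(\<Prod>i\<in>UNIV. cmod (of_real (vec_nth u i) + \<zeta> * of_real (vec_nth w i)) ^ \<alpha> i) \<le> (\<Prod>i\<in>UNIV. R ^ \<alpha> i)"
        using that by (intro prod_mono conjI power_mono) (auto simp: D_def intro: less_imp_le)
      then have "cmod (c \<alpha>) * (\<Prod>i\<in>UNIV. cmod (of_real (vec_nth u i) + \<zeta> * of_real (vec_nth w i)) ^ \<alpha> i)
          \<le> cmod (c \<alpha>) * (\<Prod>i\<in>UNIV. R ^ \<alpha> i)" by (rule mult_left_mono) simp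
      moreover have "m \<alpha> = cmod (c \<alpha>) * (\<Prod>i\<in>UNIV. R ^ \<alpha> i)"
        unfolding m_def norm_mult norm_of_real using R(1) by (simp add: prod_nonneg)
      ultimately show ?thesis by (simp add: T_def norm_mult norm_power flip: prod_norm)
    qed
    \<comment> \<open>The majorant is independent of \<open>\<zeta>\<close>, so convergence is
      uniform on all of \<open>D\<close> and holomorphy of the finite sums passes to the limit on
      discs.\<close>
    have lim: "uniform_limit D (\<lambda>X \<zeta>. \<Sum>\<alpha>\<in>X. T \<alpha> \<zeta>) F (finite_subsets_at_top UNIV)"
      unfolding F_def[abs_def] by (rule Weierstrass_m_test_general[OF bound m])
    have hol: "(\<lambda>\<zeta>. \<Sum>\<alpha>\<in>X. T \<alpha> \<zeta>) holomorphic_on S" for X S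
      unfolding T_def by (intro holomorphic_intros)
    have "F holomorphic_on D"
      unfolding holomorphic_on_open[OF \<open>open D\<close>]
    proof
      fix z assume "z \<in> D"
      then obtain r where r: "0 < r" "cball z r \<subseteq> D" using \<open>open D\<close> open_contains_cball by blast
      have "F holomorphic_on ball z r"
      proof (rule holomorphic_uniform_limit)
        show "\<forall>\<^sub>F X in finite_subsets_at_top UNIV.
            continuous_on (cball z r) (\<lambda>\<zeta>. \<Sum>\<alpha>\<in>X. T \<alpha> \<zeta>) \<and> (\<lambda>\<zeta>. \<Sum>\<alpha>\<in>X. T \<alpha> \<zeta>) holomorphic_on ball z r"
          by (intro always_eventually allI conjI hol holomorphic_on_imp_continuous_on)
        show "uniform_limit (cball z r) (\<lambda>X \<zeta>. \<Sum>\<alpha>\<in>X. T \<alpha> \<zeta>) F (finite_subsets_at_top UNIV)"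
          by (rule uniform_limit_on_subset[OF lim r(2)])
      qed auto
      then show "\<exists>f'. (F has_field_derivative f') (at z)"
        using r(1) holomorphic_on_open[of "ball z r" F] by simp
    qed
    moreover have "F (of_real s) = g (a + u + s *\<^sub>R w)" if s: "\<forall>i. \<bar>vec_nth u i + s * vec_nth w i\<bar> < R" for s
    proof -
      have "a + (u + s *\<^sub>R w) \<in> ball a \<rho>" using s by (intro mem) (simp add: less_imp_le)
      from c[rule_format, OF this] have "(T' has_sum g (a + u + s *\<^sub>R w)) UNIV"
        if "T' = (\<lambda>\<alpha>. T \<alpha> (of_real s))" for T'
        unfolding that by (simp add: T_def add.assoc)
      from infsumI[OF this[OF refl]] show ?thesis by (simp add: F_def)
    qed
    ultimately show "\<exists>F. F holomorphic_on {\<zeta>. \<forall>i. cmod (of_real (vec_nth u i) + \<zeta> * of_real (vec_nth w i)) < R} \<and>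
      (\<forall>s::real. (\<forall>i. \<bar>vec_nth u i + s * vec_nth w i\<bar> < R) \<longrightarrow> F (of_real s) = g (a + u + s *\<^sub>R w))"
      unfolding D_def by blast
  qed
qed

text \<open>An intersection of preimages of discs under linear maps. Convexity provides the
  connectedness that the identity theorem asks for.\<close>

lemma convex_complexified_segment:
  "convex {\<zeta>. \<forall>i. cmod (of_real (vec_nth u i) + \<zeta> * of_real (vec_nth w i)) < R}"
proof -
  have dist: "cmod (b + z) = dist (- b) z" for b z :: complex
  proof -
    have "dist (- b) z = cmod (- (b + z))" by (simp add: dist_norm)
    then show ?thesis by (simp only: norm_minus_cancel)
  qed
  have "{\<zeta>. \<forall>i. cmod (of_real (vec_nth u i) + \<zeta> * of_real (vec_nth w i)) < R} =
      (\<Inter>i. (\<lambda>\<zeta>. \<zeta> * of_real (vec_nth w i)) -` ball (- of_real (vec_nth u i)) R)"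
    unfolding dist by auto
  moreover have "linear (\<lambda>\<zeta>::complex. \<zeta> * of_real (vec_nth w i))" for i
    by (rule bounded_linear.linear[OF bounded_linear_mult_left])
  ultimately show ?thesis
    by (auto intro!: convex_INT convex_linear_vimage convex_ball)
qed

text \<open>Both parts reduce to one complex variable on the line to \<open>y\<close>. In the first,
  F vanishes on a real interval next to 0 and the identity theorem applies. In the second, a
  nonconstant F would be \<zeta>^n G with G(0) \<noteq> 0, against F(s) = O(s^(n+1)). The radius
  does not depend on \<open>U\<close>, which later shows that the interior of the zero set is
  relatively closed.\<close>

lemma real_analytic_local_identity:
  fixes g :: "real^'d::finite \<Rightarrow> complex"
  assumes g: "real_analytic_on \<Omega> g" and a: "a \<in> \<Omega>"
  obtains R where "0 < R"
    "\<And>U y. open U \<Longrightarrow> U \<inter> ball a R \<noteq> {} \<Longrightarrow> (\<And>x. x \<in> U \<Longrightarrow> g x = 0) \<Longrightarrow> y \<in> ball a R \<Longrightarrow> g y = 0"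
    "\<And>y. (\<And>M. vanishes_to_order UNIV a M g) \<Longrightarrow> y \<in> ball a R \<Longrightarrow> g y = 0"
proof -
  from real_analytic_line_extension[OF g a] obtain R where R: "0 < R" and ext: "\<forall>u w. \<exists>F.
      F holomorphic_on {\<zeta>. \<forall>i. cmod (of_real (vec_nth u i) + \<zeta> * of_real (vec_nth w i)) < R} \<and>
      (\<forall>s::real. (\<forall>i. \<bar>vec_nth u i + s * vec_nth w i\<bar> < R) \<longrightarrow> F (of_real s) = g (a + u + s *\<^sub>R w))"
    by (elim exE conjE) (rule that)
  have line: "\<exists>F D. open D \<and> convex D \<and> F holomorphic_on D \<and> 0 \<in> D \<and> 1 \<in> D \<and>
      (\<forall>s::real. of_real s \<in> D \<longrightarrow> F (of_real s) = g (x + s *\<^sub>R (y - x)))"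
    if x: "x \<in> ball a R" and y: "y \<in> ball a R" for x y
  proof -
    define u w where "u = x - a" and "w = y - x"
    define D where "D = {\<zeta>. \<forall>i. cmod (of_real (vec_nth u i) + \<zeta> * of_real (vec_nth w i)) < R}"
    have "\<exists>F. F holomorphic_on D \<and>
        (\<forall>s::real. (\<forall>i. \<bar>vec_nth u i + s * vec_nth w i\<bar> < R) \<longrightarrow> F (of_real s) = g (a + u + s *\<^sub>R w))"
      unfolding D_def by (rule spec[OF spec[OF ext]])
    then obtain F where F: "F holomorphic_on D"
      and Fg: "\<forall>s::real. (\<forall>i. \<bar>vec_nth u i + s * vec_nth w i\<bar> < R) \<longrightarrow> F (of_real s) = g (a + u + s *\<^sub>R w)"
      by (elim exE conjE) (rule that)
    have real: "of_real s \<in> D \<longleftrightarrow> (\<forall>i. \<bar>vec_nth u i + s * vec_nth w i\<bar> < R)" for s :: real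
      unfolding D_def by (simp flip: of_real_mult of_real_add)
    have "open D"
    proof -
      have "D = (\<Inter>i. {\<zeta>. cmod (of_real (vec_nth u i) + \<zeta> * of_real (vec_nth w i)) < R})"
        by (auto simp: D_def)
      also have "open \<dots>" by (intro open_INT ballI open_Collect_less continuous_intros) auto
      finally show ?thesis .
    qed
    moreover have "convex D" unfolding D_def by (rule convex_complexified_segment)
    moreover have "0 \<in> D" "1 \<in> D"
    proof -
      have "\<bar>vec_nth (z - a) i\<bar> < R" if "z \<in> ball a R" for z i
        using component_le_norm_cart[of "z - a" i] that by (simp add: dist_norm norm_minus_commute)
      from this[OF x] this[OF y] show "0 \<in> D" "1 \<in> D"
        using real[of 0] real[of 1] by (simp_all add: u_def w_def)
    qed
    moreover have "F (of_real s) = g (x + s *\<^sub>R (y - x))" if "of_real s \<in> D" for s :: real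
      using Fg[rule_format, of s] that unfolding real by (simp add: u_def w_def)
    ultimately show ?thesis using F by blast
  qed
  show ?thesis
  proof (rule that[OF R])
    fix U y assume U: "open U" "U \<inter> ball a R \<noteq> {}" and zero: "\<And>x. x \<in> U \<Longrightarrow> g x = 0" and y: "y \<in> ball a R"
    then obtain x where x: "x \<in> U" "x \<in> ball a R" by blast
    from line[OF x(2) y] obtain F D where D: "open D" "convex D" "F holomorphic_on D" "0 \<in> D" "1 \<in> D"
      and Fg: "\<forall>s::real. of_real s \<in> D \<longrightarrow> F (of_real s) = g (x + s *\<^sub>R (y - x))"
      by (elim exE conjE) (rule that)
    have "((\<lambda>s. x + s *\<^sub>R (y - x)) \<longlongrightarrow> x + 0 *\<^sub>R (y - x)) (nhds 0)"
      by (intro tendsto_intros filterlim_ident)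
    then have "eventually (\<lambda>s. x + s *\<^sub>R (y - x) \<in> U) (nhds 0)"
      using U(1) x(1) by (intro topological_tendstoD) auto
    then obtain e where e: "0 < e" "\<And>s. \<bar>s\<bar> < e \<Longrightarrow> x + s *\<^sub>R (y - x) \<in> U"
      by (auto simp: eventually_nhds_metric dist_real_def)
    obtain e' where e': "0 < e'" "ball 0 e' \<subseteq> D" using D(1,4) open_contains_ball by blast
    \<comment> \<open>Positive reals accumulating at 0, short enough that the points on the line
      stay in \<open>U\<close> and the parameters in \<open>D\<close>.\<close>
    define W where "W = (of_real ` {0<..<min e e'} :: complex set)"
    have "F 1 = 0"
    proof (rule analytic_continuation[of F D W 0])
      show "W \<subseteq> D" using e' by (auto simp: W_def)
      show "F z = 0" if "z \<in> W" for z
        using that e' e Fg zero \<open>W \<subseteq> D\<close> by (auto simp: W_def)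
      show "0 islimpt W"
        unfolding islimpt_approachable
      proof (intro allI impI)
        fix d :: real assume "0 < d"
        then show "\<exists>x'\<in>W. x' \<noteq> 0 \<and> dist x' 0 < d"
          using e(1) e'(1)
          by (intro bexI[of _ "of_real (min (d/2) (min e e' / 2))"]) (auto simp: W_def min_def intro!: imageI)
      qed
    qed (use D in \<open>auto simp: convex_connected\<close>)
    then show "g y = 0" using Fg[rule_format, of 1] D(5) by simp
  next
    fix y assume flat: "\<And>M. vanishes_to_order UNIV a M g" and y: "y \<in> ball a R"
    have "a \<in> ball a R" using R by simp
    from line[OF this y] obtain F D where D: "open D" "convex D" "F holomorphic_on D" "0 \<in> D" "1 \<in> D"
      and Fg: "\<forall>s::real. of_real s \<in> D \<longrightarrow> F (of_real s) = g (a + s *\<^sub>R (y - a))"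
      by (elim exE conjE) (rule that)
    have F0: "F 0 = 0"
      using flat[of 1] Fg[rule_format, of 0] D(4) unfolding vanishes_to_order_def
      by (auto dest!: spec[of _ 0])
    show "g y = 0"
    proof (rule ccontr)
      assume "g y \<noteq> 0"
      then have "F 1 \<noteq> 0" using Fg[rule_format, of 1] D(5) by simp
      with F0 D(4,5) have nc: "\<not> F constant_on D" unfolding constant_on_def by force
      obtain G r n where n: "0 < n" and r: "0 < r" "ball 0 r \<subseteq> D" and G: "G holomorphic_on ball 0 r"
        and FG: "\<And>z. z \<in> ball 0 r \<Longrightarrow> F z = (z - 0) ^ n * G z" and G0: "\<And>z. z \<in> ball 0 r \<Longrightarrow> G z \<noteq> 0"
        by (rule holomorphic_factor_zero_nonconstant[OF D(3,1) convex_connected[OF D(2)] D(4) F0 nc]) blast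
      obtain C \<delta> where C: "0 \<le> C" and \<delta>: "0 < \<delta>" and le: "\<forall>t. (\<forall>i. i \<notin> UNIV \<longrightarrow> vec_nth t i = 0) \<and> norm t \<le> \<delta> \<longrightarrow>
          norm (g (a + t)) \<le> C * norm t ^ Suc n"
        using flat[of "Suc n"] unfolding vanishes_to_order_def by (elim exE conjE) (rule that)
      define L where "L = norm (y - a)"
      have L: "0 < L + 1" by (simp add: L_def add_nonneg_pos)
      \<comment> \<open>Dividing |s^n G(s)| \<le> C (s L)^(n+1) by s^n leaves a bound for |G(s)|
        that tends to 0 with s.\<close>
      have ev: "eventually (\<lambda>s::real. cmod (G (of_real s)) \<le> C * L ^ Suc n * s) (at_right 0)"
      proof (rule eventually_at_rightI)
        show "0 < min r (\<delta> / (L + 1))" using r \<delta> L by simp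
        fix s assume s: "s \<in> {0<..<min r (\<delta> / (L + 1))}"
        then have s': "0 < s" "s < r" by auto
        have "s < \<delta> / (L + 1)" using s by simp
        then have "s * (L + 1) < \<delta>" using L by (simp only: pos_less_divide_eq)
        have sD: "of_real s \<in> ball (0::complex) r" using s' by simp
        have sL: "norm (s *\<^sub>R (y - a)) = s * L" using s' by (simp add: L_def)
        have "s * L \<le> \<delta>" using s' \<open>s * (L + 1) < \<delta>\<close> by (simp add: distrib_left)
        then have "norm (g (a + s *\<^sub>R (y - a))) \<le> C * (s * L) ^ Suc n"
          using le[rule_format, of "s *\<^sub>R (y - a)"] unfolding sL by simp
        moreover have "g (a + s *\<^sub>R (y - a)) = of_real s ^ n * G (of_real s)"
          using Fg[rule_format, OF subsetD[OF r(2) sD]] FG[OF sD] by simp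
        ultimately have "s ^ n * cmod (G (of_real s)) \<le> s ^ n * (C * L ^ Suc n * s)"
          using s' by (simp add: norm_mult norm_power power_mult_distrib ac_simps)
        then show "cmod (G (of_real s)) \<le> C * L ^ Suc n * s"
          by (rule mult_left_le_imp_le) (use s' in simp)
      qed
      have "continuous (at 0) G"
        using holomorphic_on_imp_continuous_on[OF G] r(1) by (simp add: continuous_on_eq_continuous_at)
      then have "((\<lambda>s::real. G (of_real s)) \<longlongrightarrow> G 0) (at_right 0)"
        unfolding isCont_def
        by (rule filterlim_compose) (auto intro!: filterlim_atI tendsto_eq_intros simp: eventually_at_filter)
      then have "((\<lambda>s::real. cmod (G (of_real s))) \<longlongrightarrow> cmod (G 0)) (at_right 0)"
        by (rule tendsto_norm)
      moreover have "((\<lambda>s::real. C * L ^ Suc n * s) \<longlongrightarrow> C * L ^ Suc n * 0) (at_right 0)"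
        by (intro tendsto_intros)
      ultimately have "cmod (G 0) \<le> C * L ^ Suc n * 0"
        using ev by (intro tendsto_le[of "at_right (0::real)"]) auto
      then show False using G0[of 0] r(1) by simp
    qed
  qed
qed

text \<open>The interior of the zero set is open, contains \<open>p\<close> by flatness, and is
  relatively closed: a ball of local identity that met it would consist of zeros, which puts its
  centre into the interior. Connectedness does the rest.\<close>

lemma real_analytic_flat_imp_zero:
  fixes g :: "real^'d::finite \<Rightarrow> complex"
  assumes \<Omega>: "open \<Omega>" "connected \<Omega>" and g: "real_analytic_on \<Omega> g"
    and p: "p \<in> \<Omega>" and flat: "\<And>M. vanishes_to_order UNIV p M g" and x: "x \<in> \<Omega>"
  shows "g x = 0"
proof -
  define Z where "Z = interior {x \<in> \<Omega>. g x = 0}"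
  have "open Z" by (simp add: Z_def)
  have Z0: "g y = 0" if "y \<in> Z" for y using that interior_subset unfolding Z_def by blast
  have ZI: "y \<in> Z" if "open U" "y \<in> U" "\<And>z. z \<in> U \<inter> \<Omega> \<Longrightarrow> g z = 0" "y \<in> \<Omega>" for U y
    unfolding Z_def by (rule interiorI[of "U \<inter> \<Omega>"]) (use that \<Omega> in auto)
  have "p \<in> Z"
  proof (rule real_analytic_local_identity[OF g p])
    fix R :: real assume "0 < R" "\<And>y. (\<And>M. vanishes_to_order UNIV p M g) \<Longrightarrow> y \<in> ball p R \<Longrightarrow> g y = 0"
    then show "p \<in> Z" using flat p by (intro ZI[of "ball p R"]) simp_all
  qed
  have "open (\<Omega> - Z)"
    unfolding open_subopen[of "\<Omega> - Z"]
  proof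
    fix a assume a: "a \<in> \<Omega> - Z"
    show "\<exists>T. open T \<and> a \<in> T \<and> T \<subseteq> \<Omega> - Z"
    proof (rule real_analytic_local_identity[OF g, of a])
      fix R :: real assume R: "0 < R" and id: "\<And>U y. open U \<Longrightarrow> U \<inter> ball a R \<noteq> {} \<Longrightarrow>
          (\<And>x. x \<in> U \<Longrightarrow> g x = 0) \<Longrightarrow> y \<in> ball a R \<Longrightarrow> g y = 0"
      have "Z \<inter> ball a R = {}"
      proof (rule ccontr)
        assume "Z \<inter> ball a R \<noteq> {}"
        then have "g y = 0" if "y \<in> ball a R" for y
          using id[OF \<open>open Z\<close> _ Z0 that] by blast
        then have "a \<in> Z" using R a by (intro ZI[of "ball a R"]) simp_all
        with a show False by simp
      qed
      then show ?thesis using a \<Omega> R by (intro exI[of _ "ball a R \<inter> \<Omega>"]) auto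
    qed (use a in simp)
  qed
  then have "\<Omega> - Z = {} \<or> Z \<inter> \<Omega> = {}"
    using connectedD[OF \<Omega>(2) \<open>open Z\<close>, of "\<Omega> - Z"] by blast
  with \<open>p \<in> Z\<close> p have "x \<in> Z" using x by blast
  then show ?thesis by (rule Z0)
qed

section \<open>Hilbert function spaces\<close>

context hilbert_function_space
begin

lemma zero_mem [simp]: "0 \<in> H"
  by (rule cfun.subspace_0[OF subspace])

lemma add_mem [simp]: "g \<in> H \<Longrightarrow> h \<in> H \<Longrightarrow> g + h \<in> H"
  by (rule cfun.subspace_add[OF subspace])

lemma diff_mem [simp]: "g \<in> H \<Longrightarrow> h \<in> H \<Longrightarrow> g - h \<in> H"
  by (rule cfun.subspace_diff[OF subspace])

lemma scale_mem [simp]: "h \<in> H \<Longrightarrow> (\<lambda>x. c * h x) \<in> H"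
  by (rule cfun.subspace_scale[OF subspace])

lemma sum_mem: "(\<And>i. i \<in> I \<Longrightarrow> g i \<in> H) \<Longrightarrow> sum g I \<in> H"
  by (rule cfun.subspace_sum[OF subspace])

lemma ip_zero_left [simp]: "h \<in> H \<Longrightarrow> ip 0 h = 0"
  using ip_add_left[of 0 0 h] by simp

lemma ip_zero_right [simp]: "h \<in> H \<Longrightarrow> ip h 0 = 0"
  using ip_cnj[of h 0] by simp

lemma ip_diff_left: "g \<in> H \<Longrightarrow> h \<in> H \<Longrightarrow> u \<in> H \<Longrightarrow> ip (g - h) u = ip g u - ip h u"
  using ip_add_left[of "g - h" h u] by simp

lemma ip_add_right: "g \<in> H \<Longrightarrow> h \<in> H \<Longrightarrow> u \<in> H \<Longrightarrow> ip u (g + h) = ip u g + ip u h"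
  using ip_cnj[of u "g + h"] ip_cnj[of u g] ip_cnj[of u h] by (simp add: ip_add_left)

lemma ip_diff_right: "g \<in> H \<Longrightarrow> h \<in> H \<Longrightarrow> u \<in> H \<Longrightarrow> ip u (g - h) = ip u g - ip u h"
  using ip_add_right[of "g - h" h u] by simp

lemma ip_scale_right: "g \<in> H \<Longrightarrow> h \<in> H \<Longrightarrow> ip g (\<lambda>x. c * h x) = cnj c * ip g h"
  using ip_cnj[of g "\<lambda>x. c * h x"] ip_cnj[of g h] by (simp add: ip_scale_left)

lemma ip_sum_left:
  "finite I \<Longrightarrow> (\<And>i. i \<in> I \<Longrightarrow> g i \<in> H) \<Longrightarrow> u \<in> H \<Longrightarrow> ip (sum g I) u = (\<Sum>i\<in>I. ip (g i) u)"
  by (induction I rule: finite_induct) (simp_all add: ip_add_left sum_mem)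

lemma ip_sum_right:
  "finite I \<Longrightarrow> (\<And>i. i \<in> I \<Longrightarrow> g i \<in> H) \<Longrightarrow> u \<in> H \<Longrightarrow> ip u (sum g I) = (\<Sum>i\<in>I. ip u (g i))"
  by (induction I rule: finite_induct) (simp_all add: ip_add_right sum_mem)

lemma ip_self_nonneg: "h \<in> H \<Longrightarrow> 0 \<le> Re (ip h h)"
  using ip_pos[of h] by (cases "h = 0") auto

lemma hnorm_nonneg [simp]: "h \<in> H \<Longrightarrow> 0 \<le> hnorm ip h"
  by (simp add: hnorm_def ip_self_nonneg)

lemma hnorm_sq: "h \<in> H \<Longrightarrow> (hnorm ip h)\<^sup>2 = Re (ip h h)"
  by (simp add: hnorm_def ip_self_nonneg)

lemma ip_self: "h \<in> H \<Longrightarrow> ip h h = of_real ((hnorm ip h)\<^sup>2)"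
  using ip_cnj[of h h] by (simp add: hnorm_sq complex_eq_iff)

lemma hnorm_eq_0_iff: "h \<in> H \<Longrightarrow> hnorm ip h = 0 \<longleftrightarrow> h = 0"
  using ip_pos[of h] by (cases "h = 0") (simp_all add: hnorm_def)

lemma hnorm_scale: "h \<in> H \<Longrightarrow> hnorm ip (\<lambda>x. c * h x) = cmod c * hnorm ip h"
proof -
  assume h: "h \<in> H"
  have "ip (\<lambda>x. c * h x) (\<lambda>x. c * h x) = of_real ((cmod c * hnorm ip h)\<^sup>2)"
    using h by (simp add: ip_scale_left ip_scale_right ip_self power_mult_distrib)
      (simp add: mult.assoc[symmetric] del: of_real_power flip: complex_norm_square of_real_power)
  then show ?thesis using h unfolding hnorm_def[of ip "\<lambda>x. c * h x"] by simp
qed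

lemma hnorm_sq_add:
  assumes "g \<in> H" "h \<in> H"
  shows "(hnorm ip (g + h))\<^sup>2 = (hnorm ip g)\<^sup>2 + 2 * Re (ip g h) + (hnorm ip h)\<^sup>2"
proof -
  have "ip h g = cnj (ip g h)" by (rule ip_cnj[OF assms(2,1)])
  then show ?thesis using assms by (simp add: hnorm_sq ip_add_left ip_add_right)
qed

lemma cauchy_schwarz:
  assumes g: "g \<in> H" and h: "h \<in> H"
  shows "cmod (ip g h) \<le> hnorm ip g * hnorm ip h"
proof (cases "h = 0")
  case True
  then show ?thesis using g by simp
next
  case False
  define n where "n = (hnorm ip h)\<^sup>2"
  have n: "0 < n" using False h hnorm_eq_0_iff[OF h] by (simp add: n_def)
  \<comment> \<open>This makes g + c h orthogonal to \<open>h\<close>; the claim is that its squared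
    norm is nonnegative.\<close>
  define c where "c = - (ip g h / of_real n)"
  have "Re (ip g (\<lambda>x. c * h x)) = - ((cmod (ip g h))\<^sup>2 / n)"
  proof -
    have "ip g (\<lambda>x. c * h x) = - (of_real ((cmod (ip g h))\<^sup>2) / of_real n)"
      unfolding ip_scale_right[OF g h] complex_norm_square by (simp add: c_def)
    then show ?thesis by (simp del: of_real_power flip: of_real_divide)
  qed
  moreover have "(hnorm ip (\<lambda>x. c * h x))\<^sup>2 = (cmod (ip g h))\<^sup>2 / n"
  proof -
    have "cmod c = cmod (ip g h) / n" using n by (simp add: c_def norm_divide)
    then have "(hnorm ip (\<lambda>x. c * h x))\<^sup>2 = (cmod (ip g h) / n)\<^sup>2 * n"
      unfolding hnorm_scale[OF h] power_mult_distrib by (simp only: n_def)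
    then show ?thesis using n by (simp add: power_divide power2_eq_square)
  qed
  ultimately have "0 \<le> (hnorm ip g)\<^sup>2 - (cmod (ip g h))\<^sup>2 / n"
    using hnorm_sq_add[OF g scale_mem[OF h, of c]] zero_le_power2[of "hnorm ip (g + (\<lambda>x. c * h x))"]
    by linarith
  then have "(cmod (ip g h))\<^sup>2 \<le> (hnorm ip g * hnorm ip h)\<^sup>2"
    using n by (simp add: field_simps power_mult_distrib flip: n_def)
  then show ?thesis by (rule power2_le_imp_le) (simp add: g h)
qed

lemma hnorm_triangle:
  assumes "g \<in> H" "h \<in> H"
  shows "hnorm ip (g + h) \<le> hnorm ip g + hnorm ip h"
proof (rule power2_le_imp_le)
  show "(hnorm ip (g + h))\<^sup>2 \<le> (hnorm ip g + hnorm ip h)\<^sup>2"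
    using cauchy_schwarz[OF assms] complex_Re_le_cmod[of "ip g h"]
    unfolding hnorm_sq_add[OF assms] by (simp add: power2_sum)
qed (use assms in simp)

lemma hnorm_sum:
  "finite I \<Longrightarrow> (\<And>i. i \<in> I \<Longrightarrow> g i \<in> H) \<Longrightarrow> hnorm ip (sum g I) \<le> (\<Sum>i\<in>I. hnorm ip (g i))"
proof (induction I rule: finite_induct)
  case empty
  have "hnorm ip 0 = 0" using hnorm_eq_0_iff[OF zero_mem] by (rule iffD2) (rule refl)
  then show ?case by (simp only: sum.empty order_refl)
next
  case (insert i I)
  then have "hnorm ip (g i + sum g I) \<le> hnorm ip (g i) + hnorm ip (sum g I)"
    by (intro hnorm_triangle sum_mem) auto
  moreover have "hnorm ip (sum g I) \<le> (\<Sum>i\<in>I. hnorm ip (g i))"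
    by (rule insert.IH) (simp add: insert.prems)
  ultimately show ?case unfolding sum.insert[OF insert.hyps] by linarith
qed

text \<open>The representing vector minimizes the functional \<open>\<parallel>u\<parallel>\<^sup>2 - 2 Re (F u)\<close>.\<close>

lemma riesz_representation:
  fixes F :: "('a \<Rightarrow> complex) \<Rightarrow> complex"
  assumes add: "\<And>g h. g \<in> H \<Longrightarrow> h \<in> H \<Longrightarrow> F (g + h) = F g + F h"
    and scale: "\<And>c h. h \<in> H \<Longrightarrow> F (\<lambda>x. c * h x) = c * F h"
    and bound: "\<And>h. h \<in> H \<Longrightarrow> cmod (F h) \<le> C * hnorm ip h"
  shows "\<exists>u\<in>H. \<forall>h\<in>H. F h = ip h u"
proof -
  define J where "J u = (hnorm ip u)\<^sup>2 - 2 * Re (F u)" for u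
  \<comment> \<open>Completing the square: |u|^2 - 2 C |u| = (|u| - C)^2 - C^2.\<close>
  have J_ge: "- C\<^sup>2 \<le> J u" if "u \<in> H" for u
    using bound[OF that] complex_Re_le_cmod[of "F u"] zero_le_power2[of "hnorm ip u - C"]
    unfolding J_def power2_diff by (simp add: mult.commute) 
  define m where "m = (INF u\<in>H. J u)"
  have bdd: "bdd_below (J ` H)" using J_ge by (rule bdd_belowI2)
  have m_le: "m \<le> J u" if "u \<in> H" for u
    unfolding m_def by (rule cINF_lower[OF bdd that])
  have "\<exists>u\<in>H. J u < m + 1 / real (Suc n)" for n
  proof -
    have "m < m + 1 / real (Suc n)" by simp
    then show ?thesis unfolding m_def by (subst (asm) cINF_less_iff[OF _ bdd]) (auto intro: zero_mem)
  qed
  then obtain s where s: "\<And>n. s n \<in> H" "\<And>n. J (s n) < m + 1 / real (Suc n)" by metis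
  have J_add: "J (u + h) = J u + 2 * Re (ip h u - F h) + (hnorm ip h)\<^sup>2" if "u \<in> H" "h \<in> H" for u h
    using that ip_cnj[of u h] by (simp add: J_def hnorm_sq_add add)
  \<comment> \<open>Parallelogram law around the midpoint \<open>c\<close>: J a + J b = 2 J c + 2
    |h|^2, with \<open>h\<close> half the difference and J c \<ge> m.\<close>
  have close: "(hnorm ip (a - b))\<^sup>2 \<le> 2 * (J a - m) + 2 * (J b - m)" if a: "a \<in> H" and b: "b \<in> H" for a b
  proof -
    define h where "h = (\<lambda>x. 1/2 * (a - b) x)"
    define c where "c = (\<lambda>x. 1/2 * (a + b) x)"
    have mem: "h \<in> H" "c \<in> H"
      unfolding h_def c_def by (rule scale_mem[OF diff_mem[OF a b]], rule scale_mem[OF add_mem[OF a b]])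
    have ab: "a = c + h" "b + h = c" by (auto simp: h_def c_def fun_eq_iff field_simps)
    have "J a = J c + 2 * Re (ip h c - F h) + (hnorm ip h)\<^sup>2"
      unfolding ab(1) by (rule J_add[OF mem(2,1)])
    moreover have "J c = J b + 2 * Re (ip h b - F h) + (hnorm ip h)\<^sup>2"
      using J_add[OF b mem(1)] ab(2) by simp
    moreover have "ip h c = ip h b + ip h h"
      using ip_add_right[OF b mem(1) mem(1)] ab(2) by simp
    ultimately have "J a + J b = 2 * J c + 2 * (hnorm ip h)\<^sup>2"
      using hnorm_sq[OF mem(1)] by simp
    moreover have "hnorm ip h = 1/2 * hnorm ip (a - b)"
      unfolding h_def using hnorm_scale[of "a - b" "1/2"] a b by simp
    ultimately show ?thesis using m_le[OF mem(2)] by (simp add: power_mult_distrib power_divide)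
  qed
  have "\<exists>u\<in>H. (\<lambda>n. hnorm ip (s n - u)) \<longlonglongrightarrow> 0"
  proof (rule complete[OF s(1)])
    fix e :: real assume e: "0 < e"
    \<comment> \<open>From index \<open>M\<close> on the excess over the infimum is below 1/M, so
      squared distances are below 4/M < e^2.\<close>
    then obtain M where M: "4 / e\<^sup>2 < real M" using reals_Archimedean2 by blast
    have "hnorm ip (s i - s j) < e" if "M \<le> i" "M \<le> j" for i j
    proof (rule power2_less_imp_less)
      have "0 < 4 / e\<^sup>2" using e by simp
      with M have M0: "0 < real M" by linarith
      define \<epsilon> where "\<epsilon> = 1 / real M"
      have small: "J (s l) - m < \<epsilon>" if "M \<le> l" for l
      proof -
        have "1 / real (Suc l) \<le> 1 / real M" using that M0 by (intro divide_left_mono) auto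
        with s(2)[of l] show ?thesis unfolding \<epsilon>_def by linarith
      qed
      have "(hnorm ip (s i - s j))\<^sup>2 \<le> 2 * (J (s i) - m) + 2 * (J (s j) - m)"
        by (rule close[OF s(1) s(1)])
      also have "\<dots> < 2 * \<epsilon> + 2 * \<epsilon>"
        by (intro add_strict_mono mult_strict_left_mono small that) simp_all
      also have "\<dots> < e\<^sup>2" using M M0 e by (simp add: \<epsilon>_def field_simps)
      finally show "(hnorm ip (s i - s j))\<^sup>2 < e\<^sup>2" .
    qed (use e in simp)
    then show "\<exists>M. \<forall>i\<ge>M. \<forall>j\<ge>M. hnorm ip (s i - s j) < e" by blast
  qed
  then obtain u where u: "u \<in> H" and lim: "(\<lambda>n. hnorm ip (s n - u)) \<longlonglongrightarrow> 0" by blast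
  \<comment> \<open>J u exceeds J (s n) by at most a constant times |s n - u|, so the infimum is
    attained at the limit.\<close>
  have "J u - m \<le> 0"
  proof (rule tendsto_le[OF sequentially_bot])
    show "(\<lambda>n. 1 / real (Suc n) + 2 * (hnorm ip u + C) * hnorm ip (s n - u)) \<longlonglongrightarrow> 0"
      using tendsto_add[OF LIMSEQ_Suc[OF lim_const_over_n[of "1 :: real"]]
          tendsto_mult_left[OF lim, of "2 * (hnorm ip u + C)"]] by simp
    show "(\<lambda>n. J u - m) \<longlonglongrightarrow> J u - m" by simp
    show "\<forall>\<^sub>F n in sequentially. J u - m \<le> 1 / real (Suc n) + 2 * (hnorm ip u + C) * hnorm ip (s n - u)"
    proof (rule always_eventually, rule allI)
      fix n
      define d where "d = s n - u"
      have sn: "s n = u + d" by (simp add: d_def)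
      have d: "d \<in> H" unfolding d_def using s(1) u by simp
      have "J (s n) = J u + 2 * Re (ip d u - F d) + (hnorm ip d)\<^sup>2"
        unfolding sn by (rule J_add[OF u d])
      then have "J (s n) + 2 * Re (F d) = J u + 2 * Re (ip d u) + (hnorm ip d)\<^sup>2"
        by (simp add: algebra_simps)
      moreover have "0 \<le> hnorm ip d * hnorm ip u + Re (ip d u)"
        using cauchy_schwarz[OF d u] abs_Re_le_cmod[of "ip d u"] by linarith
      moreover have "Re (F d) \<le> C * hnorm ip d"
        using bound[OF d] complex_Re_le_cmod[of "F d"] by linarith
      ultimately have "J u \<le> m + 1 / real (Suc n) + 2 * (hnorm ip d * hnorm ip u) + 2 * (C * hnorm ip d)"
        using s(2)[of n] zero_le_power2[of "hnorm ip d"] by linarith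
      then show "J u - m \<le> 1 / real (Suc n) + 2 * (hnorm ip u + C) * hnorm ip (s n - u)"
        unfolding d_def[symmetric] by (simp add: algebra_simps)
    qed
  qed
  then have min: "J u \<le> J g" if "g \<in> H" for g using m_le[OF that] by linarith
  have Re_eq: "Re (ip h u - F h) = 0" if h: "h \<in> H" for h
  proof -
    define b where "b = Re (ip h u - F h)"
    define q where "q = (hnorm ip h)\<^sup>2"
    have q: "0 \<le> q" by (simp add: q_def)
    have quad: "0 \<le> 2 * t * b + t\<^sup>2 * q" for t :: real
    proof -
      let ?th = "\<lambda>x. of_real t * h x"
      have "J u \<le> J (u + ?th)" using u h by (intro min add_mem scale_mem)
      also have "\<dots> = J u + 2 * Re (ip ?th u - F ?th) + (hnorm ip ?th)\<^sup>2"
        using u h by (intro J_add scale_mem)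
      also have "ip ?th u - F ?th = of_real t * (ip h u - F h)"
        using u h by (simp add: ip_scale_left scale algebra_simps)
      finally show ?thesis
        using h by (simp add: b_def q_def hnorm_scale power_mult_distrib)
    qed
    \<comment> \<open>A small step against the sign of \<open>b\<close> would make the quadratic
      negative unless b = 0; q + 1 in place of q allows q = 0.\<close>
    define c where "c = b / (q + 1)"
    have b: "b = c * (q + 1)" using q by (simp add: c_def)
    have "0 \<le> 2 * (- c) * b + (- c)\<^sup>2 * q" by (rule quad)
    also have "\<dots> = - (c\<^sup>2 * (q + 2))"
      by (simp add: b algebra_simps power2_eq_square)
    finally have "c\<^sup>2 * (q + 2) \<le> 0" by simp
    then have "c = 0" using q by (auto simp: mult_le_0_iff)
    then have "b = 0" using b by simp
    then show ?thesis by (simp add: b_def)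
  qed
  have "F h = ip h u" if h: "h \<in> H" for h
  proof -
    \<comment> \<open>Varying in the direction i h supplies the imaginary part.\<close>
    have "Re (\<i> * (ip h u - F h)) = 0"
      using Re_eq[OF scale_mem[OF h, of \<i>]] h u by (simp add: ip_scale_left scale)
    with Re_eq[OF h] show ?thesis by (simp add: complex_eq_iff)
  qed
  with u show ?thesis by blast
qed

end

section \<open>Coordinates with respect to a finite basis\<close>

definition lin_comb :: "(nat \<Rightarrow> 'a \<Rightarrow> complex) \<Rightarrow> nat \<Rightarrow> complex Matrix.vec \<Rightarrow> 'a \<Rightarrow> complex"
  where "lin_comb v r w = (\<Sum>i<r. (\<lambda>x. vec_index w i * v i x))"

lemma indexed_basis_lin_comb:
  assumes "indexed_basis v {..<r} V" "h \<in> V"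
  obtains w where "w \<in> carrier_vec r" "h = lin_comb v r w"
proof -
  have inj: "inj_on v {..<r}" and span: "cfun.span (v ` {..<r}) = V"
    using assms(1) by (auto simp: indexed_basis_def)
  obtain u where "h = (\<Sum>b\<in>v ` {..<r}. (\<lambda>x. u b * b x))"
    using assms(2) span cfun.span_finite[of "v ` {..<r}"] by auto
  then have "h = (\<Sum>i<r. (\<lambda>x. u (v i) * v i x))"
    by (simp only: sum.reindex[OF inj] o_def)
  also have "\<dots> = lin_comb v r (Matrix.vec r (\<lambda>i. u (v i)))"
    unfolding lin_comb_def by (intro sum.cong) auto
  finally show ?thesis by (intro that[of "Matrix.vec r (\<lambda>i. u (v i))"]) simp_all
qed

lemma indexed_basis_mem: "indexed_basis v {..<r} V \<Longrightarrow> i < r \<Longrightarrow> v i \<in> V"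
  using cfun.span_base[of "v i" "v ` {..<r}"] by (auto simp: indexed_basis_def)

lemma indexed_basis_subspace: "indexed_basis v {..<r} V \<Longrightarrow> cfun.subspace V"
  using cfun.subspace_span[of "v ` {..<r}"] by (simp add: indexed_basis_def)

lemma lin_comb_mem: "indexed_basis v {..<r} V \<Longrightarrow> lin_comb v r w \<in> V"
  unfolding lin_comb_def
  by (intro cfun.subspace_sum cfun.subspace_scale indexed_basis_subspace indexed_basis_mem) simp_all

lemma lin_comb_eq_0:
  assumes "indexed_basis v {..<r} V" "w \<in> carrier_vec r" "lin_comb v r w = 0"
  shows "w = 0\<^sub>v r"
proof (rule eq_vecI)
  have inj: "inj_on v {..<r}" and ind: "cfun.independent (v ` {..<r})"
    using assms(1) by (auto simp: indexed_basis_def)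
  define u where "u b = vec_index w (the_inv_into {..<r} v b)" for b
  have u: "u (v i) = vec_index w i" if "i < r" for i
    using that the_inv_into_f_f[OF inj] by (simp add: u_def)
  have "(\<Sum>b\<in>v ` {..<r}. (\<lambda>x. u b * b x)) = (\<Sum>i<r. (\<lambda>x. u (v i) * v i x))"
    by (simp only: sum.reindex[OF inj] o_def)
  also have "\<dots> = lin_comb v r w" unfolding lin_comb_def by (intro sum.cong) (simp_all add: u)
  finally have "(\<Sum>b\<in>v ` {..<r}. (\<lambda>x. u b * b x)) = 0" using assms(3) by simp
  then have "u (v i) = 0" if "i < r" for i
    using cfun.independentD[OF ind _ subset_refl, of u "v i"] that by simp
  then show "vec_index w i = vec_index (0\<^sub>v r) i" if "i < dim_vec (0\<^sub>v r :: complex Matrix.vec)" for i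
    using that u by simp
qed (use assms(2) in simp)

text \<open>Links coordinate vectors to \<open>cfun.representation\<close>, through which
  \<open>matrix_in_basis\<close> is defined.\<close>

lemma representation_lin_comb:
  assumes "indexed_basis v {..<r} V" "w \<in> carrier_vec r" "i < r"
  shows "cfun.representation (v ` {..<r}) (lin_comb v r w) (v i) = vec_index w i"
proof -
  have inj: "inj_on v {..<r}" and ind: "cfun.independent (v ` {..<r})"
    using assms(1) by (auto simp: indexed_basis_def)
  have mem: "v j \<in> cfun.span (v ` {..<r})" if "j < r" for j
    using that by (intro cfun.span_base) simp
  have "cfun.representation (v ` {..<r}) (lin_comb v r w) (v i) =
      (\<Sum>j<r. cfun.representation (v ` {..<r}) (\<lambda>x. vec_index w j * v j x) (v i))"
    unfolding lin_comb_def
    by (subst cfun.representation_sum[OF ind]) (auto intro!: cfun.span_scale mem)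
  also have "\<dots> = (\<Sum>j<r. if j = i then vec_index w j else 0)"
  proof (intro sum.cong refl)
    fix j assume "j \<in> {..<r}"
    then have j: "j < r" by simp
    have "cfun.representation (v ` {..<r}) (\<lambda>x. vec_index w j * v j x) =
        (\<lambda>b. vec_index w j * cfun.representation (v ` {..<r}) (v j) b)"
      by (rule cfun.representation_scale[OF ind mem[OF j]])
    moreover have "cfun.representation (v ` {..<r}) (v j) = (\<lambda>b. if b = v j then 1 else 0)"
      using j by (intro cfun.representation_basis[OF ind]) simp
    ultimately show "cfun.representation (v ` {..<r}) (\<lambda>x. vec_index w j * v j x) (v i) =
        (if j = i then vec_index w j else 0)"
      using inj_on_eq_iff[OF inj, of i j] assms(3) j by simp
  qed
  also have "\<dots> = vec_index w i" using assms(3) by simp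
  finally show ?thesis .
qed

lemma gram_mat_carrier [simp]: "gram_mat ip v r \<in> carrier_mat r r"
  by (simp add: gram_mat_def)

lemma gram_mat_dim [simp]: "dim_row (gram_mat ip v r) = r" "dim_col (gram_mat ip v r) = r"
  by (simp_all add: gram_mat_def)

lemma lin_comb_apply: "lin_comb v r w x = (\<Sum>i<r. vec_index w i * v i x)"
proof -
  have "(\<Sum>i\<in>I. g i) x = (\<Sum>i\<in>I. g i x)" if "finite I" for I :: "nat set" and g :: "nat \<Rightarrow> 'a \<Rightarrow> complex"
    using that by (induction I rule: finite_induct) simp_all
  then show ?thesis by (simp add: lin_comb_def)
qed

lemma comp_op_add: "comp_op \<Omega> f (g + h) = comp_op \<Omega> f g + comp_op \<Omega> f h"
  by (auto simp: comp_op_def fun_eq_iff)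

lemma comp_op_diff: "comp_op \<Omega> f (g - h) = comp_op \<Omega> f g - comp_op \<Omega> f h"
  by (auto simp: comp_op_def fun_eq_iff)

lemma comp_op_scale: "comp_op \<Omega> f (\<lambda>x. c * h x) = (\<lambda>x. c * comp_op \<Omega> f h x)"
  by (auto simp: comp_op_def fun_eq_iff)

lemma comp_op_lin_comb: "comp_op \<Omega> f (lin_comb v r w) = lin_comb (\<lambda>i. comp_op \<Omega> f (v i)) r w"
  by (auto simp: comp_op_def fun_eq_iff lin_comb_apply)

section \<open>Gram matrices, orthogonal projections and operator norms\<close>

context hilbert_function_space
begin

lemma ip_lin_comb_left:
  "(\<And>i. i < r \<Longrightarrow> v i \<in> H) \<Longrightarrow> u \<in> H \<Longrightarrow> ip (lin_comb v r w) u = (\<Sum>i<r. vec_index w i * ip (v i) u)"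
  unfolding lin_comb_def by (subst ip_sum_left) (auto intro!: sum.cong simp: ip_scale_left)

lemma ip_lin_comb_right:
  "(\<And>i. i < r \<Longrightarrow> v i \<in> H) \<Longrightarrow> u \<in> H \<Longrightarrow> ip u (lin_comb v r w) = (\<Sum>i<r. cnj (vec_index w i) * ip u (v i))"
  unfolding lin_comb_def by (subst ip_sum_right) (auto intro!: sum.cong simp: ip_scale_right)

lemma subspace_orthogonal: "h \<in> H \<Longrightarrow> cfun.subspace {w \<in> H. ip h w = 0}"
  by (rule cfun.subspaceI) (simp_all add: ip_add_right ip_scale_right)

context
  fixes v :: "nat \<Rightarrow> 'a \<Rightarrow> complex" and r :: nat and V :: "('a \<Rightarrow> complex) set"
  assumes basis: "indexed_basis v {..<r} V" and VH: "V \<subseteq> H"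
begin

private abbreviation "G \<equiv> gram_mat ip v r"

lemma basis_mem_H: "i < r \<Longrightarrow> v i \<in> H"
  using indexed_basis_mem[OF basis] VH by blast

lemma lin_comb_mem_H: "lin_comb v r w \<in> H"
  using lin_comb_mem[OF basis] VH by blast

text \<open>Coordinates are sent to inner products with the basis; this is why the column index of
  \<open>gram_mat\<close> sits in the linear first slot.\<close>

lemma gram_mat_mult_vec:
  assumes "w \<in> carrier_vec r" "i < r"
  shows "vec_index (G *\<^sub>v w) i = ip (lin_comb v r w) (v i)"
  using assms
  by (simp add: gram_mat_def scalar_prod_def ip_lin_comb_left basis_mem_H atLeast0LessThan mult.commute)

lemma gram_mat_form:
  assumes w: "w \<in> carrier_vec r"
  shows "(G *\<^sub>v w) \<bullet>c w = of_real ((hnorm ip (lin_comb v r w))\<^sup>2)"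
proof -
  have "(G *\<^sub>v w) \<bullet>c w = (\<Sum>i<r. cnj (vec_index w i) * ip (lin_comb v r w) (v i))"
    using w by (simp add: cscalar_prod_sum gram_mat_mult_vec mult.commute del: index_mult_mat_vec)
  also have "\<dots> = ip (lin_comb v r w) (lin_comb v r w)"
    by (rule ip_lin_comb_right[symmetric, OF basis_mem_H lin_comb_mem_H])
  finally show ?thesis by (simp only: ip_self[OF lin_comb_mem_H])
qed

lemma gram_mat_injective:
  assumes w: "w \<in> carrier_vec r" and z: "G *\<^sub>v w = 0\<^sub>v r"
  shows "w = 0\<^sub>v r"
proof -
  have "(G *\<^sub>v w) \<bullet>c w = 0" unfolding z using w by (simp add: cscalar_prod_sum)
  then have "hnorm ip (lin_comb v r w) = 0" unfolding gram_mat_form[OF w] by simp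
  then have "lin_comb v r w = 0" by (simp only: hnorm_eq_0_iff[OF lin_comb_mem_H])
  then show ?thesis by (rule lin_comb_eq_0[OF basis w])
qed

lemma gram_mat_inv:
  "mat_inv G \<in> carrier_mat r r" "G * mat_inv G = 1\<^sub>m r" "mat_inv G * G = 1\<^sub>m r"
proof -
  have inj: "\<forall>w\<in>carrier_vec r. G *\<^sub>v w = 0\<^sub>v r \<longrightarrow> w = 0\<^sub>v r"
    using gram_mat_injective by blast
  show "mat_inv G \<in> carrier_mat r r" "G * mat_inv G = 1\<^sub>m r" "mat_inv G * G = 1\<^sub>m r"
    by (rule mat_inv[OF gram_mat_carrier inj])+
qed

lemma gram_mat_adjoint: "mat_adjoint G = G"
proof (rule eq_matI)
  fix i j assume "i < dim_row G" "j < dim_col G"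
  then have ij: "i < r" "j < r" by simp_all
  then show "mat_adjoint G $$ (i, j) = G $$ (i, j)"
    using ip_cnj[OF basis_mem_H[OF ij(2)] basis_mem_H[OF ij(1)]] by (simp add: gram_mat_def)
qed simp_all

lemma gram_mat_inv_adjoint: "mat_adjoint (mat_inv G) = mat_inv G"
  by (rule adjoint_inverse[OF gram_mat_carrier gram_mat_adjoint gram_mat_inv])

text \<open>With y = G^{-1} w the form is <y, G y>, the squared norm of the combination with
  coefficients y. Positivity makes the square root of the inverse available.\<close>

lemma gram_mat_inv_psd: "psd_mat (mat_inv G)"
  unfolding psd_mat_def
proof (intro conjI ballI)
  note Gi = gram_mat_inv
  show "square_mat (mat_inv G)" using carrier_matD[OF Gi(1)] by simp
  show "mat_adjoint (mat_inv G) = mat_inv G" by (rule gram_mat_inv_adjoint)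
  fix w :: "complex Matrix.vec"
  assume "w \<in> carrier_vec (dim_row (mat_inv G))"
  then have w: "w \<in> carrier_vec r" using carrier_matD[OF Gi(1)] by simp
  define y where "y = mat_inv G *\<^sub>v w"
  have y: "y \<in> carrier_vec r" unfolding y_def by (rule mult_mat_vec_carrier[OF Gi(1) w])
  have Gy: "G *\<^sub>v y = w"
    unfolding y_def assoc_mult_mat_vec[OF gram_mat_carrier Gi(1) w, symmetric] Gi(2) using w by simp
  have "y \<bullet>c w = y \<bullet>c (mat_adjoint G *\<^sub>v y)" by (simp only: gram_mat_adjoint Gy)
  also have "\<dots> = (G *\<^sub>v y) \<bullet>c y" by (rule cscalar_prod_adjoint[symmetric, OF gram_mat_carrier y y])
  finally have "y \<bullet>c w = of_real ((hnorm ip (lin_comb v r y))\<^sup>2)" unfolding gram_mat_form[OF y] .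
  then show "0 \<le> Re ((mat_inv G *\<^sub>v w) \<bullet>c w)" unfolding y_def[symmetric] by simp
qed

text \<open>Inverting the Gram matrix solves the moment problem in \<open>V\<close>: it finds the
  element with prescribed inner products with the basis. Projections and values of the adjoint are
  both built this way.\<close>

lemma lin_comb_gram_inv:
  assumes b: "b \<in> carrier_vec r" and i: "i < r"
  shows "ip (lin_comb v r (mat_inv G *\<^sub>v b)) (v i) = vec_index b i"
proof -
  note Gi = gram_mat_inv
  have y: "mat_inv G *\<^sub>v b \<in> carrier_vec r" by (rule mult_mat_vec_carrier[OF Gi(1) b])
  have "G *\<^sub>v (mat_inv G *\<^sub>v b) = b"
    unfolding assoc_mult_mat_vec[OF gram_mat_carrier Gi(1) b, symmetric] Gi(2) using b by simp
  then show ?thesis using gram_mat_mult_vec[OF y i] by simp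
qed

lemma ip_basis_ext:
  assumes "g \<in> H" and "\<And>i. i < r \<Longrightarrow> ip g (v i) = 0" and "w \<in> V"
  shows "ip g w = 0"
  using indexed_basis_lin_comb[OF basis assms(3)] ip_lin_comb_right[OF basis_mem_H assms(1)] assms(2) by fastforce

lemma orth_proj_eq:
  assumes h: "h \<in> H" and u: "u \<in> V" and orth: "\<And>w. w \<in> V \<Longrightarrow> ip (h - u) w = 0"
  shows "orth_proj ip V h = u"
  unfolding orth_proj_def
proof (rule the_equality)
  fix z assume z: "z \<in> V \<and> (\<forall>w\<in>V. ip (h - z) w = 0)"
  have H: "z \<in> H" "u \<in> H" using z u VH by auto
  have zu: "z - u \<in> V" using z u by (intro cfun.subspace_diff[OF indexed_basis_subspace[OF basis]]) auto
  have "z - u = (h - u) - (h - z)" by simp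
  then have "ip (z - u) (z - u) = ip (h - u) (z - u) - ip (h - z) (z - u)"
    using ip_diff_left[of "h - u" "h - z" "z - u"] h H by simp
  also have "\<dots> = 0" using orth[OF zu] z zu by simp
  finally have "hnorm ip (z - u) = 0" by (simp add: hnorm_def)
  then have "z - u = 0" using H by (simp only: hnorm_eq_0_iff[OF diff_mem])
  then show "z = u" by simp
qed (use u orth in blast)

lemma orth_proj_lin_comb:
  assumes h: "h \<in> H"
  shows "orth_proj ip V h = lin_comb v r (mat_inv G *\<^sub>v Matrix.vec r (\<lambda>i. ip h (v i)))" (is "_ = ?u")
proof (rule orth_proj_eq[OF h lin_comb_mem[OF basis]])
  fix w assume "w \<in> V"
  then show "ip (h - ?u) w = 0"
  proof (rule ip_basis_ext[rotated -1])
    show "h - ?u \<in> H" using h lin_comb_mem_H by simp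
    fix i assume "i < r"
    then show "ip (h - ?u) (v i) = 0"
      using h lin_comb_mem_H basis_mem_H lin_comb_gram_inv[of "Matrix.vec r (\<lambda>i. ip h (v i))" i]
      by (simp add: ip_diff_left)
  qed
qed

lemma orth_proj:
  assumes h: "h \<in> H"
  shows "orth_proj ip V h \<in> V" "\<And>w. w \<in> V \<Longrightarrow> ip (h - orth_proj ip V h) w = 0"
proof -
  show mem: "orth_proj ip V h \<in> V" unfolding orth_proj_lin_comb[OF h] by (rule lin_comb_mem[OF basis])
  fix w assume "w \<in> V"
  then show "ip (h - orth_proj ip V h) w = 0"
  proof (rule ip_basis_ext[rotated -1])
    show "h - orth_proj ip V h \<in> H" using h mem VH by auto
    fix i assume "i < r"
    then show "ip (h - orth_proj ip V h) (v i) = 0"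
      unfolding orth_proj_lin_comb[OF h]
      using h lin_comb_mem_H basis_mem_H lin_comb_gram_inv[of "Matrix.vec r (\<lambda>i. ip h (v i))" i]
      by (simp add: ip_diff_left)
  qed
qed

text \<open>Pythagoras for h - u = (h - z) + (z - u), with z the projection, gives |h - z| \<le> |h
  - u| for every u in \<open>V\<close>, hence also against the infimum.\<close>

lemma hnorm_orth_proj_le:
  assumes h: "h \<in> H"
  shows "hnorm ip (h - orth_proj ip V h) \<le> proj_error ip V h"
  unfolding proj_error_def
proof (rule cINF_greatest)
  show "V \<noteq> {}" using lin_comb_mem[OF basis] by blast
  fix u assume u: "u \<in> V"
  define z where "z = orth_proj ip V h"
  have z: "z \<in> V" unfolding z_def by (rule orth_proj(1)[OF h])
  have zu: "z - u \<in> V" by (rule cfun.subspace_diff[OF indexed_basis_subspace[OF basis] z u])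
  have mem: "h - z \<in> H" "z - u \<in> H" using h z zu VH by auto
  have "ip (h - z) (z - u) = 0" unfolding z_def using orth_proj(2)[OF h] zu by (simp add: z_def)
  then have "(hnorm ip ((h - z) + (z - u)))\<^sup>2 = (hnorm ip (h - z))\<^sup>2 + (hnorm ip (z - u))\<^sup>2"
    using hnorm_sq_add[OF mem] by simp
  then have "(hnorm ip (h - z))\<^sup>2 \<le> (hnorm ip (h - u))\<^sup>2" by simp
  moreover have "h - u \<in> H" using h u VH by auto
  then have "0 \<le> hnorm ip (h - u)" by (rule hnorm_nonneg)
  ultimately have "hnorm ip (h - z) \<le> hnorm ip (h - u)" by (rule power2_le_imp_le)
  then show "hnorm ip (h - orth_proj ip V h) \<le> hnorm ip (h - u)" unfolding z_def .
qed

text \<open>The supremum in \<open>op_norm_on\<close> has to be bounded first. It is, because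
  \<open>V\<close> has a finite basis whose coordinate functionals are controlled by the inverse
  Gram matrix; the estimate then follows by normalizing \<open>h\<close>.\<close>

lemma op_norm_on_bound:
  assumes T: "\<And>h. h \<in> V \<Longrightarrow> T h \<in> H"
    and add: "\<And>g h. T (g + h) = T g + T h" and scale: "\<And>c h. T (\<lambda>x. c * h x) = (\<lambda>x. c * T h x)"
    and h: "h \<in> V"
  shows "hnorm ip (T h) \<le> op_norm_on ip V T * hnorm ip h"
    and "0 \<le> op_norm_on ip V T"
proof -
  have T0: "T 0 = 0" using add[of 0 0] by simp
  have Tsum: "T (sum g I) = (\<Sum>i\<in>I. T (g i))" if "finite I" for g and I :: "nat set"
    using that
  proof (induction I rule: finite_induct)
    case empty
    show ?case by (simp only: sum.empty T0)
  next
    case (insert i I)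
    then show ?case by (simp only: sum.insert[OF insert.hyps] add insert.IH)
  qed
  note Gi = gram_mat_inv
  \<comment> \<open>The inner sum bounds the j-th coordinate of any element of norm at most 1, by
    Cauchy-Schwarz in each <g, v_i>.\<close>
  define K where "K = (\<Sum>j<r. (\<Sum>i<r. cmod (mat_inv G $$ (j, i)) * hnorm ip (v i)) * hnorm ip (T (v j)))"
  have bdd: "bdd_above ((\<lambda>h. hnorm ip (T h)) ` {h \<in> V. hnorm ip h \<le> 1})"
  proof (rule bdd_aboveI2)
    fix g assume g: "g \<in> {h \<in> V. hnorm ip h \<le> 1}"
    then have gV: "g \<in> V" and g1: "hnorm ip g \<le> 1" by auto
    have gH: "g \<in> H" using gV VH by blast
    define b where "b = Matrix.vec r (\<lambda>i. ip g (v i))"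
    define w where "w = mat_inv G *\<^sub>v b"
    have b: "b \<in> carrier_vec r" by (simp add: b_def)
    have w: "w \<in> carrier_vec r" unfolding w_def by (rule mult_mat_vec_carrier[OF Gi(1) b])
    \<comment> \<open>Projecting an element of \<open>V\<close> onto \<open>V\<close> exhibits its
      coordinates as G^{-1} b.\<close>
    have "orth_proj ip V g = g"
      by (rule orth_proj_eq[OF gH gV]) (use VH in auto)
    then have "g = lin_comb v r w" using orth_proj_lin_comb[OF gH] by (simp add: w_def b_def)
    then have "T g = (\<Sum>j<r. (\<lambda>x. vec_index w j * T (v j) x))"
      by (simp only: lin_comb_def Tsum[OF finite_lessThan] scale)
    then have "hnorm ip (T g) \<le> (\<Sum>j<r. hnorm ip (\<lambda>x. vec_index w j * T (v j) x))"
      by (simp only:) (intro hnorm_sum; simp add: T indexed_basis_mem[OF basis])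
    also have "\<dots> = (\<Sum>j<r. cmod (vec_index w j) * hnorm ip (T (v j)))"
      by (intro sum.cong refl hnorm_scale T indexed_basis_mem[OF basis]) simp
    also have "\<dots> \<le> K"
      unfolding K_def
    proof (intro sum_mono mult_right_mono)
      fix j assume "j \<in> {..<r}"
      then have j: "j < r" by simp
      then show "0 \<le> hnorm ip (T (v j))" by (intro hnorm_nonneg T indexed_basis_mem[OF basis])
      have "vec_index w j = (\<Sum>i<r. mat_inv G $$ (j, i) * ip g (v i))"
        using j carrier_matD[OF Gi(1)] by (simp add: w_def b_def scalar_prod_def atLeast0LessThan)
      then have "cmod (vec_index w j) \<le> (\<Sum>i<r. cmod (mat_inv G $$ (j, i)) * cmod (ip g (v i)))"
        by (simp add: order_trans[OF norm_sum] norm_mult)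
      also have "\<dots> \<le> (\<Sum>i<r. cmod (mat_inv G $$ (j, i)) * hnorm ip (v i))"
      proof (intro sum_mono mult_left_mono)
        fix i assume "i \<in> {..<r}"
        then have vi: "v i \<in> H" by (simp add: basis_mem_H)
        have "cmod (ip g (v i)) \<le> hnorm ip g * hnorm ip (v i)" by (rule cauchy_schwarz[OF gH vi])
        also have "\<dots> \<le> 1 * hnorm ip (v i)" using vi by (intro mult_right_mono g1) simp
        finally show "cmod (ip g (v i)) \<le> hnorm ip (v i)" by simp
      qed simp
      finally show "cmod (vec_index w j) \<le> (\<Sum>i<r. cmod (mat_inv G $$ (j, i)) * hnorm ip (v i))" .
    qed
    finally show "hnorm ip (T g) \<le> K" .
  qed
  have zero: "(0 :: 'a \<Rightarrow> complex) \<in> V" "hnorm ip 0 = 0"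
    using cfun.subspace_0[OF indexed_basis_subspace[OF basis]] hnorm_eq_0_iff[OF zero_mem] by blast+
  have le: "hnorm ip (T g) \<le> op_norm_on ip V T" if "g \<in> V" "hnorm ip g \<le> 1" for g
    unfolding op_norm_on_def using that by (intro cSUP_upper[OF _ bdd]) simp
  show nonneg: "0 \<le> op_norm_on ip V T"
    using order_trans[OF hnorm_nonneg le[OF zero(1)]] zero T0 by simp
  have hH: "h \<in> H" using h VH by blast
  show "hnorm ip (T h) \<le> op_norm_on ip V T * hnorm ip h"
  proof (cases "h = 0")
    case True
    then show ?thesis using zero(2) T0 by simp
  next
    case False
    then have pos: "0 < hnorm ip h" using hnorm_eq_0_iff[OF hH] hnorm_nonneg[OF hH] by linarith
    define c :: complex where "c = of_real (1 / hnorm ip h)"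
    have c: "cmod c = 1 / hnorm ip h" using pos by (simp add: c_def norm_divide)
    have "hnorm ip (T (\<lambda>x. c * h x)) \<le> op_norm_on ip V T"
      by (rule le[OF cfun.subspace_scale[OF indexed_basis_subspace[OF basis] h]])
        (use pos in \<open>simp add: hnorm_scale[OF hH] c\<close>)
    then show ?thesis using pos by (simp add: scale hnorm_scale[OF T[OF h]] c field_simps)
  qed
qed

end

end

text \<open>Let q be the vector of all <e, C v_l> and h the combination with coefficients G^{-1} q,
  so <h, v_l> = <e, C v_l>. Then |S q|^2 = <q, G^{-1} q> = |h|^2, and the same number equals <e, C
  h>, at most |e| |h| times the operator norm; one |h| cancels.\<close>

lemma (in hilbert_function_space) cvec_norm_sqrt_gram_le:
  assumes basis: "indexed_basis v {..<r} V" and VH: "V \<subseteq> H"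
    and T: "\<And>h. h \<in> V \<Longrightarrow> comp_op \<Omega> f h \<in> H" and e: "e \<in> H"
  defines "S \<equiv> mat_sqrt (mat_inv (gram_mat ip v r))"
  shows "cvec_norm (S *\<^sub>v Matrix.vec r (\<lambda>l. ip e (comp_op \<Omega> f (v l)))) \<le>
    op_norm_on ip V (comp_op \<Omega> f) * hnorm ip e"
proof -
  let ?G = "gram_mat ip v r" and ?C = "comp_op \<Omega> f"
  define q where "q = Matrix.vec r (\<lambda>l. ip e (?C (v l)))"
  note Gi = gram_mat_inv[OF basis VH]
  note S = mat_sqrt[OF Gi(1) gram_mat_inv_psd[OF basis VH], folded S_def]
  have q: "q \<in> carrier_vec r" by (simp add: q_def)
  define y where "y = mat_inv ?G *\<^sub>v q"
  have y: "y \<in> carrier_vec r" unfolding y_def by (rule mult_mat_vec_carrier[OF Gi(1) q])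
  have Gy: "?G *\<^sub>v y = q"
    unfolding y_def assoc_mult_mat_vec[OF gram_mat_carrier Gi(1) q, symmetric] Gi(2) using q by simp
  define h where "h = lin_comb v r y"
  have hV: "h \<in> V" unfolding h_def by (rule lin_comb_mem[OF basis])
  have hH: "h \<in> H" using hV VH by blast
  have form: "q \<bullet>c y = of_real ((hnorm ip h)\<^sup>2)"
    using gram_mat_form[OF basis VH y] by (simp only: Gy h_def)
  have Sq: "S *\<^sub>v q \<in> carrier_vec r" by (rule mult_mat_vec_carrier[OF S(1) q])
  have S': "mat_adjoint S = S" using S(2) by (simp add: psd_mat_def)
  have "(S *\<^sub>v q) \<bullet>c (S *\<^sub>v q) = q \<bullet>c (mat_adjoint S *\<^sub>v (S *\<^sub>v q))"
    by (rule cscalar_prod_adjoint[OF S(1) q Sq])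
  also have "mat_adjoint S *\<^sub>v (S *\<^sub>v q) = y"
    unfolding S' assoc_mult_mat_vec[OF S(1) S(1) q, symmetric] S(3) y_def ..
  finally have "(cvec_norm (S *\<^sub>v q))\<^sup>2 = (hnorm ip h)\<^sup>2"
    unfolding form cvec_norm_sq by (simp only: of_real_eq_iff)
  then have eq: "cvec_norm (S *\<^sub>v q) = hnorm ip h"
    using hnorm_nonneg[OF hH] by (simp add: power2_eq_iff_nonneg)
  have CH: "?C (v l) \<in> H" if "l < r" for l by (rule T[OF indexed_basis_mem[OF basis that]])
  have "q \<bullet>c y = ip e (?C h)"
    using y ip_lin_comb_right[of r "\<lambda>l. ?C (v l)" e y] CH e
    by (simp add: cscalar_prod_sum q_def h_def comp_op_lin_comb mult.commute)
  then have "(hnorm ip h)\<^sup>2 = cmod (ip e (?C h))" unfolding form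
    by (metis norm_of_real abs_power2 real_norm_def)
  also have "\<dots> \<le> hnorm ip e * hnorm ip (?C h)" by (rule cauchy_schwarz[OF e T[OF hV]])
  also have "\<dots> \<le> hnorm ip e * (op_norm_on ip V ?C * hnorm ip h)"
    by (intro mult_left_mono op_norm_on_bound(1)[OF basis VH T comp_op_add comp_op_scale hV] hnorm_nonneg[OF e])
  finally have "hnorm ip h * hnorm ip h \<le> hnorm ip h * (op_norm_on ip V ?C * hnorm ip e)"
    by (simp add: power2_eq_square ac_simps)
  moreover have "0 \<le> op_norm_on ip V ?C * hnorm ip e"
    by (intro mult_nonneg_nonneg op_norm_on_bound(2)[OF basis VH T comp_op_add comp_op_scale hV] hnorm_nonneg[OF e])
  ultimately have "hnorm ip h \<le> op_norm_on ip V ?C * hnorm ip e"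
    using hnorm_nonneg[OF hH] by (cases "hnorm ip h = 0") simp_all
  then show ?thesis unfolding q_def[symmetric] eq .
qed

section \<open>The adjoint of the composition operator\<close>

text \<open>Having a given derivative is the same condition for \<open>f\<close> and for
  \<open>f\<close> minus a constant, so \<open>partial_deriv\<close> returns the same function
  everywhere, even at points without a derivative. Only the outermost clauses of
  \<open>Ck_on\<close> change.\<close>

lemma C_infinity_on_diff_const:
  fixes f :: "real^'d::finite \<Rightarrow> 'b::real_normed_vector"
  assumes "C_infinity_on \<Omega> f"
  shows "C_infinity_on \<Omega> (\<lambda>x. f x - c)"
proof -
  have iff: "((\<lambda>t. g t - c) has_vector_derivative f') F \<longleftrightarrow> (g has_vector_derivative f') F"
    for g :: "real \<Rightarrow> 'b" and f' F
    using has_vector_derivative_diff[OF _ has_vector_derivative_const[of c F], of g f']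
      has_vector_derivative_add[OF _ has_vector_derivative_const[of c F], of "\<lambda>t. g t - c" f']
    by auto
  have pd: "partial_deriv i (\<lambda>x. f x - c) = partial_deriv i f" for i
    by (simp add: fun_eq_iff partial_deriv_def vector_derivative_def iff)
  have "Ck_on n \<Omega> f \<Longrightarrow> Ck_on n \<Omega> (\<lambda>x. f x - c)" for n
    by (cases n) (auto simp: pd intro!: continuous_intros)
  then show ?thesis using assms by (simp add: C_infinity_on_def)
qed

text \<open>In the theorem, \<open>V_subset\<close> is obtained from the inclusion of all V_{p,n} in
  the domain of C_f, which is a part of \<open>H\<close>.\<close>

locale analytic_rkhs = rkhs \<Omega> H ip k
  for \<Omega> :: "(real^'d::finite) set"
    and H :: "(real^'d \<Rightarrow> complex) set"
    and ip :: "(real^'d \<Rightarrow> complex) \<Rightarrow> (real^'d \<Rightarrow> complex) \<Rightarrow> complex"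
    and k :: "real^'d \<Rightarrow> real^'d \<Rightarrow> complex" +
  fixes p :: "real^'d"
  assumes open_\<Omega>: "open \<Omega>" and connected_\<Omega>: "connected \<Omega>"
    and smooth: "continuously_included_smooth \<Omega> H ip"
    and analytic: "h \<in> H \<Longrightarrow> real_analytic_on \<Omega> h"
    and p_mem: "p \<in> \<Omega>"
    and V_subset: "V_space k p n \<subseteq> H"
begin

section \<open>Derivatives at the base point as inner products\<close>

lemma smooth_H: "h \<in> H \<Longrightarrow> C_infinity_on \<Omega> h"
  using smooth by (simp add: continuously_included_smooth_def)

definition "kernel_deriv \<alpha> = (\<lambda>y. multi_deriv \<alpha> (\<lambda>x. k x y) p)"

lemma kernel_deriv_mem: "sum \<alpha> UNIV \<le> n \<Longrightarrow> kernel_deriv \<alpha> \<in> V_space k p n"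
  unfolding V_space_def kernel_deriv_def by (rule cfun.span_base) blast

lemma kernel_deriv_H: "kernel_deriv \<alpha> \<in> H"
  using kernel_deriv_mem[OF order_refl] V_subset by blast

lemma multi_deriv_add: "g \<in> H \<Longrightarrow> h \<in> H \<Longrightarrow> multi_deriv \<alpha> (g + h) p = multi_deriv \<alpha> g p + multi_deriv \<alpha> h p"
  using multi_deriv_linear_comb[OF open_\<Omega> bounded_linear_ident bounded_linear_ident smooth_H smooth_H _ p_mem,
      of g h "g + h"] by simp

lemma multi_deriv_scale: "h \<in> H \<Longrightarrow> multi_deriv \<alpha> (\<lambda>x. c * h x) p = c * multi_deriv \<alpha> h p"
  using multi_deriv_linear_comb[OF open_\<Omega> bounded_linear_mult_right[of c] bounded_linear_zero smooth_H smooth_H _ p_mem,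
      of h h "\<lambda>x. c * h x"] by simp

text \<open>Continuity of the inclusion at 0, for the compact set {p} and tolerance 1, bounds the
  derivative on a ball of radius \<delta>; rescaling \<open>h\<close> to norm \<delta>/2 gives the
  constant 2/\<delta>.\<close>

lemma multi_deriv_bounded: "\<exists>C. \<forall>h\<in>H. cmod (multi_deriv \<alpha> h p) \<le> C * hnorm ip h"
proof -
  have zero: "multi_deriv \<alpha> (0 :: real^'d \<Rightarrow> complex) p = 0"
    using multi_deriv_add[OF zero_mem zero_mem, of \<alpha>] by simp
  have "\<forall>h\<in>H. \<forall>\<alpha> K. compact K \<and> K \<subseteq> \<Omega> \<longrightarrow> (\<forall>\<epsilon>>0. \<exists>\<delta>>0. \<forall>g\<in>H. hnorm ip (g - h) < \<delta> \<longrightarrow>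
      (\<forall>x\<in>K. cmod (multi_deriv \<alpha> g x - multi_deriv \<alpha> h x) < \<epsilon>))"
    by (rule conjunct2[OF smooth[unfolded continuously_included_smooth_def]])
  from this[rule_format, OF zero_mem, of "{p}" 1 \<alpha>] p_mem
  have "\<exists>\<delta>>0. \<forall>g\<in>H. hnorm ip (g - 0) < \<delta> \<longrightarrow>
      (\<forall>x\<in>{p}. cmod (multi_deriv \<alpha> g x - multi_deriv \<alpha> 0 x) < 1)" by simp
  then obtain \<delta> where \<delta>: "0 < \<delta>" and
    small: "\<forall>g\<in>H. hnorm ip (g - 0) < \<delta> \<longrightarrow> (\<forall>x\<in>{p}. cmod (multi_deriv \<alpha> g x - multi_deriv \<alpha> 0 x) < 1)"
    by (elim exE conjE) (rule that)
  have small: "cmod (multi_deriv \<alpha> g p) < 1" if "g \<in> H" "hnorm ip g < \<delta>" for g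
    using small[rule_format, OF that(1), of p] that(2) by (simp add: zero)
  have "cmod (multi_deriv \<alpha> h p) \<le> 2 / \<delta> * hnorm ip h" if h: "h \<in> H" for h
  proof (cases "h = 0")
    case True
    then show ?thesis using zero hnorm_eq_0_iff[OF zero_mem] by simp
  next
    case False
    then have pos: "0 < hnorm ip h" using hnorm_eq_0_iff[OF h] hnorm_nonneg[OF h] by linarith
    define c where "c = \<delta> / (2 * hnorm ip h)"
    have c: "0 < c" using pos \<delta> by (simp add: c_def)
    have "hnorm ip (\<lambda>x. of_real c * h x) < \<delta>"
      using pos \<delta> c by (simp add: hnorm_scale[OF h]) (simp add: c_def)
    from small[OF scale_mem[OF h] this] have "c * cmod (multi_deriv \<alpha> h p) < 1"
      using c by (simp add: multi_deriv_scale[OF h] norm_mult)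
    then show ?thesis using pos \<delta> by (simp add: c_def field_simps)
  qed
  then show ?thesis by blast
qed

text \<open>The Riesz vector u of the derivative functional is identified by evaluation: u(y) = <u,
  k_y> is the conjugate of <k_y, u>, that is, of the derivative of k_y at p, and the conjugate of
  k_y is k(., y) on \<Omega>. Differentiation is thus never carried through the inner
  product.\<close>

lemma ip_kernel_deriv:
  assumes h: "h \<in> H"
  shows "ip h (kernel_deriv \<alpha>) = multi_deriv \<alpha> h p"
proof -
  obtain C where C: "\<forall>h\<in>H. cmod (multi_deriv \<alpha> h p) \<le> C * hnorm ip h"
    using multi_deriv_bounded[of \<alpha>] by (rule exE)
  have "\<exists>u\<in>H. \<forall>h\<in>H. multi_deriv \<alpha> h p = ip h u"
    by (rule riesz_representation[OF multi_deriv_add multi_deriv_scale C[rule_format]])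
  then obtain u where u: "u \<in> H" and rep: "\<forall>h\<in>H. multi_deriv \<alpha> h p = ip h u" by (rule bexE)
  have "u = kernel_deriv \<alpha>"
  proof
    fix y
    show "u y = kernel_deriv \<alpha> y"
    proof (cases "y \<in> \<Omega>")
      case False
      then show ?thesis using zero_outside[OF u] zero_outside[OF kernel_deriv_H] by simp
    next
      case True
      note ky = kernel_mem[OF True]
      have "u y = cnj (multi_deriv \<alpha> (k y) p)"
        using reproducing[OF u True] ip_cnj[OF u ky] rep[rule_format, OF ky] by simp
      also have "\<dots> = multi_deriv \<alpha> (\<lambda>x. k x y) p"
      proof -
        have "k x y = cnj (k y x) + 0" if "x \<in> \<Omega>" for x
          using reproducing[OF kernel_mem[OF that] True] reproducing[OF ky that]
            ip_cnj[OF kernel_mem[OF that] ky] by simp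
        from multi_deriv_linear_comb[OF open_\<Omega> bounded_linear_cnj bounded_linear_zero
            smooth_H[OF ky] smooth_H[OF ky] this p_mem]
        show ?thesis by simp
      qed
      finally show ?thesis by (simp add: kernel_deriv_def)
    qed
  qed
  then show ?thesis using rep h by simp
qed

lemma orthogonal_V_iff:
  assumes h: "h \<in> H"
  shows "(\<forall>w\<in>V_space k p n. ip h w = 0) \<longleftrightarrow> vanishes_to_order UNIV p (Suc n) h"
proof -
  have "(\<forall>w\<in>V_space k p n. ip h w = 0) \<longleftrightarrow> (\<forall>\<alpha>. sum \<alpha> UNIV \<le> n \<longrightarrow> ip h (kernel_deriv \<alpha>) = 0)"
  proof (intro iffI allI impI ballI)
    fix \<alpha> :: "'d \<Rightarrow> nat" assume "\<forall>w\<in>V_space k p n. ip h w = 0" "sum \<alpha> UNIV \<le> n"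
    then show "ip h (kernel_deriv \<alpha>) = 0" using kernel_deriv_mem by blast
  next
    fix w assume z: "\<forall>\<alpha>. sum \<alpha> UNIV \<le> n \<longrightarrow> ip h (kernel_deriv \<alpha>) = 0" and w: "w \<in> V_space k p n"
    have "V_space k p n \<subseteq> {w \<in> H. ip h w = 0}"
      unfolding V_space_def
    proof (rule cfun.span_minimal[OF _ subspace_orthogonal[OF h]])
      show "{\<lambda>y. multi_deriv \<alpha> (\<lambda>x. k x y) p |\<alpha>. sum \<alpha> UNIV \<le> n} \<subseteq> {w \<in> H. ip h w = 0}"
      proof
        fix w assume "w \<in> {\<lambda>y. multi_deriv \<alpha> (\<lambda>x. k x y) p |\<alpha>. sum \<alpha> UNIV \<le> n}"
        then obtain \<alpha> where "w = kernel_deriv \<alpha>" "sum \<alpha> UNIV \<le> n" unfolding kernel_deriv_def by auto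
        then show "w \<in> {w \<in> H. ip h w = 0}" using z kernel_deriv_H by simp
      qed
    qed
    then show "ip h w = 0" using w by blast
  qed
  also have "\<dots> \<longleftrightarrow> vanishes_to_order UNIV p (Suc n) h"
    unfolding vanishes_to_order_iff_multi_deriv[OF open_\<Omega> p_mem smooth_H[OF h]]
    by (simp only: ip_kernel_deriv[OF h] less_Suc_eq_le)
  finally show ?thesis .
qed

lemma orthogonal_all_V_imp_zero:
  assumes u: "u \<in> H" and orth: "\<And>n w. w \<in> V_space k p n \<Longrightarrow> ip u w = 0"
  shows "u = 0"
proof
  fix x
  have flat: "vanishes_to_order UNIV p M u" for M
  proof (cases M)
    case 0
    then show ?thesis by (simp add: vanishes_to_order_iff_multi_deriv[OF open_\<Omega> p_mem smooth_H[OF u]])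
  next
    case (Suc n)
    then show ?thesis using orthogonal_V_iff[OF u, of n] orth by simp
  qed
  show "u x = 0 x"
  proof (cases "x \<in> \<Omega>")
    case True
    then show ?thesis
      using real_analytic_flat_imp_zero[OF open_\<Omega> connected_\<Omega> analytic[OF u] p_mem flat] by simp
  qed (use zero_outside[OF u] in simp)
qed

section \<open>The adjoint of the composition operator on V_{p,m}\<close>

context
  fixes f :: "real^'d \<Rightarrow> real^'d"
  assumes f_maps: "f ` \<Omega> \<subseteq> \<Omega>" and f_smooth: "C_infinity_on \<Omega> f" and f_fix: "f p = p"
    and V_dom: "\<And>n. V_space k p n \<subseteq> comp_dom \<Omega> H f"
begin

text \<open>At order 1 the derivative criterion involves only \<alpha> = 0, that is, the value f p -
  p = 0; the linear bound near \<open>p\<close> comes out of it.\<close>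

lemma fixed_point_lipschitz: "vanishes_to_order UNIV p 1 (\<lambda>x. f x - p)"
  unfolding vanishes_to_order_iff_multi_deriv[OF open_\<Omega> p_mem C_infinity_on_diff_const[OF f_smooth]]
proof (intro allI impI)
  fix \<alpha> :: "'d \<Rightarrow> nat" assume "sum \<alpha> UNIV < 1"
  then have "\<alpha> i = 0" for i by simp
  then have "foldr (\<lambda>i. partial_deriv i ^^ \<alpha> i) is g = g" for "is" and g :: "real^'d \<Rightarrow> real^'d"
    by (induction "is") simp_all
  then show "multi_deriv \<alpha> (\<lambda>x. f x - p) p = 0" by (simp add: multi_deriv_def f_fix)
qed

lemma vanishes_to_order_comp_op:
  assumes van: "vanishes_to_order UNIV p M h"
  shows "vanishes_to_order UNIV p M (comp_op \<Omega> f h)"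
proof -
  obtain C \<delta> where C: "0 \<le> C" and \<delta>: "0 < \<delta>"
    and h: "\<forall>t. (\<forall>i. i \<notin> UNIV \<longrightarrow> vec_nth t i = 0) \<and> norm t \<le> \<delta> \<longrightarrow> cmod (h (p + t)) \<le> C * norm t ^ M"
    using van unfolding vanishes_to_order_def by (elim exE conjE) (rule that)
  obtain L \<eta> where L: "0 \<le> L" and \<eta>: "0 < \<eta>"
    and f: "\<forall>t. (\<forall>i. i \<notin> UNIV \<longrightarrow> vec_nth t i = 0) \<and> norm t \<le> \<eta> \<longrightarrow> norm (f (p + t) - p) \<le> L * norm t ^ 1"
    using fixed_point_lipschitz unfolding vanishes_to_order_def by (elim exE conjE) (rule that)
  \<comment> \<open>The displacement of the image, at most L |t|, has to stay within \<delta>; L + 1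
    keeps the quotient meaningful for L = 0.\<close>
  define \<epsilon> where "\<epsilon> = min \<eta> (\<delta> / (L + 1))"
  have \<epsilon>: "0 < \<epsilon>" using \<eta> \<delta> L by (simp add: \<epsilon>_def)
  have main: "cmod (comp_op \<Omega> f h (p + t)) \<le> (C * L ^ M) * norm t ^ M" if t: "norm t \<le> \<epsilon>" for t
  proof -
    have t1: "norm t \<le> \<eta>" using t by (simp add: \<epsilon>_def)
    have "norm t \<le> \<delta> / (L + 1)" using t by (simp add: \<epsilon>_def)
    then have t2: "norm t * (L + 1) \<le> \<delta>" using L by (simp add: pos_le_divide_eq)
    define s where "s = f (p + t) - p"
    have s: "norm s \<le> L * norm t" using f t1 by (simp add: s_def)
    also have "\<dots> \<le> norm t * (L + 1)" by (simp add: algebra_simps)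
    finally have "norm s \<le> \<delta>" using t2 by linarith
    then have "cmod (h (p + s)) \<le> C * norm s ^ M" using h by simp
    also have "\<dots> \<le> C * (L * norm t) ^ M" using C s by (intro mult_left_mono power_mono) auto
    finally have "cmod (h (f (p + t))) \<le> (C * L ^ M) * norm t ^ M"
      by (simp add: s_def power_mult_distrib)
    \<comment> \<open>Where p + t leaves \<Omega>, \<open>comp_op\<close> is 0 by convention and the
      bound is trivial.\<close>
    moreover have "0 \<le> (C * L ^ M) * norm t ^ M" using C L by simp
    ultimately show ?thesis by (simp add: comp_op_def)
  qed
  have "0 \<le> C * L ^ M" using C L by simp
  then show ?thesis
    unfolding vanishes_to_order_def
    by (intro exI[of _ "C * L ^ M"] exI[of _ \<epsilon>] conjI \<epsilon> allI impI) (auto intro: main)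
qed

lemma comp_adj_V_space:
  assumes basis: "indexed_basis v {..<r} (V_space k p m)" and g: "g \<in> V_space k p m"
  shows "comp_adj \<Omega> H ip f g \<in> V_space k p m"
    and "h \<in> comp_dom \<Omega> H f \<Longrightarrow> ip (comp_op \<Omega> f h) g = ip h (comp_adj \<Omega> H ip f g)"
proof -
  let ?C = "comp_op \<Omega> f"
  let ?V = "V_space k p m"
  \<comment> \<open>The element u of V_{p,m} with <v_i, u> = <C v_i, g> for all basis vectors. The
    conjugate appears because the moment problem is posed with u in the first slot.\<close>
  define u where "u = lin_comb v r (mat_inv (gram_mat ip v r) *\<^sub>v Matrix.vec r (\<lambda>i. cnj (ip (?C (v i)) g)))"
  have u: "u \<in> ?V" unfolding u_def by (rule lin_comb_mem[OF basis])
  have uH: "u \<in> H" and gH: "g \<in> H" using u g V_subset by auto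
  have vH: "v i \<in> H" and CvH: "?C (v i) \<in> H" if "i < r" for i
    using indexed_basis_mem[OF basis that] V_dom by (auto simp: comp_dom_def)
  have rep_v: "ip (v i) u = ip (?C (v i)) g" if i: "i < r" for i
  proof -
    have "ip u (v i) = cnj (ip (?C (v i)) g)"
      unfolding u_def using lin_comb_gram_inv[OF basis V_subset, of "Matrix.vec r (\<lambda>i. cnj (ip (?C (v i)) g))" i] i
      by simp
    then show ?thesis using ip_cnj[OF vH[OF i] uH] by simp
  qed
  have rep_V: "ip (?C w) g = ip w u" if w: "w \<in> ?V" for w
  proof (rule indexed_basis_lin_comb[OF basis w])
    fix c assume "w = lin_comb v r c"
    then show ?thesis
      using ip_lin_comb_left[of r "\<lambda>i. ?C (v i)" g c] ip_lin_comb_left[of r v u c] vH CvH uH gH rep_v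
      by (simp add: comp_op_lin_comb)
  qed
  have rep: "ip (?C h) g = ip h u" if h: "h \<in> comp_dom \<Omega> H f" for h
  proof -
    have hH: "h \<in> H" "?C h \<in> H" using h by (auto simp: comp_dom_def)
    \<comment> \<open>On the component z in V_{p,m} the identity is linear algebra. The rest h - z
      is orthogonal to V_{p,m}, hence so is its composition with \<open>f\<close>, and both sides
      vanish there.\<close>
    define z where "z = orth_proj ip ?V h"
    have z: "z \<in> ?V" unfolding z_def by (rule orth_proj(1)[OF basis V_subset hH(1)])
    have zH: "z \<in> H" "?C z \<in> H" using z V_dom by (auto simp: comp_dom_def)
    have orth: "\<forall>w\<in>?V. ip (h - z) w = 0"
      unfolding z_def using orth_proj(2)[OF basis V_subset hH(1)] by blast
    then have "vanishes_to_order UNIV p (Suc m) (h - z)"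
      using orthogonal_V_iff[of "h - z" m] hH zH by simp
    then have "vanishes_to_order UNIV p (Suc m) (?C h - ?C z)"
      using vanishes_to_order_comp_op[of "Suc m" "h - z"] by (simp add: comp_op_diff)
    then have "ip (?C h - ?C z) g = 0"
      using orthogonal_V_iff[of "?C h - ?C z" m] hH zH g by simp
    moreover have "ip (h - z) u = 0" using orth u by blast
    ultimately show ?thesis
      using rep_V[OF z] hH zH uH gH by (simp add: ip_diff_left)
  qed
  have "comp_adj \<Omega> H ip f g = u"
    unfolding comp_adj_def adjoint_op_def
  proof (rule the_equality)
    show "u \<in> H \<and> (\<forall>h\<in>comp_dom \<Omega> H f. ip (?C h) g = ip h u)" using uH rep by blast
    fix u' assume u': "u' \<in> H \<and> (\<forall>h\<in>comp_dom \<Omega> H f. ip (?C h) g = ip h u')"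
    have "u' - u = 0"
    proof (rule orthogonal_all_V_imp_zero)
      show "u' - u \<in> H" using u' uH by simp
      fix n w assume "w \<in> V_space k p n"
      then have w: "w \<in> comp_dom \<Omega> H f" "w \<in> H" using V_dom V_subset by blast+
      have "ip w (u' - u) = 0"
        using u' rep[OF w(1)] w uH by (simp add: ip_diff_right)
      then show "ip (u' - u) w = 0" using ip_cnj[of "u' - u" w] u' uH w by simp
    qed
    then show "u' = u" by simp
  qed
  then show "comp_adj \<Omega> H ip f g \<in> ?V"
    and "h \<in> comp_dom \<Omega> H f \<Longrightarrow> ip (?C h) g = ip h (comp_adj \<Omega> H ip f g)"
    using u rep by simp_all
qed

end

end

section \<open>The estimation error\<close>

text \<open>Otherwise the basis vector of V_{p,m} with index r_n would lie in V_{p,n}, the span of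
  the vectors with smaller index, against independence.\<close>

lemma adapted_basis_dim_mono:
  assumes basis: "adapted_basis k p v" and "m \<le> n"
  shows "V_dim k p m \<le> V_dim k p n"
proof (rule ccontr)
  let ?r = "V_dim k p m" and ?R = "V_dim k p n"
  assume "\<not> ?r \<le> ?R"
  then have lt: "?R < ?r" by simp
  have br: "indexed_basis v {..<?r} (V_space k p m)" and bR: "indexed_basis v {..<?R} (V_space k p n)"
    using basis by (auto simp: adapted_basis_def)
  have "V_space k p m \<subseteq> V_space k p n"
    unfolding V_space_def using \<open>m \<le> n\<close> by (intro cfun.span_mono) auto
  then have "v ?R \<in> V_space k p n" using indexed_basis_mem[OF br lt] by blast
  then have "v ?R \<in> cfun.span (v ` {..<?R})" using bR by (simp add: indexed_basis_def)
  moreover have "v ` {..<?R} \<subseteq> v ` {..<?r} - {v ?R}"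
    using lt br by (auto simp: indexed_basis_def inj_on_def)
  ultimately have "v ?R \<in> cfun.span (v ` {..<?r} - {v ?R})" using cfun.span_mono by blast
  moreover have "v ?R \<in> v ` {..<?r}" using lt by blast
  ultimately show False using br by (auto simp: indexed_basis_def cfun.dependent_def)
qed

text \<open>The entries of D^H w are the values at the data points of the function h with
  coefficients w. If D D^H w = 0 then D^H w = 0, so h is orthogonal to the kernels k_{x_j} and,
  lying in \<open>V\<close>, to their projections; these span \<open>V\<close>, hence h = 0.\<close>

lemma (in rkhs) data_mat_gram_injective:
  assumes basis: "indexed_basis v {..<R} V" and VH: "V \<subseteq> H" and X: "\<forall>i<N. X i \<in> \<Omega>"
    and span: "cfun.span ((\<lambda>i. orth_proj ip V (k (X i))) ` {..<N}) = V"
  shows "\<forall>w\<in>carrier_vec R. (data_mat v R N X * mat_adjoint (data_mat v R N X)) *\<^sub>v w = 0\<^sub>v R \<longrightarrow> w = 0\<^sub>v R"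
proof (intro ballI impI)
  let ?D = "data_mat v R N X"
  fix w :: "complex Matrix.vec"
  assume w: "w \<in> carrier_vec R" and z: "(?D * mat_adjoint ?D) *\<^sub>v w = 0\<^sub>v R"
  have D: "?D \<in> carrier_mat R N" by (simp add: data_mat_def)
  define u where "u = mat_adjoint ?D *\<^sub>v w"
  have u: "u \<in> carrier_vec N" unfolding u_def by (rule mult_mat_vec_carrier[OF mat_adjoint_carrier[OF D] w])
  have "u \<bullet>c u = (?D *\<^sub>v u) \<bullet>c w"
    using cscalar_prod_adjoint[OF D u w] by (simp only: u_def)
  also have "?D *\<^sub>v u = 0\<^sub>v R"
    unfolding u_def assoc_mult_mat_vec[OF D mat_adjoint_carrier[OF D] w, symmetric] by (rule z)
  finally have "u \<bullet>c u = 0" using w by (simp add: cscalar_prod_sum)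
  then have "u = 0\<^sub>v N" using cvec_norm_eq_0[OF u] by (simp add: cvec_norm_sq)
  define h where "h = lin_comb v R w"
  have hV: "h \<in> V" unfolding h_def by (rule lin_comb_mem[OF basis])
  have hH: "h \<in> H" using hV VH by blast
  have "ip h (orth_proj ip V (k (X j))) = 0" if j: "j < N" for j
  proof -
    have kX: "k (X j) \<in> H" using X j kernel_mem by blast
    note P = orth_proj[OF basis VH kX]
    have PH: "orth_proj ip V (k (X j)) \<in> H" using P(1) VH by blast
    have "vec_index u j = h (X j)"
      using w j by (simp add: u_def h_def lin_comb_apply data_mat_def scalar_prod_def atLeast0LessThan mult.commute)
    then have "ip h (k (X j)) = 0"
      using reproducing[OF hH] X j \<open>u = 0\<^sub>v N\<close> by simp
    moreover have "ip h (k (X j) - orth_proj ip V (k (X j))) = 0"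
      using P(2)[OF hV] ip_cnj[OF hH diff_mem[OF kX PH]] by simp
    ultimately show ?thesis using ip_diff_right[OF kX PH hH] by simp
  qed
  then have "(\<lambda>i. orth_proj ip V (k (X i))) ` {..<N} \<subseteq> {w \<in> H. ip h w = 0}"
    using orth_proj(1)[OF basis VH] X kernel_mem VH by blast
  from cfun.span_minimal[OF this subspace_orthogonal[OF hH]]
  have "V \<subseteq> {w \<in> H. ip h w = 0}" unfolding span .
  then have "ip h h = 0" using hV by blast
  then have "hnorm ip h = 0" by (simp add: hnorm_def)
  then have "h = 0" by (simp only: hnorm_eq_0_iff[OF hH])
  then show "w = 0\<^sub>v R" unfolding h_def by (rule lin_comb_eq_0[OF basis w])
qed

text \<open>Replacing each \<open>k (X j)\<close> by its projection in the data matrix makes the estimator exact;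
  the columns of \<open>Q\<close> measure the projection errors.\<close>

lemma (in analytic_rkhs) estimator_error:
  fixes f :: "real^'d \<Rightarrow> real^'d" and n m N :: nat
  assumes f: "f ` \<Omega> \<subseteq> \<Omega>" "C_infinity_on \<Omega> f" "f p = p" "\<And>n. V_space k p n \<subseteq> comp_dom \<Omega> H f"
    and basis_m: "indexed_basis v {..<r} (V_space k p m)"
    and basis_n: "indexed_basis v {..<R} (V_space k p n)" and rR: "r \<le> R"
    and X: "\<forall>i<N. X i \<in> \<Omega>" and Y: "\<forall>i<N. Y i = f (X i)"
    and span: "cfun.span ((\<lambda>i. orth_proj ip (V_space k p n) (k (X i))) ` {..<N}) = V_space k p n"
  defines "D \<equiv> data_mat v R N X"
    and "Q \<equiv> Matrix.mat r N (\<lambda>(l, j). ip (k (X j) - orth_proj ip (V_space k p n) (k (X j))) (comp_op \<Omega> f (v l)))"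
  shows "matrix_in_basis v r (comp_adj \<Omega> H ip f) - C_hat ip v r R N X Y =
    - (mat_inv (gram_mat ip v r) * (Q * (mat_adjoint D * mat_inv (D * mat_adjoint D) * gram_mat ip v R * truncation R r)))"
proof -
  let ?C = "comp_op \<Omega> f" and ?W = "truncation R r" and ?Vm = "V_space k p m" and ?Vn = "V_space k p n"
  define G Gm DY where "G = gram_mat ip v R" and "Gm = gram_mat ip v r" and "DY = data_mat v r N Y"
  define K where "K = mat_inv (D * mat_adjoint D)"
  define Z where "Z = mat_adjoint D * K * G * ?W"
  define T where "T = matrix_in_basis v r (comp_adj \<Omega> H ip f)"
  \<comment> \<open>Inner products of the basis of V_{p,n} with the images C v_l; the exact matrix
    and the projected data are both expressed through them.\<close>
  define B where "B = Matrix.mat r R (\<lambda>(l, i). ip (v i) (?C (v l)))"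
  have D: "D \<in> carrier_mat R N" and DY: "DY \<in> carrier_mat r N" and Q: "Q \<in> carrier_mat r N"
    and G: "G \<in> carrier_mat R R" and Gm: "Gm \<in> carrier_mat r r" and T: "T \<in> carrier_mat r r"
    and B: "B \<in> carrier_mat r R"
    by (simp_all add: D_def DY_def Q_def G_def Gm_def T_def B_def data_mat_def matrix_in_basis_def)
  have D': "mat_adjoint D \<in> carrier_mat N R" using D by simp
  have DD: "D * mat_adjoint D \<in> carrier_mat R R" by (rule mult_carrier_mat[OF D D'])
  have inj: "\<forall>w\<in>carrier_vec R. (D * mat_adjoint D) *\<^sub>v w = 0\<^sub>v R \<longrightarrow> w = 0\<^sub>v R"
    unfolding D_def by (rule data_mat_gram_injective[OF basis_n V_subset X span])
  note K = mat_inv[OF DD inj, folded K_def]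
  note Gi = gram_mat_inv[OF basis_n V_subset, folded G_def]
  note Gmi = gram_mat_inv[OF basis_m V_subset, folded Gm_def]
  note dims [simp] = carrier_matD[OF D] carrier_matD[OF DY] carrier_matD[OF Q] carrier_matD[OF G]
    carrier_matD[OF Gm] carrier_matD[OF T] carrier_matD[OF B] carrier_matD[OF K(1)]
    carrier_matD[OF Gi(1)] carrier_matD[OF Gmi(1)]
  have Z: "Z \<in> carrier_mat N r" by (rule carrier_matI) (simp_all add: Z_def)
  have kX: "k (X j) \<in> H" "X j \<in> \<Omega>" if "j < N" for j using X that kernel_mem by blast+
  have vH: "v i \<in> H" if "i < R" for i by (rule basis_mem_H[OF basis_n V_subset that])
  have CvH: "?C (v l) \<in> H" if "l < r" for l
    using indexed_basis_mem[OF basis_m that] f(4) by (auto simp: comp_dom_def)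
  have C_hat: "C_hat ip v r R N X Y = mat_inv Gm * (DY * Z)"
  proof -
    have "pinv D = mat_adjoint D * K" by (rule pinv_full_row_rank[OF D K])
    then have "C_hat ip v r R N X Y = leading_block r (mat_inv Gm * DY * (mat_adjoint D * K) * G)"
      by (simp add: C_hat_def D_def DY_def G_def Gm_def)
    also have "\<dots> = mat_inv Gm * DY * (mat_adjoint D * K) * G * ?W"
      by (rule leading_block_truncation_right[OF _ rR]) (rule carrier_matI; simp)
    also have "\<dots> = mat_inv Gm * (DY * Z)" by (simp add: Z_def mat_mult_assoc)
    finally show ?thesis .
  qed
  \<comment> \<open>Entry (l, j) compares <C^H v_j, v_l> with <v_j, C v_l>, where C^H is the
    adjoint.\<close>
  have GmT: "Gm * T = B * ?W"
  proof (rule eq_matI)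
    fix l j assume "l < dim_row (B * ?W)" "j < dim_col (B * ?W)"
    then have l: "l < r" and j: "j < r" by simp_all
    let ?g = "comp_adj \<Omega> H ip f (v j)"
    note adj = comp_adj_V_space[OF f basis_m indexed_basis_mem[OF basis_m j]]
    have vl: "v l \<in> comp_dom \<Omega> H f" using indexed_basis_mem[OF basis_m l] f(4) by blast
    have gH: "?g \<in> H" using adj(1) V_subset by blast
    show "(Gm * T) $$ (l, j) = (B * ?W) $$ (l, j)"
    proof (rule indexed_basis_lin_comb[OF basis_m adj(1)])
      fix c assume c: "c \<in> carrier_vec r" and g: "?g = lin_comb v r c"
      have col: "Matrix.col T j = c"
        using c j representation_lin_comb[OF basis_m c] by (intro eq_vecI) (simp_all add: T_def matrix_in_basis_def g)
      have "(Gm * T) $$ (l, j) = vec_index (Gm *\<^sub>v c) l" using l j by (simp add: col)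
      also have "\<dots> = ip ?g (v l)"
        unfolding Gm_def g by (rule gram_mat_mult_vec[OF basis_m V_subset c l])
      also have "\<dots> = cnj (ip (?C (v l)) (v j))"
        using ip_cnj[OF gH vH[of l]] adj(2)[OF vl] l rR by simp
      also have "\<dots> = ip (v j) (?C (v l))"
        using ip_cnj[OF vH[of j] CvH[OF l]] j rR by simp
      also have "\<dots> = (B * ?W) $$ (l, j)"
        using l j rR by (simp add: mult_truncation_index[of B R r] del: index_mult_mat(1)) (simp add: B_def)
      finally show ?thesis .
    qed
  qed simp_all
  \<comment> \<open>By the reproducing property \<open>DY\<close> has the entries <k_{x_j}, C v_l>.
    Subtracting \<open>Q\<close> leaves the same with projected kernels, whose coordinates are the
    columns of G^{-1} D.\<close>
  have BGD: "B * (mat_inv G * D) = DY - Q"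
  proof (rule eq_matI)
    fix l j assume "l < dim_row (DY - Q)" "j < dim_col (DY - Q)"
    then have l: "l < r" and j: "j < N" by simp_all
    let ?k = "k (X j)"
    define a where "a = mat_inv G *\<^sub>v Matrix.col D j"
    have a: "a \<in> carrier_vec R"
      unfolding a_def by (rule mult_mat_vec_carrier[OF Gi(1)]) (simp add: carrier_vecI)
    have "Matrix.col D j = Matrix.vec R (\<lambda>i. ip ?k (v i))"
      using j reproducing[OF vH kX(2)[OF j]] ip_cnj[OF kX(1)[OF j] vH]
      by (intro eq_vecI) (simp_all add: D_def data_mat_def)
    then have proj: "orth_proj ip ?Vn ?k = lin_comb v R a"
      unfolding a_def G_def using orth_proj_lin_comb[OF basis_n V_subset kX(1)[OF j]] by simp
    have PH: "lin_comb v R a \<in> H" by (rule lin_comb_mem_H[OF basis_n V_subset])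
    have "DY $$ (l, j) = cnj (?C (v l) (X j))"
      using l j Y kX(2)[OF j] by (simp add: DY_def data_mat_def comp_op_def)
    also have "\<dots> = ip ?k (?C (v l))"
      using reproducing[OF CvH[OF l] kX(2)[OF j]] ip_cnj[OF kX(1)[OF j] CvH[OF l]] by simp
    finally have "(DY - Q) $$ (l, j) = ip ?k (?C (v l)) - ip (?k - lin_comb v R a) (?C (v l))"
      using l j by (simp add: Q_def proj)
    also have "\<dots> = ip (lin_comb v R a) (?C (v l))"
      using ip_diff_left[OF kX(1)[OF j] PH CvH[OF l]] by simp
    also have "\<dots> = (\<Sum>i<R. vec_index a i * ip (v i) (?C (v l)))"
      by (rule ip_lin_comb_left[OF vH CvH[OF l]])
    also have "\<dots> = (\<Sum>i<R. B $$ (l, i) * vec_index a i)"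
      using l by (intro sum.cong) (simp_all add: B_def)
    also have "\<dots> = (B * (mat_inv G * D)) $$ (l, j)"
      using l j a by (simp add: scalar_prod_def atLeast0LessThan a_def)
    finally show "(B * (mat_inv G * D)) $$ (l, j) = (DY - Q) $$ (l, j)" ..
  qed simp_all
  \<comment> \<open>As \<open>K\<close> inverts D D^H, the product D Z is G W, and B G^{-1} turns it
    into B W, the exact value.\<close>
  have "(DY - Q) * Z = B * (mat_inv G * (D * mat_adjoint D * K * (G * ?W)))"
    unfolding BGD[symmetric] Z_def by (simp add: mat_mult_assoc)
  also have "mat_inv G * (D * mat_adjoint D * K * (G * ?W)) = mat_inv G * G * ?W"
    unfolding K(2) by (simp add: mat_mult_assoc)
  also have "\<dots> = ?W" unfolding Gi(3) by simp
  finally have exact: "(DY - Q) * Z = Gm * T" unfolding GmT .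
  have "T = mat_inv Gm * (Gm * T)"
    using Gmi(3) by (simp flip: mat_mult_assoc)
  also have "\<dots> = mat_inv Gm * (DY * Z - Q * Z)"
    unfolding exact[symmetric] minus_mult_distrib_mat[OF DY Q Z] ..
  also have "\<dots> = mat_inv Gm * (DY * Z) - mat_inv Gm * (Q * Z)"
    by (rule mult_minus_distrib_mat[OF Gmi(1) mult_carrier_mat[OF DY Z] mult_carrier_mat[OF Q Z]])
  finally have "T - C_hat ip v r R N X Y = - (mat_inv Gm * (Q * Z))"
    unfolding C_hat
  proof (intro eq_matI)
    fix i j assume *: "T = mat_inv Gm * (DY * Z) - mat_inv Gm * (Q * Z)"
      and ij: "i < dim_row (- (mat_inv Gm * (Q * Z)))" "j < dim_col (- (mat_inv Gm * (Q * Z)))"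
    show "(T - mat_inv Gm * (DY * Z)) $$ (i, j) = (- (mat_inv Gm * (Q * Z))) $$ (i, j)"
      using ij arg_cong[OF *, of "\<lambda>M. M $$ (i, j)"] Z by (simp del: index_mult_mat(1))
  qed (use Z in simp_all)
  then show ?thesis unfolding T_def Gm_def Z_def K_def G_def .
qed

theorem theorem3p5:
  fixes \<Omega> :: "(real^'d::finite) set"
    and H :: "(real^'d \<Rightarrow> complex) set"
    and ip :: "(real^'d \<Rightarrow> complex) \<Rightarrow> (real^'d \<Rightarrow> complex) \<Rightarrow> complex"
    and k :: "real^'d \<Rightarrow> real^'d \<Rightarrow> complex"
    and f :: "real^'d \<Rightarrow> real^'d"
    and p :: "real^'d"
    and v :: "nat \<Rightarrow> real^'d \<Rightarrow> complex"
    and m n N :: nat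
    and X Y :: "nat \<Rightarrow> real^'d"
  assumes "open \<Omega>" and "connected \<Omega>"
    and "rkhs \<Omega> H ip k"
    and "continuously_included_smooth \<Omega> H ip"
    and "\<forall>h\<in>H. real_analytic_on \<Omega> h"
    and "f ` \<Omega> \<subseteq> \<Omega>" and "C_infinity_on \<Omega> f"
    and "p \<in> \<Omega>" and "f p = p"
    and "(\<Union>j. V_space k p j) \<subseteq> comp_dom \<Omega> H f"
    and "adapted_basis k p v"
    and "m \<le> n"
    and "\<forall>i<N. X i \<in> \<Omega>" and "\<forall>i<N. Y i \<in> \<Omega>" and "\<forall>i<N. Y i = f (X i)"
    and "V_dim k p n \<le> N"
    and "cfun.span ((\<lambda>i. orth_proj ip (V_space k p n) (k (X i))) ` {..<N}) = V_space k p n"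
  shows "frobenius_norm
           (matrix_in_basis v (V_dim k p m) (comp_adj \<Omega> H ip f)
             - C_hat ip v (V_dim k p m) (V_dim k p n) N X Y)
         \<le> op_norm_on ip (V_space k p m) (comp_op \<Omega> f)
           * mat_op_norm (mat_sqrt (mat_inv (gram_mat ip v (V_dim k p m))))
           * sqrt (mat_op_norm (E_mat ip v (V_dim k p m) (V_dim k p n) N X))
           * sqrt (1 / real N * (\<Sum>i<N. (proj_error ip (V_space k p n) (k (X i)))\<^sup>2))"
proof -
  have dom: "V_space k p j \<subseteq> comp_dom \<Omega> H f" for j using assms(10) by blast
  have VH: "V_space k p j \<subseteq> H" for j using dom[of j] by (auto simp: comp_dom_def)
  interpret analytic_rkhs \<Omega> H ip k p
    using assms(1-5,8) VH by (intro analytic_rkhs.intro analytic_rkhs_axioms.intro) auto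
  define r R where "r = V_dim k p m" and "R = V_dim k p n"
  have basis_m: "indexed_basis v {..<r} (V_space k p m)" and basis_n: "indexed_basis v {..<R} (V_space k p n)"
    using assms(11) by (auto simp: adapted_basis_def r_def R_def)
  have rR: "r \<le> R" unfolding r_def R_def by (rule adapted_basis_dim_mono[OF assms(11,12)])
  define S where "S = mat_sqrt (mat_inv (gram_mat ip v r))"
  define L where "L = op_norm_on ip (V_space k p m) (comp_op \<Omega> f)"
  define E where "E = E_mat ip v r R N X"
  define err where "err i = proj_error ip (V_space k p n) (k (X i))" for i
  have CH: "comp_op \<Omega> f h \<in> H" if "h \<in> V_space k p m" for h
    using that dom by (auto simp: comp_dom_def)
  have L0: "0 \<le> L"
    unfolding L_def
    by (rule op_norm_on_bound(2)[OF basis_m VH CH comp_op_add comp_op_scale lin_comb_mem[OF basis_m]])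
  show ?thesis
    unfolding r_def[symmetric] R_def[symmetric] S_def[symmetric] L_def[symmetric] E_def[symmetric] err_def[symmetric]
  proof (cases "N = 0")
    \<comment> \<open>Without data points r_n \<le> N forces r = 0, so the matrix on the left is
      empty; on the right 1/0 = 0 and the sum is empty.\<close>
    case True
    then have "r = 0" using rR assms(16) by (simp add: R_def)
    then have "frobenius_norm (matrix_in_basis v r (comp_adj \<Omega> H ip f) - C_hat ip v r R N X Y) = 0"
      by (simp add: frobenius_norm_def C_hat_def leading_block_def)
    then show "frobenius_norm (matrix_in_basis v r (comp_adj \<Omega> H ip f) - C_hat ip v r R N X Y)
        \<le> L * mat_op_norm S * sqrt (mat_op_norm E) * sqrt (1 / real N * (\<Sum>i<N. (err i)\<^sup>2))"
      using L0 True by simp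
  next
    case False
    then have N: "0 < N" by simp
    define D where "D = data_mat v R N X"
    define Z where "Z = mat_adjoint D * mat_inv (D * mat_adjoint D) * gram_mat ip v R * truncation R r"
    define e where "e j = k (X j) - orth_proj ip (V_space k p n) (k (X j))" for j
    define Q where "Q = Matrix.mat r N (\<lambda>(l, j). ip (e j) (comp_op \<Omega> f (v l)))"
    have kX: "k (X j) \<in> H" if "j < N" for j using assms(13) that kernel_mem by blast
    have D: "D \<in> carrier_mat R N" by (simp add: D_def data_mat_def)
    have inj: "\<forall>w\<in>carrier_vec R. (D * mat_adjoint D) *\<^sub>v w = 0\<^sub>v R \<longrightarrow> w = 0\<^sub>v R"
      unfolding D_def by (rule data_mat_gram_injective[OF basis_n VH assms(13,17)])
    have Z: "Z \<in> carrier_mat N r" unfolding Z_def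
      by (rule carrier_matI) (simp_all add: D_def data_mat_def)
    have Q: "Q \<in> carrier_mat r N" by (simp add: Q_def)
    note Gi = gram_mat_inv[OF basis_m VH]
    note S = mat_sqrt[OF Gi(1) gram_mat_inv_psd[OF basis_m VH], folded S_def]
    have Z_bound: "cvec_norm (Z *\<^sub>v w) \<le> sqrt (mat_op_norm E / real N) * cvec_norm w" if "w \<in> carrier_vec r" for w
      unfolding Z_def E_def E_mat_def D_def[symmetric]
      by (rule regression_operator_bound[OF D gram_mat_carrier gram_mat_adjoint[OF basis_n VH] inj N rR that])
    \<comment> \<open>Column j belongs to the projection error of k_{x_j} alone, so the bound is
      summed over the data points.\<close>
    have SQ: "frobenius_norm (S * Q) \<le> L * sqrt (\<Sum>i<N. (err i)\<^sup>2)"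
    proof (rule power2_le_imp_le)
      have "(frobenius_norm (S * Q))\<^sup>2 = (\<Sum>j<N. (cvec_norm (S *\<^sub>v Matrix.col Q j))\<^sup>2)"
        unfolding frobenius_norm_cols[OF mult_carrier_mat[OF S(1) Q]]
        using col_mult2[OF S(1) Q] by simp
      also have "\<dots> \<le> (\<Sum>j<N. (L * err j)\<^sup>2)"
      proof (intro sum_mono power_mono)
        fix j assume "j \<in> {..<N}"
        then have j: "j < N" by simp
        have eH: "e j \<in> H" unfolding e_def
          by (rule diff_mem[OF kX[OF j] subsetD[OF VH orth_proj(1)[OF basis_n VH kX[OF j]]]])
        have "Matrix.col Q j = Matrix.vec r (\<lambda>l. ip (e j) (comp_op \<Omega> f (v l)))"
          using j by (intro eq_vecI) (simp_all add: Q_def)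
        then have "cvec_norm (S *\<^sub>v Matrix.col Q j) \<le> L * hnorm ip (e j)"
          unfolding S_def L_def using cvec_norm_sqrt_gram_le[OF basis_m VH CH eH] by simp
        also have "\<dots> \<le> L * err j"
          unfolding e_def err_def by (intro mult_left_mono hnorm_orth_proj_le[OF basis_n VH kX[OF j]] L0)
        finally show "cvec_norm (S *\<^sub>v Matrix.col Q j) \<le> L * err j" .
      qed simp
      also have "\<dots> = (L * sqrt (\<Sum>i<N. (err i)\<^sup>2))\<^sup>2"
        by (simp add: power_mult_distrib sum_distrib_left sum_nonneg)
      finally show "(frobenius_norm (S * Q))\<^sup>2 \<le> (L * sqrt (\<Sum>i<N. (err i)\<^sup>2))\<^sup>2" .
    qed (simp add: L0 sum_nonneg)
    have "matrix_in_basis v r (comp_adj \<Omega> H ip f) - C_hat ip v r R N X Y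
        = - (mat_inv (gram_mat ip v r) * (Q * Z))"
      unfolding Z_def Q_def e_def D_def
      by (rule estimator_error[OF assms(6,7,9) dom basis_m basis_n rR assms(13,15,17)])
    also have "mat_inv (gram_mat ip v r) * (Q * Z) = S * ((S * Q) * Z)"
      unfolding S(3)[symmetric]
      using carrier_matD[OF S(1)] carrier_matD[OF Q] carrier_matD[OF Z] by (simp add: mat_mult_assoc)
    also have "frobenius_norm (- (S * ((S * Q) * Z))) = frobenius_norm (S * ((S * Q) * Z))"
      by (simp add: frobenius_norm_def del: index_mult_mat(1))
    also have "\<dots> \<le> mat_op_norm S * frobenius_norm ((S * Q) * Z)"
      by (rule frobenius_norm_mult_left[OF S(1) mult_carrier_mat[OF mult_carrier_mat[OF S(1) Q] Z] mat_op_norm_nonneg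
            cvec_norm_mult_le[OF S(1)]])
    also have "\<dots> \<le> mat_op_norm S * (frobenius_norm (S * Q) * sqrt (mat_op_norm E / real N))"
      by (intro mult_left_mono frobenius_norm_mult_right[OF mult_carrier_mat[OF S(1) Q] Z _ Z_bound]) simp_all
    also have "\<dots> \<le> mat_op_norm S * (L * sqrt (\<Sum>i<N. (err i)\<^sup>2) * sqrt (mat_op_norm E / real N))"
      by (intro mult_left_mono mult_right_mono SQ) simp_all
    \<comment> \<open>The factor 1/N, so far attached to \<open>E\<close>, moves to the sum of
      squared errors and makes it a mean.\<close>
    also have "\<dots> = L * mat_op_norm S * sqrt (mat_op_norm E) * sqrt (1 / real N * (\<Sum>i<N. (err i)\<^sup>2))"
      by (simp add: real_sqrt_divide real_sqrt_mult)
    finally show "frobenius_norm (matrix_in_basis v r (comp_adj \<Omega> H ip f) - C_hat ip v r R N X Y)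
        \<le> L * mat_op_norm S * sqrt (mat_op_norm E) * sqrt (1 / real N * (\<Sum>i<N. (err i)\<^sup>2))" .
  qed
qed

end
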